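(* Let a dynamic programming problem with value functions $V_{t_u}$, $u=0,\ldots,n$, and its Dynamic Chebyshev approximations $\widehat{V}_{t_u}$ be given as in the context, with $f$ Lipschitz continuous with constant $L_f$. Assume: (1) (Analyticity) for each $u=1,\ldots,n$ the function $\mathcal{X}\ni x\mapsto V_{t_u}(x)$ is real valued and has an analytic extension to a generalized Bernstein ellipse $\mathcal{B}(\mathcal{X},\varrho_{t_u})$ with $\varrho_{t_u}\in(1,\infty)^D$ and $\sup_{x\in\mathcal{B}(\mathcal{X},\varrho_{t_u})}|V_{t_u}(x)|\le B_{t_u}$; (2) (Truncation) there is a constant $\varepsilon_{tr}\ge0$ with $\big|\mathbb{E}[V_{t_{u+1}}(X_{t_{u+1}})\mathbf{1}_{\mathbb{R}^D\setminus\mathcal{X}}(X_{t_{u+1}})\mid X_{t_u}=x^k]\big|\le\varepsilon_{tr}$ for all $u=0,\ldots,n-1$ and $k\in\mathcal{J}$; (3) (Generalized moments) the approximations $\widehat{\Gamma}^k_{t_u}$ of the conditional expectation operators $\Gamma^k_{t_u}$ satisfy either the deterministic condition (GM) with constant $\overline{\delta}$, in which case put $\varepsilon_{gm}=\overline{\delta}$, or the stochastic condition (GM$^*$) with bound $\delta^\star(M)$, in which case put $\varepsilon_{gm}=\delta^\star(M)$. Then for every $u=1,\ldots,n$ the error $\varepsilon_{t_u}:=\max_{x\in\mathcal{X}}\mathbb{E}\big[|V_{t_u}(x)-\widehat{V}_{t_u}(x)|\big]$ (which in the deterministic case (GM) is simply $\max_{x\in\mathcal{X}}|V_{t_u}(x)-\widehat{V}_{t_u}(x)|$)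 satisfies $$\varepsilon_{t_u}\le\sum_{j=u}^{n}C^{j-u}\varepsilon_{int}^{j}+\Lambda_{\overline{N}}L_f\sum_{j=u+1}^{n}C^{j-(u+1)}\big(\varepsilon_{tr}+\varepsilon_{gm}\overline{V}_j\big),$$ where $C=\Lambda_{\overline{N}}L_f(1+\varepsilon_{gm})$, $\overline{V}_j=\max_{x\in\mathcal{X}}|V_{t_j}(x)|$ and $\varepsilon_{int}^j=\varepsilon_{int}(\varrho_{t_j},N,D,B_{t_j})$.
   Context: **Dynamic programming problem.** $X=(X_t)_{0\le t\le T}$ is a Markov process with state space $\mathbb{R}^D$, and conditional expectations $\mathbb{E}[\,\cdot\mid X_{t_u}=x]$ are understood through its transition kernels. Let $t_0<\ldots<t_n=T$ be time points, $g:[0,T]\times\mathbb{R}^D\to\mathbb{R}$ continuous with $\mathbb{E}[\sup_{0\le t\le T}|g(t,X_t)|]<\infty$, and $f:\mathbb{R}\times\mathbb{R}\to\mathbb{R}$ Lipschitz continuous with constant $L_f$ in the sense $|f(x_1,y_1)-f(x_2,y_2)|\le L_f(|x_1-x_2|+|y_1-y_2|)$. The value functions are $$V_T(x)=g(T,x),\qquad V_{t_u}(x)=f\big(g(t_u,x),\mathbb{E}[V_{t_{u+1}}(X_{t_{u+1}})\mid X_{t_u}=x]\big),\quad u=n-1,\ldots,0,$$ the conditional expectations being assumed to exist. **Chebyshev interpolation.** $\mathcal{X}=[\underline{x}_1,\overline{x}_1]\times\ldots\times[\underline{x}_D,\overline{x}_D]$, $\overline{N}=(N_1,\ldots,N_D)$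 with integers $N_i\ge1$, $\mathcal{J}=\{j\in\mathbb{N}_0^D:0\le j_i\le N_i\}$. The affine map $\tau_{\mathcal{X}}:[-1,1]^D\to\mathcal{X}$ acts componentwise by $z_i\mapsto\overline{x}_i+\tfrac12(\underline{x}_i-\overline{x}_i)(1-z_i)$. $T_j(z)=\prod_iT_{j_i}(z_i)$, $T_m(y)=\cos(m\arccos y)$; $p_j(x)=T_j(\tau_{\mathcal{X}}^{-1}(x))\mathbf{1}_{\mathcal{X}}(x)$ (extended by $0$ outside $\mathcal{X}$). Nodes: $z^k=(\cos(\pi k_i/N_i))_{i=1}^D$, $x^k=\tau_{\mathcal{X}}(z^k)$, $k\in\mathcal{J}$. For values $h(x^k)$, $k\in\mathcal{J}$, the interpolant is $I_{\overline{N}}(h)=\sum_{j\in\mathcal{J}}c_jp_j$ with $c_j=\big(\prod_{i=1}^D\frac{2^{\mathbf{1}_{\{0<j_i<N_i\}}}}{N_i}\big)\sum_{k\in\mathcal{J}}''h(x^k)T_j(z^k)$, where $\sum''$ means the summand is multiplied by $1/2$ for each $i$ with $k_i\in\{0,N_i\}$; on $\mathcal{X}$ it is the unique tensor polynomial of degree $\le N_i$ in $x_i$ interpolating the values $h(x^k)$. Lebesgue constant: $\Lambda_{\overline{N}}=\max_{x\in\mathcal{X}}\sum_{j\in\mathcal{J}}|\lambda^j(x)|$, where $\lambda^j$ are the tensor-product Lagrange polynomials for the nodes $x^k$ (i.e. $\lambda^j(x^k)=1$ if $j=k$, $0$ otherwise). **Bernstein ellipses and interpolation bound.** For $r>1$,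 $\mathcal{B}([-1,1],r)\subset\mathbb{C}$ is the open region bounded by the ellipse with foci $\pm1$ whose semiaxis lengths sum to $r$; $\mathcal{B}([\underline{x},\overline{x}],r)$ is its image under $z\mapsto\overline{x}+\tfrac12(\underline{x}-\overline{x})(1-z)$; for $\varrho\in(1,\infty)^D$, $\mathcal{B}(\mathcal{X},\varrho)=\prod_{i=1}^D\mathcal{B}([\underline{x}_i,\overline{x}_i],\varrho_i)$. Further $$\varepsilon_{int}(\varrho,N,D,B):=2^{\frac D2+1}\cdot B\cdot\Big(\sum_{i=1}^D\varrho_i^{-2N_i}\prod_{j=1}^D\frac{1}{1-\varrho_j^{-2}}\Big)^{1/2}.$$ **Generalized moments.** $\Gamma^k_{t_u}(h):=\mathbb{E}[h(X_{t_{u+1}})\mid X_{t_u}=x^k]$, $u=0,\ldots,n-1$, $k\in\mathcal{J}$. Let $\mathcal{P}_{\overline{N}}(\mathcal{X})=\mathrm{span}\{p_j:j\in\mathcal{J}\}$ with norm $\|p\|_\infty=\max_{x\in\mathcal{X}}|p(x)|$. The operator $\Gamma^k_{t_u}$ is approximated on $\mathcal{P}_{\overline{N}}(\mathcal{X})$ by a linear operator $\widehat{\Gamma}^k_{t_u}:\mathcal{P}_{\overline{N}}(\mathcal{X})\to\mathbb{R}$, for which one of the following holds. (GM) The approximation is deterministic and for all $u=0,\ldots,n-1$, $k\in\mathcal{J}$: $\sup_{p\in\mathcal{P}_{\overline{N}}(\mathcal{X}),\,\|p\|_\infty=1}|\Gamma^k_{t_u}(p)-\widehat{\Gamma}^k_{t_u}(p)|\le\overline{\delta}$.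 (GM$^*$) The approximation is stochastic: $\widehat{\Gamma}^k_{t_u}$ is random (it uses $M$ samples of the underlying process), and the polynomials $p\in\mathcal{P}_{\overline{N}}(\mathcal{X})$ to which it is applied may have random coefficients; operators are applied to such $p$ realization-wise, by linearity in the coefficients ($\Gamma^k_{t_u}$ itself integrating only over the transition law of $X$). For all $u=0,\ldots,n-1$, $k\in\mathcal{J}$: $\sup_{p,\,\|p\|_\infty^\star=1}\mathbb{E}[|\Gamma^k_{t_u}(p)-\widehat{\Gamma}^k_{t_u}(p)|]\le\delta^\star(M)$, where $\|p\|_\infty^\star=\max_{x\in\mathcal{X}}\mathbb{E}[|p(x)|]$ and the supremum is over all polynomials in $\mathcal{P}_{\overline{N}}(\mathcal{X})$ with possibly random coefficients. **Dynamic Chebyshev method.** $\widehat{V}_T=I_{\overline{N}}(g(T,\cdot))$, and for $u=n-1,\ldots,0$ one sets the nodal values $\widehat{V}_{t_u}(x^k)=f\big(g(t_u,x^k),\widehat{\Gamma}^k_{t_u}(\widehat{V}_{t_{u+1}})\big)$, $k\in\mathcal{J}$, and lets $\widehat{V}_{t_u}\in\mathcal{P}_{\overline{N}}(\mathcal{X})$ be the Chebyshev interpolant of these nodal values. In the stochastic case $\widehat{V}_{t_u}$ is a polynomial with random coefficients. *)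

theory Defs
  imports "HOL-Probability.Probability"
begin

section \<open>Markov processes and their transition kernels\<close>

definition natural_filtration ::
    "'w measure \<Rightarrow> (real \<Rightarrow> 'w \<Rightarrow> 's::topological_space) \<Rightarrow> real \<Rightarrow> 'w measure" where
  "natural_filtration M X s =
     sigma (space M) {X r -` A \<inter> space M | r A. 0 \<le> r \<and> r \<le> s \<and> A \<in> sets borel}"

text \<open>\<open>K s t x\<close> is the law of \<open>X t\<close> given \<open>X s = x\<close>. The kernels are part of the data, since
  \<open>X\<close> determines them only up to null sets, whereas conditional expectations given
  \<open>X s = x\<close> are needed at individual points \<open>x\<close>.\<close>

definition markov_process ::
    "'w measure \<Rightarrow> real \<Rightarrow> (real \<Rightarrow> 'w \<Rightarrow> 's::topological_space)
      \<Rightarrow> (real \<Rightarrow> real \<Rightarrow> 's \<Rightarrow> 's measure) \<Rightarrow> bool" where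
  "markov_process M T X K \<longleftrightarrow>
     prob_space M \<and>
     (\<forall>s\<in>{0..T}. X s \<in> borel_measurable M) \<and>
     (\<forall>s t. 0 \<le> s \<and> s \<le> t \<and> t \<le> T \<longrightarrow>
        K s t \<in> borel \<rightarrow>\<^sub>M prob_algebra borel \<and>
        (\<forall>A\<in>sets borel. AE \<omega> in M.
           real_cond_exp M (natural_filtration M X s) (\<lambda>\<omega>. indicator A (X t \<omega>)) \<omega>
             = measure (K s t (X s \<omega>)) A))"


section \<open>Value functions\<close>

function value_fun ::
    "(real \<Rightarrow> real \<Rightarrow> real) \<Rightarrow> (real \<Rightarrow> 's \<Rightarrow> real) \<Rightarrow> (real \<Rightarrow> real \<Rightarrow> 's \<Rightarrow> 's measure)
      \<Rightarrow> (nat \<Rightarrow> real) \<Rightarrow> nat \<Rightarrow> nat \<Rightarrow> 's \<Rightarrow> real" where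
  "value_fun f g K t n u =
     (if n \<le> u then g (t n)
      else (\<lambda>x. f (g (t u) x) (\<integral>y. value_fun f g K t n (Suc u) y \<partial>K (t u) (t (Suc u)) x)))"
  by pat_completeness auto
termination by (relation "Wellfounded.measure (\<lambda>(f, g, K, t, n, u). n - u)") auto

declare value_fun.simps [simp del]


section \<open>Tensorized Chebyshev interpolation\<close>

text \<open>The map is needed on the real axis (interpolation) and in the complex plane (ellipses).\<close>

definition interval_map :: "real \<Rightarrow> real \<Rightarrow> 'a \<Rightarrow> 'a::real_field" where
  "interval_map a b z = of_real b + of_real ((a - b) / 2) * (1 - z)"

definition box_map :: "real^'d \<Rightarrow> real^'d \<Rightarrow> real^'d \<Rightarrow> real^'d" where
  "box_map xl xu z = (\<chi> i. interval_map (xl $ i) (xu $ i) (z $ i))"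

definition multi_indices :: "nat^'d \<Rightarrow> (nat^'d) set" where
  "multi_indices N = {j. \<forall>i. j $ i \<le> N $ i}"

definition cheb :: "nat \<Rightarrow> real \<Rightarrow> real" where
  "cheb m y = cos (real m * arccos y)"

definition cheb_tensor :: "nat^'d \<Rightarrow> real^'d \<Rightarrow> real" where
  "cheb_tensor j z = (\<Prod>i\<in>UNIV. cheb (j $ i) (z $ i))"

definition cheb_basis :: "real^'d \<Rightarrow> real^'d \<Rightarrow> nat^'d \<Rightarrow> real^'d \<Rightarrow> real" where
  "cheb_basis xl xu j x =
     cheb_tensor j (inv_into (cbox (-1) 1) (box_map xl xu) x) * indicator (cbox xl xu) x"

definition ref_node :: "nat^'d \<Rightarrow> nat^'d \<Rightarrow> real^'d" where
  "ref_node N k = (\<chi> i. cos (pi * real (k $ i) / real (N $ i)))"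

definition cheb_node :: "real^'d \<Rightarrow> real^'d \<Rightarrow> nat^'d \<Rightarrow> nat^'d \<Rightarrow> real^'d" where
  "cheb_node xl xu N k = box_map xl xu (ref_node N k)"

text \<open>The nodal values \<open>v k\<close> stand for \<open>h (cheb_node xl xu N k)\<close>; the factor
  \<open>(\<Prod>i. if k $ i \<in> {0, N $ i} then 1 / 2 else 1)\<close> is the halving in the double-primed sum.\<close>

definition cheb_coeff :: "nat^'d \<Rightarrow> (nat^'d \<Rightarrow> real) \<Rightarrow> nat^'d \<Rightarrow> real" where
  "cheb_coeff N v j =
     (\<Prod>i\<in>UNIV. 2 ^ (if 0 < j $ i \<and> j $ i < N $ i then 1 else 0) / real (N $ i)) *
     (\<Sum>k\<in>multi_indices N.
        (\<Prod>i\<in>UNIV. if k $ i \<in> {0, N $ i} then 1 / 2 else 1) * (v k * cheb_tensor j (ref_node N k)))"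

definition cheb_comb ::
    "real^'d \<Rightarrow> real^'d \<Rightarrow> nat^'d \<Rightarrow> (nat^'d \<Rightarrow> real) \<Rightarrow> real^'d \<Rightarrow> real" where
  "cheb_comb xl xu N c = (\<lambda>x. \<Sum>j\<in>multi_indices N. c j * cheb_basis xl xu j x)"

definition cheb_interp ::
    "real^'d \<Rightarrow> real^'d \<Rightarrow> nat^'d \<Rightarrow> (nat^'d \<Rightarrow> real) \<Rightarrow> real^'d \<Rightarrow> real" where
  "cheb_interp xl xu N v = cheb_comb xl xu N (cheb_coeff N v)"

text \<open>The linear span of the \<open>cheb_basis xl xu j\<close>; functions are no instance of the library's
  class \<open>real_vector\<close>, so \<open>span\<close> does not apply.\<close>

definition cheb_space :: "real^'d \<Rightarrow> real^'d \<Rightarrow> nat^'d \<Rightarrow> (real^'d \<Rightarrow> real) set" where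
  "cheb_space xl xu N = range (cheb_comb xl xu N)"

text \<open>Used for functions that are continuous on the compact box only, so that the supremum is a
  maximum.\<close>

definition max_norm :: "real^'d \<Rightarrow> real^'d \<Rightarrow> (real^'d \<Rightarrow> real) \<Rightarrow> real" where
  "max_norm xl xu p = (SUP x\<in>cbox xl xu. \<bar>p x\<bar>)"

definition lagrange_tensor ::
    "real^'d \<Rightarrow> real^'d \<Rightarrow> nat^'d \<Rightarrow> nat^'d \<Rightarrow> real^'d \<Rightarrow> real" where
  "lagrange_tensor xl xu N j x =
     (let nd = (\<lambda>i m. interval_map (xl $ i) (xu $ i) (cos (pi * real m / real (N $ i))))
      in \<Prod>i\<in>UNIV. \<Prod>m\<in>{..N $ i} - {j $ i}. (x $ i - nd i m) / (nd i (j $ i) - nd i m))"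

definition lebesgue_const :: "real^'d \<Rightarrow> real^'d \<Rightarrow> nat^'d \<Rightarrow> real" where
  "lebesgue_const xl xu N =
     (SUP x\<in>cbox xl xu. \<Sum>j\<in>multi_indices N. \<bar>lagrange_tensor xl xu N j x\<bar>)"


section \<open>Bernstein ellipses and the interpolation error bound\<close>

text \<open>The ellipse with foci \<open>-1\<close>, \<open>1\<close> and semiaxes \<open>a\<close>, \<open>b = sqrt (a\<^sup>2 - 1)\<close> bounds the
  region \<open>cmod (z - 1) + cmod (z + 1) < 2 * a\<close>; here \<open>a + b = r\<close> means \<open>2 * a = r + 1 / r\<close>.\<close>

definition bernstein_ellipse :: "real \<Rightarrow> complex set" where
  "bernstein_ellipse r = {z. cmod (z - 1) + cmod (z + 1) < r + 1 / r}"

lemma semiaxes_sum: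
  assumes "1 < (r::real)"
  defines "a \<equiv> (r + 1 / r) / 2"
  shows "a + sqrt (a\<^sup>2 - 1) = r"
proof -
  have eq: "a\<^sup>2 - 1 = ((r - 1 / r) / 2)\<^sup>2"
    using assms(1) unfolding a_def by (simp add: field_simps power2_eq_square)
  have "1 / r \<le> r"
    using assms(1) by (smt (verit) divide_le_eq_1)
  then have "sqrt (((r - 1 / r) / 2)\<^sup>2) = (r - 1 / r) / 2"
    by (subst real_sqrt_abs) simp
  then have "sqrt (a\<^sup>2 - 1) = (r - 1 / r) / 2"
    using eq by simp
  moreover have "a + (r - 1 / r) / 2 = r"
    unfolding a_def by (simp add: field_simps)
  ultimately show ?thesis
    by linarith
qed

definition bernstein_polyellipse ::
    "real^'d \<Rightarrow> real^'d \<Rightarrow> real^'d \<Rightarrow> (complex^'d) set" where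
  "bernstein_polyellipse xl xu \<rho> =
     {z. \<forall>i. z $ i \<in> interval_map (xl $ i) (xu $ i) ` bernstein_ellipse (\<rho> $ i)}"

text \<open>Analyticity of a function of several complex variables on an open set: differentiability
  with complex-linear derivative.\<close>

definition analytic_several :: "(complex^'d) set \<Rightarrow> (complex^'d \<Rightarrow> complex) \<Rightarrow> bool" where
  "analytic_several S F \<longleftrightarrow>
     (\<forall>z\<in>S. \<exists>F'. (F has_derivative F') (at z) \<and> (\<forall>c v. F' (c *s v) = c * F' v))"

definition analytic_extension_bounded ::
    "real^'d \<Rightarrow> real^'d \<Rightarrow> real^'d \<Rightarrow> real \<Rightarrow> (real^'d \<Rightarrow> real) \<Rightarrow> bool" where
  "analytic_extension_bounded xl xu \<rho> B h \<longleftrightarrow>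
     (\<exists>F. analytic_several (bernstein_polyellipse xl xu \<rho>) F \<and>
          (\<forall>x\<in>cbox xl xu. F (\<chi> i. complex_of_real (x $ i)) = complex_of_real (h x)) \<and>
          (\<forall>z\<in>bernstein_polyellipse xl xu \<rho>. cmod (F z) \<le> B))"

definition eps_int :: "real^'d \<Rightarrow> nat^'d \<Rightarrow> real \<Rightarrow> real" where
  "eps_int \<rho> N B =
     2 powr (real CARD('d) / 2 + 1) * B *
     sqrt (\<Sum>i\<in>UNIV. 1 / (\<rho> $ i) ^ (2 * N $ i) * (\<Prod>j\<in>UNIV. 1 / (1 - 1 / (\<rho> $ j)\<^sup>2)))"


section \<open>Generalized moments\<close>

definition gen_moment ::
    "real^'d \<Rightarrow> real^'d \<Rightarrow> nat^'d \<Rightarrow> (real \<Rightarrow> real \<Rightarrow> real^'d \<Rightarrow> (real^'d) measure) \<Rightarrow> (nat \<Rightarrow> real)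
      \<Rightarrow> nat \<Rightarrow> nat^'d \<Rightarrow> (real^'d \<Rightarrow> real) \<Rightarrow> real" where
  "gen_moment xl xu N K t u k h = (\<integral>y. h y \<partial>K (t u) (t (Suc u)) (cheb_node xl xu N k))"

text \<open>\<open>\<Gamma>h u k \<omega>\<close> is the realization at \<open>\<omega>\<close> of the approximate operator, acting on
  \<open>cheb_space xl xu N\<close>.\<close>

definition random_linear_ops ::
    "'w measure \<Rightarrow> real^'d \<Rightarrow> real^'d \<Rightarrow> nat^'d \<Rightarrow> nat
      \<Rightarrow> (nat \<Rightarrow> nat^'d \<Rightarrow> 'w \<Rightarrow> (real^'d \<Rightarrow> real) \<Rightarrow> real) \<Rightarrow> bool" where
  "random_linear_ops M xl xu N n \<Gamma>h \<longleftrightarrow>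
     (\<forall>u<n. \<forall>k\<in>multi_indices N.
        (\<forall>\<omega>\<in>space M. \<forall>p\<in>cheb_space xl xu N. \<forall>q\<in>cheb_space xl xu N. \<forall>a b.
           \<Gamma>h u k \<omega> (\<lambda>x. a * p x + b * q x) = a * \<Gamma>h u k \<omega> p + b * \<Gamma>h u k \<omega> q) \<and>
        (\<forall>p\<in>cheb_space xl xu N. (\<lambda>\<omega>. \<Gamma>h u k \<omega> p) \<in> borel_measurable M))"

definition GM ::
    "'w measure \<Rightarrow> real^'d \<Rightarrow> real^'d \<Rightarrow> nat^'d
      \<Rightarrow> (real \<Rightarrow> real \<Rightarrow> real^'d \<Rightarrow> (real^'d) measure) \<Rightarrow> (nat \<Rightarrow> real) \<Rightarrow> nat
      \<Rightarrow> (nat \<Rightarrow> nat^'d \<Rightarrow> 'w \<Rightarrow> (real^'d \<Rightarrow> real) \<Rightarrow> real) \<Rightarrow> real \<Rightarrow> bool" where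
  "GM M xl xu N K t n \<Gamma>h \<delta> \<longleftrightarrow>
     (\<exists>G. \<forall>u<n. \<forall>k\<in>multi_indices N.
        (\<forall>\<omega>\<in>space M. \<forall>p\<in>cheb_space xl xu N. \<Gamma>h u k \<omega> p = G u k p) \<and>
        (\<forall>p\<in>cheb_space xl xu N. max_norm xl xu p = 1 \<longrightarrow>
           \<bar>gen_moment xl xu N K t u k p - G u k p\<bar> \<le> \<delta>))"

text \<open>Expectations of absolute values are taken in the extended nonnegative reals: the real-valued
  integral would return 0 in the non-integrable case. A random polynomial is given by its
  measurable coefficients \<open>c j\<close>; they need not be independent of the randomness in \<open>\<Gamma>h\<close>.
  The condition \<open>0 \<le> \<delta>\<close> is implicit in the supremum being bounded by \<open>\<delta>\<close>, but
  \<open>ennreal\<close> truncates negative arguments.\<close>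

definition star_norm :: "'w measure \<Rightarrow> real^'d \<Rightarrow> real^'d \<Rightarrow> ('w \<Rightarrow> real^'d \<Rightarrow> real) \<Rightarrow> ennreal" where
  "star_norm M xl xu p = (SUP x\<in>cbox xl xu. \<integral>\<^sup>+\<omega>. ennreal \<bar>p \<omega> x\<bar> \<partial>M)"

definition GM_star ::
    "'w measure \<Rightarrow> real^'d \<Rightarrow> real^'d \<Rightarrow> nat^'d
      \<Rightarrow> (real \<Rightarrow> real \<Rightarrow> real^'d \<Rightarrow> (real^'d) measure) \<Rightarrow> (nat \<Rightarrow> real) \<Rightarrow> nat
      \<Rightarrow> (nat \<Rightarrow> nat^'d \<Rightarrow> 'w \<Rightarrow> (real^'d \<Rightarrow> real) \<Rightarrow> real) \<Rightarrow> real \<Rightarrow> bool" where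
  "GM_star M xl xu N K t n \<Gamma>h \<delta> \<longleftrightarrow>
     0 \<le> \<delta> \<and>
     (\<forall>u<n. \<forall>k\<in>multi_indices N. \<forall>c.
        (\<forall>j\<in>multi_indices N. c j \<in> borel_measurable M) \<longrightarrow>
        (let p = (\<lambda>\<omega>. cheb_comb xl xu N (\<lambda>j. c j \<omega>))
         in star_norm M xl xu p = 1 \<longrightarrow>
            (\<integral>\<^sup>+\<omega>. ennreal \<bar>gen_moment xl xu N K t u k (p \<omega>) - \<Gamma>h u k \<omega> (p \<omega>)\<bar> \<partial>M)
              \<le> ennreal \<delta>))"


section \<open>The Dynamic Chebyshev method\<close>

function cheb_value ::
    "real^'d \<Rightarrow> real^'d \<Rightarrow> nat^'d \<Rightarrow> (real \<Rightarrow> real \<Rightarrow> real) \<Rightarrow> (real \<Rightarrow> real^'d \<Rightarrow> real)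
      \<Rightarrow> (nat \<Rightarrow> nat^'d \<Rightarrow> 'w \<Rightarrow> (real^'d \<Rightarrow> real) \<Rightarrow> real) \<Rightarrow> (nat \<Rightarrow> real) \<Rightarrow> nat
      \<Rightarrow> nat \<Rightarrow> 'w \<Rightarrow> real^'d \<Rightarrow> real" where
  "cheb_value xl xu N f g \<Gamma>h t n u =
     (if n \<le> u then (\<lambda>\<omega>. cheb_interp xl xu N (\<lambda>k. g (t n) (cheb_node xl xu N k)))
      else (\<lambda>\<omega>. cheb_interp xl xu N (\<lambda>k.
        f (g (t u) (cheb_node xl xu N k))
          (\<Gamma>h u k \<omega> (cheb_value xl xu N f g \<Gamma>h t n (Suc u) \<omega>)))))"
  by pat_completeness auto
termination by (relation "Wellfounded.measure (\<lambda>(xl, xu, N, f, g, \<Gamma>h, t, n, u). n - u)") auto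

declare cheb_value.simps [simp del]

definition cheb_error ::
    "'w measure \<Rightarrow> real^'d \<Rightarrow> real^'d \<Rightarrow> (real^'d \<Rightarrow> real) \<Rightarrow> ('w \<Rightarrow> real^'d \<Rightarrow> real) \<Rightarrow> ennreal" where
  "cheb_error M xl xu V Vh = (SUP x\<in>cbox xl xu. \<integral>\<^sup>+\<omega>. ennreal \<bar>V x - Vh \<omega> x\<bar> \<partial>M)"

lemma cheb_error_deterministic:
  assumes "prob_space M" and "\<And>\<omega> x. \<omega> \<in> space M \<Longrightarrow> x \<in> cbox xl xu \<Longrightarrow> Vh \<omega> x = W x"
  shows "cheb_error M xl xu V Vh = (SUP x\<in>cbox xl xu. ennreal \<bar>V x - W x\<bar>)"
proof -
  interpret prob_space M by fact
  have "(\<integral>\<^sup>+\<omega>. ennreal \<bar>V x - Vh \<omega> x\<bar> \<partial>M) = ennreal \<bar>V x - W x\<bar>" if "x \<in> cbox xl xu" for x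
  proof -
    have "(\<integral>\<^sup>+\<omega>. ennreal \<bar>V x - Vh \<omega> x\<bar> \<partial>M) = (\<integral>\<^sup>+\<omega>. ennreal \<bar>V x - W x\<bar> \<partial>M)"
      using assms(2) that by (intro nn_integral_cong) simp
    then show ?thesis
      by (simp add: emeasure_space_1)
  qed
  then show ?thesis
    unfolding cheb_error_def by simp
qed

end

theory Submission
  imports Defs "HOL-Complex_Analysis.Complex_Analysis"
begin

no_notation fps_nth (infixl "$" 75)

text \<open>
  Let \<open>x = 1 / \<rho>\<^sup>2\<close> and \<open>c\<^sup>2 = 2 / (1 - x)\<close>. For a function that is holomorphic and bounded by \<open>B\<close> on the
  Bernstein ellipse of \<open>\<rho>\<close>, the univariate interpolation error is at most \<open>2 B sqrt (x\<^sup>N (c\<^sup>2 - 1))\<close>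
  and the interpolant itself is at most \<open>B c\<close>. Both follow from Cauchy's formula and Cauchy-Schwarz
  when \<open>x\<^sup>N\<close> is small, the sum of the squared aliasing errors \<open>cos k\<theta> - I(cos k\<theta>)\<close> with
  weights \<open>x\<^sup>k\<close> being a closed expression, and from the bound \<open>\<Lambda> \<le> sqrt N\<close> for the Lebesgue
  constant otherwise. Interpolating one coordinate after the other, \<open>F - I\<^sub>j I F = (F - I\<^sub>j F) + I\<^sub>j (F - I F)\<close>,
  gives the bound \<open>\<epsilon>\<^sub>i\<^sub>n\<^sub>t\<close> in any dimension.

  In one step of the backward recursion the interpolation error is added to \<open>\<Lambda>\<close> times the error of
  the nodal values, which by the Lipschitz condition is \<open>L\<^sub>f\<close> times the error of the conditional
  expectation. That splits into the part outside the box, the propagated error, and the moment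
  error, which is proportional to the norm of the previous approximation and thus at most
  \<open>\<epsilon>\<^sub>g\<^sub>m\<close> times the previous error plus \<open>V\<close>.
\<close>

section \<open>Interpolation at the Chebyshev nodes in trigonometric form\<close>

text \<open>The obstacle is the constant in \<open>eps_int\<close>: it contains no Lebesgue constant
  and grows only like \<open>1 / sqrt (1 - x)\<close> as \<open>\<rho>\<close> tends to 1. Adding up
  the aliasing errors of the single frequencies with Cauchy's coefficient bounds would give
  \<open>4 B / (\<rho>^N (\<rho> - 1))\<close>, which grows like \<open>1 / (1 - x)\<close>.
  Therefore all frequencies are treated at once, in mean square over a circle. The closed form of
  their energy is estimated only for \<open>x ^ (2 N) <= 1/4\<close>; if \<open>x ^ N >= 1/2\<close>
  instead, then \<open>N (1 - x) <= ln 2\<close>, so that \<open>sqrt N\<close> is itself of the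
  order \<open>1 / sqrt (1 - x)\<close>. In several variables, interpolating the error left by the
  other coordinates must not cost a Lebesgue constant, since that grows with \<open>N\<close>. The
  partial error is again holomorphic in the next coordinate on the whole ellipse, and on such
  functions interpolation costs only the factor \<open>c\<close>. Hence the tensor estimates are
  proved at complex points, although they are used on the box only.\<close>

definition dirichlet_mod :: "nat \<Rightarrow> real \<Rightarrow> real" where
  "dirichlet_mod N u = (\<Sum>j<N. (cos (real j * u) + cos (real (Suc j) * u)) / 2)"

definition end_weight :: "nat \<Rightarrow> nat \<Rightarrow> real" where
  "end_weight N j = (if j \<in> {0, N} then 1 / 2 else 1)"

definition cheb_angle :: "nat \<Rightarrow> nat \<Rightarrow> real" where
  "cheb_angle N k = pi * real k / real N"

text \<open>The Lagrange cardinal polynomial of the node \<open>cos (cheb_angle N k)\<close>, as a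
  function of the angle. The two translates of the kernel make it even in \<open>\<theta>\<close>;
  at an end node they coincide modulo \<open>2 * pi\<close>, which \<open>end_weight\<close>
  corrects.\<close>

definition cardinal_cos :: "nat \<Rightarrow> nat \<Rightarrow> real \<Rightarrow> real" where
  "cardinal_cos N k \<theta> = end_weight N k / real N *
     (dirichlet_mod N (\<theta> - cheb_angle N k) + dirichlet_mod N (\<theta> + cheb_angle N k))"

definition lagrange_cheb :: "nat \<Rightarrow> nat \<Rightarrow> real \<Rightarrow> real" where
  "lagrange_cheb N k z =
     (\<Prod>m\<in>{..N} - {k}. (z - cos (cheb_angle N m)) / (cos (cheb_angle N k) - cos (cheb_angle N m)))"

lemma sum_end_weight:
  assumes "1 \<le> N"
  shows "(\<Sum>j\<le>N. end_weight N j * a j) = (\<Sum>j<N. (a j + a (Suc j)) / 2)"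
proof -
  obtain m where N: "N = Suc m"
    using assms by (cases N) auto
  have "(\<Sum>j\<le>N. end_weight N j * a j) = (\<Sum>j\<le>m. end_weight N j * a j) + a N / 2"
    by (simp add: N end_weight_def)
  also have "(\<Sum>j\<le>m. end_weight N j * a j) = (\<Sum>j\<le>m. a j) - a 0 / 2"
  proof -
    have "(\<Sum>j\<le>m. end_weight N j * a j) = (\<Sum>j\<le>m. a j - (if j = 0 then a 0 / 2 else 0))"
      by (rule sum.cong) (auto simp: N end_weight_def)
    then show ?thesis
      by (simp add: sum_subtractf)
  qed
  also have "(\<Sum>j\<le>m. a j) - a 0 / 2 + a N / 2 = (\<Sum>j<N. (a j + a (Suc j)) / 2)"
  proof -
    have "(\<Sum>j<N. a (Suc j)) = (\<Sum>j<N. a j) + a N - a 0"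
      using sum_lessThan_telescope[of a N] by (simp add: sum_subtractf)
    then have "(\<Sum>j<N. (a j + a (Suc j)) / 2) = (\<Sum>j<N. a j) + (a N - a 0) / 2"
      by (simp add: sum.distrib add_divide_distrib diff_divide_distrib flip: sum_divide_distrib)
    then show ?thesis
      by (simp only: N lessThan_Suc_atMost) (simp add: field_simps)
  qed
  finally show ?thesis .
qed

text \<open>\<open>dirichlet_mod\<close> is the modified Dirichlet kernel
  \<open>1/2 + cos u + ... + cos ((N - 1) u) + cos (N u) / 2\<close>, that is
  \<open>sin (N u) cot (u / 2) / 2\<close>. Multiplication by \<open>2 sin (u / 2)\<close> makes the
  sum telescope; free of division, the identity also holds where \<open>sin (u / 2)\<close>
  vanishes.\<close>

lemma dirichlet_mod_closed: "2 * sin (u / 2) * dirichlet_mod N u = sin (real N * u) * cos (u / 2)"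
proof -
  have "2 * sin (u / 2) * ((cos (real j * u) + cos (real (Suc j) * u)) / 2)
      = (sin (real (Suc j) * u) - sin (real j * u)) * cos (u / 2)" for j
  proof -
    define b where "b = (real j + 1 / 2) * u"
    have 1: "real j * u = b - u / 2" "real (Suc j) * u = b + u / 2"
      by (auto simp: b_def field_simps)
    show ?thesis
      unfolding 1 by (simp add: cos_add cos_diff sin_add sin_diff)
  qed
  then have "2 * sin (u / 2) * dirichlet_mod N u
      = (\<Sum>j<N. (sin (real (Suc j) * u) - sin (real j * u))) * cos (u / 2)"
    unfolding dirichlet_mod_def sum_distrib_left sum_distrib_right by simp
  also have "(\<Sum>j<N. (sin (real (Suc j) * u) - sin (real j * u))) = sin (real N * u)"
    using sum_lessThan_telescope[of "\<lambda>j. sin (real j * u)" N] by simp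
  finally show ?thesis .
qed

lemma dirichlet_mod_minus [simp]: "dirichlet_mod N (- u) = dirichlet_mod N u"
  by (simp add: dirichlet_mod_def)

lemma cos_add_int_multiple: "cos (x + 2 * pi * of_int i) = cos x"
  using sin_cos_eq_iff[of "x + 2 * pi * of_int i" x] by auto

lemma cos_nat_shift: "cos (real j * (u + 2 * pi * of_int i)) = cos (real j * u)"
  using cos_add_int_multiple[of "real j * u" "int j * i"] by (simp add: algebra_simps)

lemma dirichlet_mod_periodic: "dirichlet_mod N (u + 2 * pi * of_int i) = dirichlet_mod N u"
  unfolding dirichlet_mod_def cos_nat_shift ..

lemma dirichlet_mod_0 [simp]: "dirichlet_mod N 0 = real N"
  by (simp add: dirichlet_mod_def)

lemma dirichlet_mod_node:
  assumes "1 \<le> N"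
  shows "dirichlet_mod N (pi * of_int i / real N) = (if 2 * int N dvd i then real N else 0)"
proof (cases "2 * int N dvd i")
  case True
  then obtain m where "i = 2 * int N * m" by (auto elim: dvdE)
  then have "pi * of_int i / real N = 0 + 2 * pi * of_int m"
    using assms by (simp add: field_simps)
  then show ?thesis
    using True by (simp only: dirichlet_mod_periodic) simp
next
  case False
  have "sin (pi * of_int i / real N / 2) \<noteq> 0"
  proof
    assume "sin (pi * of_int i / real N / 2) = 0"
    then obtain m :: int where "pi * of_int i / real N / 2 = of_int m * pi"
      unfolding sin_zero_iff_int2 by auto
    then have "(of_int i :: real) = of_int (2 * int N * m)"
      using assms by (simp add: field_simps)
    then have "i = 2 * int N * m"
      by (simp only: of_int_eq_iff)
    then show False
      using False by simp
  qed
  moreover have "sin (real N * (pi * of_int i / real N)) = 0"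
    using assms by (simp add: sin_zero_iff_int2 mult.commute)
  ultimately show ?thesis
    using dirichlet_mod_closed[of "pi * of_int i / real N" N] False by simp
qed

lemma cardinal_cos_node:
  assumes "1 \<le> N" "k \<le> N" "m \<le> N"
  shows "cardinal_cos N k (cheb_angle N m) = (if k = m then 1 else 0)"
proof -
  have eq: "cheb_angle N m - cheb_angle N k = pi * of_int (int m - int k) / real N"
    "cheb_angle N m + cheb_angle N k = pi * of_int (int m + int k) / real N"
    using assms(1) by (simp_all add: cheb_angle_def algebra_simps diff_divide_distrib add_divide_distrib)
  have d1: "2 * int N dvd int m - int k \<longleftrightarrow> k = m"
  proof
    assume "2 * int N dvd int m - int k"
    moreover have "\<bar>int m - int k\<bar> < 2 * int N"
      using assms by auto
    ultimately show "k = m"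
      using zdvd_imp_le[of "2 * int N" "\<bar>int m - int k\<bar>"] by auto
  qed simp
  \<comment> \<open>The second translate contributes a further \<open>real N\<close> only at the end
    nodes, where the weight \<open>1 / 2\<close> halves the sum.\<close>
  have d2: "2 * int N dvd int m + int k \<longleftrightarrow> k = m \<and> k \<in> {0, N}"
  proof
    assume d: "2 * int N dvd int m + int k"
    have "int m + int k = 0 \<or> int m + int k \<ge> 2 * int N"
      using zdvd_imp_le[OF d] by linarith
    then show "k = m \<and> k \<in> {0, N}"
      using assms by auto
  qed auto
  show ?thesis
    unfolding cardinal_cos_def eq dirichlet_mod_node[OF assms(1)] d1 d2
    using assms by (auto simp: end_weight_def)
qed

lemma cos_multiple_poly: "\<exists>p :: real poly. degree p \<le> j \<and> (\<forall>\<theta>. poly p (cos \<theta>) = cos (real j * \<theta>))"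
proof (induction j rule: less_induct)
  case (less j)
  consider "j = 0" | "j = 1" | m where "j = Suc (Suc m)"
    by (metis One_nat_def old.nat.exhaust)
  then show ?case
  proof cases
    case 1
    then show ?thesis by (intro exI[of _ 1]) auto
  next
    case 2
    then show ?thesis by (intro exI[of _ "[:0, 1:]"]) auto
  next
    case 3
    obtain p q :: "real poly" where p: "degree p \<le> Suc m" "\<And>\<theta>. poly p (cos \<theta>) = cos (real (Suc m) * \<theta>)"
      and q: "degree q \<le> m" "\<And>\<theta>. poly q (cos \<theta>) = cos (real m * \<theta>)"
      using less.IH[of "Suc m"] less.IH[of m] 3 by auto
    have "cos (real j * \<theta>) = 2 * cos \<theta> * cos (real (Suc m) * \<theta>) - cos (real m * \<theta>)" for \<theta>
    proof -
      have e: "real j * \<theta> = real (Suc m) * \<theta> + \<theta>" "real m * \<theta> = real (Suc m) * \<theta> - \<theta>"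
        by (simp_all add: 3 algebra_simps)
      show ?thesis
        unfolding e by (simp add: cos_add cos_diff)
    qed
    moreover have "degree ([:0, 2:] * p - q) \<le> j"
      using p(1) q(1) 3 degree_mult_le[of "[:0, 2:]" p] by (intro degree_diff_le) auto
    ultimately show ?thesis
      using p(2) q(2) by (intro exI[of _ "[:0, 2:] * p - q"]) auto
  qed
qed

lemma cos_cheb_angle_inj:
  assumes "1 \<le> N"
  shows "inj_on (\<lambda>m. cos (cheb_angle N m)) {..N}"
proof (rule inj_onI)
  fix k m assume "k \<in> {..N}" "m \<in> {..N}" and eq: "cos (cheb_angle N k) = cos (cheb_angle N m)"
  then have "cheb_angle N k \<in> {0..pi}" "cheb_angle N m \<in> {0..pi}"
    using assms by (auto simp: cheb_angle_def field_simps)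
  then have "cheb_angle N k = cheb_angle N m"
    using eq cos_inj_pi by auto
  then show "k = m"
    using assms by (simp add: cheb_angle_def field_simps)
qed

text \<open>The \<open>N + 1\<close> nodes are distinct, so they determine a polynomial of degree at
  most \<open>N\<close>. This settles both the identification with the Lagrange product and the
  reproduction of \<open>cos (j \<theta>)\<close> for \<open>j <= N\<close>.\<close>

lemma poly_eq_at_cheb_nodes:
  fixes p q :: "real poly"
  assumes "1 \<le> N" "degree p \<le> N" "degree q \<le> N"
    and "\<And>m. m \<le> N \<Longrightarrow> poly p (cos (cheb_angle N m)) = poly q (cos (cheb_angle N m))"
  shows "p = q"
proof (rule ccontr)
  assume "p \<noteq> q"
  then have nz: "p - q \<noteq> 0" by simp
  have "(\<lambda>m. cos (cheb_angle N m)) ` {..N} \<subseteq> {x. poly (p - q) x = 0}"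
    using assms(4) by auto
  then have "card ((\<lambda>m. cos (cheb_angle N m)) ` {..N}) \<le> card {x. poly (p - q) x = 0}"
    using poly_roots_finite[OF nz] by (intro card_mono)
  also have "\<dots> \<le> degree (p - q)"
    by (rule card_poly_roots_bound[OF nz])
  also have "\<dots> \<le> N"
    using assms(2,3) by (rule degree_diff_le)
  finally show False
    using card_image[OF cos_cheb_angle_inj[OF assms(1)]] by simp
qed

text \<open>The coefficients are the factors that \<open>cheb_coeff\<close> attaches to the nodal
  value at \<open>k\<close> in one dimension; this links the double-primed sums with the Lagrange
  form.\<close>

lemma cardinal_cos_expand:
  assumes "1 \<le> N"
  shows "cardinal_cos N k \<theta> = (\<Sum>j\<le>N. 2 * end_weight N j / real N *
           (end_weight N k * cos (real j * cheb_angle N k)) * cos (real j * \<theta>))"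
proof -
  have "dirichlet_mod N u = (\<Sum>j\<le>N. end_weight N j * cos (real j * u))" for u
    unfolding dirichlet_mod_def sum_end_weight[OF assms] ..
  then have "cardinal_cos N k \<theta> = end_weight N k / real N *
      (\<Sum>j\<le>N. end_weight N j * (cos (real j * (\<theta> - cheb_angle N k)) + cos (real j * (\<theta> + cheb_angle N k))))"
    unfolding cardinal_cos_def by (simp add: sum.distrib distrib_left)
  also have "\<dots> = (\<Sum>j\<le>N. 2 * end_weight N j / real N *
           (end_weight N k * cos (real j * cheb_angle N k)) * cos (real j * \<theta>))"
    unfolding sum_distrib_left
    by (rule sum.cong) (auto simp: right_diff_distrib distrib_left cos_add cos_diff)
  finally show ?thesis .
qed

lemma cardinal_cos_poly:
  assumes "1 \<le> N"
  shows "\<exists>p :: real poly. degree p \<le> N \<and> (\<forall>\<theta>. poly p (cos \<theta>) = cardinal_cos N k \<theta>)"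
proof -
  obtain c :: "nat \<Rightarrow> real poly" where c: "\<And>j. degree (c j) \<le> j"
    "\<And>j \<theta>. poly (c j) (cos \<theta>) = cos (real j * \<theta>)"
    using cos_multiple_poly by metis
  let ?p = "\<Sum>j\<le>N. smult (2 * end_weight N j / real N * (end_weight N k * cos (real j * cheb_angle N k))) (c j)"
  have "degree ?p \<le> N"
    by (rule degree_sum_le) (auto intro: order_trans[OF degree_smult_le] order_trans[OF c(1)])
  then show ?thesis
    unfolding cardinal_cos_expand[OF assms] by (intro exI[of _ ?p]) (auto simp: poly_sum c(2))
qed

lemma cardinal_cos_eq_lagrange:
  assumes "1 \<le> N" "k \<le> N"
  shows "cardinal_cos N k \<theta> = lagrange_cheb N k (cos \<theta>)"
proof -
  obtain p :: "real poly" where p: "degree p \<le> N" "\<And>\<theta>. poly p (cos \<theta>) = cardinal_cos N k \<theta>"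
    using cardinal_cos_poly[OF assms(1)] by blast
  let ?z = "\<lambda>m. cos (cheb_angle N m)"
  let ?q = "\<Prod>m\<in>{..N} - {k}. smult (1 / (?z k - ?z m)) [:- ?z m, 1:]"
  have q: "poly ?q z = lagrange_cheb N k z" for z
    unfolding lagrange_cheb_def poly_prod by (rule prod.cong) (auto simp: diff_divide_distrib)
  have "degree ?q \<le> (\<Sum>m\<in>{..N} - {k}. 1)"
    by (rule order_trans[OF degree_prod_sum_le sum_mono]) (auto intro: order_trans[OF degree_smult_le])
  then have dq: "degree ?q \<le> N"
    using assms by simp
  have "p = ?q"
  proof (rule poly_eq_at_cheb_nodes[OF assms(1) p(1) dq])
    fix m assume m: "m \<le> N"
    have "lagrange_cheb N k (?z m) = (if k = m then 1 else 0)"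
    proof (cases "k = m")
      case True
      have "(?z m - ?z i) / (?z m - ?z i) = 1" if "i \<in> {..N} - {m}" for i
        using that m inj_onD[OF cos_cheb_angle_inj[OF assms(1)], of m i] by auto
      then show ?thesis
        unfolding lagrange_cheb_def True by (simp add: prod.neutral)
    next
      case False
      then show ?thesis
        unfolding lagrange_cheb_def using m by (auto intro!: prod_zero)
    qed
    then show "poly p (?z m) = poly ?q (?z m)"
      unfolding q p(2) cardinal_cos_node[OF assms m] by simp
  qed
  then show ?thesis
    using p(2) q by simp
qed

lemma cardinal_cos_reproduces:
  assumes "1 \<le> N" "j \<le> N"
  shows "(\<Sum>k\<le>N. cardinal_cos N k \<theta> * cos (real j * cheb_angle N k)) = cos (real j * \<theta>)"
proof -
  obtain p :: "nat \<Rightarrow> real poly" where p: "\<And>k. degree (p k) \<le> N"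
    "\<And>k \<theta>. poly (p k) (cos \<theta>) = cardinal_cos N k \<theta>"
    using cardinal_cos_poly[OF assms(1)] by metis
  obtain c :: "real poly" where c: "degree c \<le> j" "\<And>\<theta>. poly c (cos \<theta>) = cos (real j * \<theta>)"
    using cos_multiple_poly by metis
  let ?q = "\<Sum>k\<le>N. smult (cos (real j * cheb_angle N k)) (p k)"
  have "?q = c"
  proof (rule poly_eq_at_cheb_nodes[OF assms(1)])
    show "degree ?q \<le> N"
      by (rule degree_sum_le) (auto intro: order_trans[OF degree_smult_le] p(1))
    show "degree c \<le> N"
      using c(1) assms(2) by simp
    fix m assume "m \<le> N"
    then show "poly ?q (cos (cheb_angle N m)) = poly c (cos (cheb_angle N m))"
      using assms(1) by (simp add: poly_sum p(2) c(2) cardinal_cos_node if_distrib cong: if_cong)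
  qed
  then have "poly ?q (cos \<theta>) = cos (real j * \<theta>)"
    using c(2) by simp
  then show ?thesis
    by (simp add: poly_sum p(2) mult.commute)
qed

section \<open>The Lebesgue function\<close>

text \<open>The \<open>2 N\<close> arguments are the integers from \<open>a - N\<close> to
  \<open>a + N - 1\<close>, a full period. They are written in pairs around \<open>a\<close> because
  the Lebesgue sum is estimated pair by pair.\<close>

lemma periodic_sum_shift:
  fixes h :: "int \<Rightarrow> real"
  assumes "\<And>i. h (i + 2 * int N) = h i"
  shows "(\<Sum>j<N. h (a + int j) + h (a - 1 - int j)) = (\<Sum>j<N. h (int j) + h (- 1 - int j))"
proof -
  define S where "S = (\<lambda>a. \<Sum>j<N. h (a + int j) + h (a - 1 - int j))"
  have step: "S (a + 1) = S a" for a
  proof -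
    have "S (a + 1) - S a = (\<Sum>j<N. h (a + int (Suc j)) - h (a + int j))
        - (\<Sum>j<N. h (a - int (Suc j)) - h (a - int j))"
      unfolding S_def sum_subtractf[symmetric] by (intro sum.cong) (auto simp: algebra_simps)
    also have "\<dots> = h (a + int N) - h (a - int N)"
      using sum_lessThan_telescope[of "\<lambda>j. h (a + int j)" N]
        sum_lessThan_telescope[of "\<lambda>j. h (a - int j)" N] by simp
    also have "\<dots> = 0"
      using assms[of "a - int N"] by (simp add: add.commute)
    finally show ?thesis by simp
  qed
  have "S a = S 0"
  proof (induction a rule: int_induct[where k = 0])
    case (step2 i)
    then show ?case using step[of "i - 1"] by simp
  qed (use step in auto)
  then show ?thesis
    by (simp add: S_def)
qed

text \<open>The triangle inequality for the two translates unfolds the \<open>N + 1\<close> cosine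
  nodes to \<open>2 N\<close> equispaced points of the circle, which may then be centred at any
  \<open>a\<close>.\<close>

lemma sum_cardinal_cos_le:
  assumes "1 \<le> N"
  shows "real N * (\<Sum>k\<le>N. \<bar>cardinal_cos N k \<theta>\<bar>) \<le>
    (\<Sum>j<N. \<bar>dirichlet_mod N (\<theta> - pi * of_int (a + int j) / real N)\<bar>
         + \<bar>dirichlet_mod N (\<theta> - pi * of_int (a - 1 - int j) / real N)\<bar>)"
proof -
  define h :: "int \<Rightarrow> real" where "h i = \<bar>dirichlet_mod N (\<theta> - pi * of_int i / real N)\<bar>" for i
  have per: "h (i + 2 * int N) = h i" for i
  proof -
    have "\<theta> - pi * of_int i / real N = (\<theta> - pi * of_int (i + 2 * int N) / real N) + 2 * pi * of_int 1"
      using assms by (simp add: field_simps)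
    then show ?thesis
      unfolding h_def by (simp only: dirichlet_mod_periodic)
  qed
  have "real N * \<bar>cardinal_cos N k \<theta>\<bar> \<le> end_weight N k * (h (int k) + h (- int k))" for k
  proof -
    have "real N * \<bar>cardinal_cos N k \<theta>\<bar> = end_weight N k *
        \<bar>dirichlet_mod N (\<theta> - cheb_angle N k) + dirichlet_mod N (\<theta> + cheb_angle N k)\<bar>"
      using assms by (simp add: cardinal_cos_def abs_mult end_weight_def)
    also have "\<dots> \<le> end_weight N k * (h (int k) + h (- int k))"
      by (intro mult_left_mono) (auto simp: h_def cheb_angle_def end_weight_def)
    finally show ?thesis .
  qed
  then have "real N * (\<Sum>k\<le>N. \<bar>cardinal_cos N k \<theta>\<bar>) \<le> (\<Sum>k\<le>N. end_weight N k * (h (int k) + h (- int k)))"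
    unfolding sum_distrib_left by (intro sum_mono)
  \<comment> \<open>The halved ends turn the sum into the mean of the windows centred at 0 and at 1,
    and each of these equals the window at an arbitrary \<open>a\<close>.\<close>
  also have "\<dots> = ((\<Sum>j<N. h (int j) + h (- 1 - int j)) + (\<Sum>j<N. h (1 + int j) + h (1 - 1 - int j))) / 2"
    unfolding sum_end_weight[OF assms] sum.distrib[symmetric] sum_divide_distrib
    by (intro sum.cong) (auto simp: algebra_simps)
  also have "\<dots> = (\<Sum>j<N. h (int j) + h (- 1 - int j))"
    using periodic_sum_shift[of h N 1, OF per] by simp
  also have "\<dots> = (\<Sum>j<N. h (a + int j) + h (a - 1 - int j))"
    using periodic_sum_shift[of h N a, OF per] by simp
  finally show ?thesis
    by (simp add: h_def)
qed

text \<open>A separate case because the odd harmonic bound is about 1.436 at \<open>N = 2\<close>,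
  above \<open>sqrt 2\<close>. The kernel is \<open>cos u (1 + cos u)\<close>; over antipodal points
  the factors \<open>1 + cos u\<close> add up to 2, which leaves
  \<open>|sin \<theta>| + |cos \<theta>|\<close>.\<close>

lemma sum_cardinal_cos_le_two:
  "(\<Sum>k\<le>2. \<bar>cardinal_cos 2 k \<theta>\<bar>) \<le> sqrt 2"
proof -
  have D: "dirichlet_mod 2 u = cos u * (1 + cos u)" for u
    using cos_double_cos[of u] by (simp add: dirichlet_mod_def numeral_2_eq_2 field_simps power2_eq_square)
  have le1: "\<bar>cos u * (1 + cos u)\<bar> = \<bar>cos u\<bar> * (1 + cos u)" for u :: real
  proof -
    have "0 \<le> 1 + cos u"
      using cos_ge_minus_one[of u] by linarith
    then show ?thesis by (simp only: abs_mult abs_of_nonneg)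
  qed
  have "real 2 * (\<Sum>k\<le>2. \<bar>cardinal_cos 2 k \<theta>\<bar>) \<le>
    (\<Sum>j<2. \<bar>dirichlet_mod 2 (\<theta> - pi * of_int (1 + int j) / real 2)\<bar>
         + \<bar>dirichlet_mod 2 (\<theta> - pi * of_int (1 - 1 - int j) / real 2)\<bar>)"
    by (rule sum_cardinal_cos_le) simp
  also have "\<dots> = \<bar>cos (\<theta> - pi / 2)\<bar> * (1 + cos (\<theta> - pi / 2)) + \<bar>cos \<theta>\<bar> * (1 + cos \<theta>)
      + \<bar>cos (\<theta> - pi)\<bar> * (1 + cos (\<theta> - pi)) + \<bar>cos (\<theta> + pi / 2)\<bar> * (1 + cos (\<theta> + pi / 2))"
    unfolding D le1 by (simp add: numeral_2_eq_2)
  also have "\<dots> = 2 * (\<bar>sin \<theta>\<bar> + \<bar>cos \<theta>\<bar>)"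
    by (simp add: cos_diff cos_add algebra_simps)
  also have "\<dots> \<le> 2 * sqrt 2"
  proof -
    have "(a + b)\<^sup>2 \<le> 2 * (a\<^sup>2 + b\<^sup>2)" for a b :: real
      using sum_squares_bound[of a b] by (simp add: power2_sum)
    from this[of "\<bar>sin \<theta>\<bar>" "\<bar>cos \<theta>\<bar>"] have "(\<bar>sin \<theta>\<bar> + \<bar>cos \<theta>\<bar>)\<^sup>2 \<le> 2" by simp
    then have "\<bar>sin \<theta>\<bar> + \<bar>cos \<theta>\<bar> \<le> sqrt 2"
      by (rule real_le_rsqrt)
    then show ?thesis by simp
  qed
  finally show ?thesis by simp
qed

lemma sum_cardinal_cos_le_one:
  "(\<Sum>k\<le>1. \<bar>cardinal_cos 1 k \<theta>\<bar>) \<le> 1"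
proof -
  have D: "dirichlet_mod 1 u = (1 + cos u) / 2" for u
    by (simp add: dirichlet_mod_def)
  have "real 1 * (\<Sum>k\<le>1. \<bar>cardinal_cos 1 k \<theta>\<bar>) \<le>
    (\<Sum>j<1. \<bar>dirichlet_mod 1 (\<theta> - pi * of_int (1 + int j) / real 1)\<bar>
         + \<bar>dirichlet_mod 1 (\<theta> - pi * of_int (1 - 1 - int j) / real 1)\<bar>)"
    by (rule sum_cardinal_cos_le) simp
  also have "\<dots> = \<bar>(1 - cos \<theta>) / 2\<bar> + \<bar>(1 + cos \<theta>) / 2\<bar>"
    unfolding D by (simp add: cos_diff)
  also have "\<dots> = 1"
  proof -
    have "\<bar>(1 - c) / 2\<bar> + \<bar>(1 + c) / 2\<bar> = 1" if "- 1 \<le> c" "c \<le> 1" for c :: real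
      using that by (auto simp: abs_if field_simps)
    from this[of "cos \<theta>"] show ?thesis
      by (simp only: cos_ge_minus_one cos_le_one)
  qed
  finally show ?thesis by simp
qed

text \<open>The inequality \<open>cot v <= 1 / v - v / 3\<close>, with the first two terms of the
  Laurent series, cleared of denominators. The difference of the sides vanishes at 0 and has
  derivative \<open>v (sin v - v cos v)\<close>, whose sign follows by the same argument.\<close>

lemma three_mult_cos_le_sin:
  fixes v :: real
  assumes "0 \<le> v" "v \<le> pi"
  shows "3 * v * cos v \<le> (3 - v\<^sup>2) * sin v"
proof -
  have 1: "0 \<le> sin u - u * cos u" if "0 \<le> u" "u \<le> pi" for u :: real
  proof -
    have "sin 0 - 0 * cos 0 \<le> sin u - u * cos u"
    proof (rule DERIV_nonneg_imp_nondecreasing[OF that(1)])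
      fix x assume x: "0 \<le> x" "x \<le> u"
      have "((\<lambda>x. sin x - x * cos x) has_real_derivative x * sin x) (at x)"
        by (auto intro!: derivative_eq_intros)
      moreover have "0 \<le> x * sin x"
        using x that by (simp add: sin_ge_zero)
      ultimately show "\<exists>y. ((\<lambda>x. sin x - x * cos x) has_real_derivative y) (at x) \<and> 0 \<le> y"
        by blast
    qed
    then show ?thesis by simp
  qed
  have "(3 - 0\<^sup>2) * sin 0 - 3 * 0 * cos 0 \<le> (3 - v\<^sup>2) * sin v - 3 * v * cos v"
  proof (rule DERIV_nonneg_imp_nondecreasing[OF assms(1)])
    fix x assume x: "0 \<le> x" "x \<le> v"
    have "((\<lambda>x. (3 - x\<^sup>2) * sin x - 3 * x * cos x) has_real_derivative x * (sin x - x * cos x)) (at x)"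
      by (auto intro!: derivative_eq_intros simp: algebra_simps power2_eq_square)
    moreover have "0 \<le> x * (sin x - x * cos x)"
      using x 1[of x] assms by simp
    ultimately show "\<exists>y. ((\<lambda>x. (3 - x\<^sup>2) * sin x - 3 * x * cos x) has_real_derivative y) (at x) \<and> 0 \<le> y"
      by blast
  qed
  then show ?thesis by simp
qed

text \<open>The bound for \<open>cot\<close> at \<open>u / 2\<close>, inserted into
  \<open>dirichlet_mod_closed\<close>. The correction \<open>- u / 12\<close> matters: without it
  the final bound would exceed \<open>sqrt N\<close> at \<open>N = 3\<close>.\<close>

lemma dirichlet_mod_abs_le:
  assumes "0 < u" "u \<le> pi"
  shows "\<bar>dirichlet_mod N u\<bar> \<le> \<bar>sin (real N * u)\<bar> * (1 / u - u / 12)"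
proof -
  define v where "v = u / 2"
  have v: "0 < v" "v \<le> pi / 2" "u = 2 * v"
    using assms by (auto simp: v_def)
  have s: "0 < sin v" and c: "0 \<le> cos v"
    using v sin_gt_zero[of v] cos_ge_zero[of v] pi_gt_zero by linarith+
  have "cos v \<le> sin v * (1 / v - v / 3)"
    using three_mult_cos_le_sin[of v] v pi_gt_zero by (simp add: field_simps power2_eq_square)
  then have "\<bar>sin (real N * u)\<bar> * cos v \<le> \<bar>sin (real N * u)\<bar> * (sin v * (1 / v - v / 3))"
    by (intro mult_left_mono) auto
  moreover have "2 * sin v * \<bar>dirichlet_mod N u\<bar> = \<bar>sin (real N * u)\<bar> * cos v"
    using arg_cong[OF dirichlet_mod_closed[of u N], of abs] s c by (simp add: abs_mult v)
  ultimately have "sin v * \<bar>dirichlet_mod N u\<bar> \<le> sin v * (\<bar>sin (real N * u)\<bar> * (1 / u - u / 12))"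
    by (simp add: v(3) field_simps)
  then show ?thesis
    using s by simp
qed

text \<open>Equality holds at \<open>0\<close>, \<open>pi / 2\<close> and \<open>pi\<close>. At
  distance \<open>2 s\<close> from \<open>pi / 2\<close> the sine equals 1 minus twice the square of
  \<open>sin s\<close>, and concavity keeps \<open>sin s\<close> above its chord on
  \<open>[0, pi / 4]\<close>.\<close>

lemma sin_le_parabola:
  fixes \<psi> :: real
  assumes "0 \<le> \<psi>" "\<psi> \<le> pi"
  shows "sin \<psi> \<le> 4 * (\<psi> * (pi - \<psi>)) / pi\<^sup>2"
proof -
  have conv: "convex_on {0..pi} (\<lambda>x. - sin x)"
  proof (rule f''_ge0_imp_convex)
    show "((\<lambda>x. - sin x) has_real_derivative - cos x) (at x)" for x :: real
      by (auto intro!: derivative_eq_intros)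
    show "((\<lambda>x. - cos x) has_real_derivative sin x) (at x)" for x :: real
      by (auto intro!: derivative_eq_intros)
  qed (auto intro: sin_ge_zero)
  define s where "s = \<bar>pi / 2 - \<psi>\<bar> / 2"
  have s: "0 \<le> s" "s \<le> pi / 4"
    using assms unfolding s_def by (simp_all add: abs_if)
  define t where "t = 4 * s / pi"
  have t: "0 \<le> t" "t \<le> 1" "t * (pi / 4) = s"
    using s by (auto simp: t_def field_simps)
  have "- sin ((1 - t) *\<^sub>R 0 + t *\<^sub>R (pi / 4)) \<le> (1 - t) * (- sin 0) + t * (- sin (pi / 4))"
    by (rule convex_onD[OF conv]) (use t in auto)
  then have "t * (sqrt 2 / 2) \<le> sin s"
    using t(3) by (simp add: sin_45)
  then have "(t * (sqrt 2 / 2))\<^sup>2 \<le> (sin s)\<^sup>2"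
    using t by (intro power_mono) auto
  then have "t\<^sup>2 / 2 \<le> (sin s)\<^sup>2"
    by (simp add: power_mult_distrib power_divide)
  moreover have "sin \<psi> = 1 - 2 * (sin s)\<^sup>2"
  proof -
    have "sin \<psi> = cos (pi / 2 - \<psi>)" by (simp add: cos_diff)
    also have "\<dots> = cos \<bar>pi / 2 - \<psi>\<bar>" by simp
    also have "\<dots> = cos (2 * s)" by (simp add: s_def)
    finally show ?thesis by (simp add: cos_double_sin)
  qed
  moreover have "1 - t\<^sup>2 = 4 * (\<psi> * (pi - \<psi>)) / pi\<^sup>2"
  proof -
    have "t\<^sup>2 = 4 * (pi / 2 - \<psi>)\<^sup>2 / pi\<^sup>2"
      by (simp add: t_def s_def power_divide power_mult_distrib)
    then show ?thesis
      by (simp add: field_simps power2_eq_square)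
  qed
  ultimately show ?thesis by linarith
qed

text \<open>The increment \<open>4 / (pi (2 N + 1))\<close> is at most
  \<open>sqrt (N + 1) - sqrt N\<close>, for which \<open>pi > 3\<close> suffices. The induction
  starts at 3 because at 1 and 2 the left side is slightly larger than the root.\<close>

lemma odd_harmonic_le_sqrt:
  assumes "3 \<le> N"
  shows "4 / pi * (\<Sum>j<N. 1 / (2 * real j + 1)) - pi / 12 \<le> sqrt (real N)"
  using assms
proof (induction N rule: dec_induct)
  case base
  define a where "a = 4 / pi"
  have p: "157 / 50 < pi"
    using pi_approx by simp
  have "a \<le> 200 / 157"
    unfolding a_def using p by (simp add: divide_simps)
  moreover have "(\<Sum>j<3. 1 / (2 * real j + 1)) = 23 / 15"
    by (simp add: eval_nat_numeral)
  moreover have "17 / 10 \<le> sqrt (3::real)"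
    by (rule real_le_rsqrt) (simp add: power2_eq_square)
  ultimately show ?case
    using p unfolding a_def[symmetric] of_nat_numeral by (simp only:)
next
  case (step N)
  have "sqrt (real N + 1) * 4 * 2 \<le> 3 * (2 * real N + 1)"
  proof (rule power2_le_imp_le)
    have "(sqrt (real N + 1) * 4 * 2)\<^sup>2 = 64 * (real N + 1)"
      by (simp add: power_mult_distrib)
    also have "\<dots> \<le> 9 * (2 * real N + 1)\<^sup>2"
    proof -
      have "(2 * real N + 1)\<^sup>2 \<ge> 7 * (2 * real N + 1)"
        unfolding power2_eq_square using step(1) by (intro mult_right_mono) auto
      then show ?thesis using step(1) by simp
    qed
    finally show "(sqrt (real N + 1) * 4 * 2)\<^sup>2 \<le> (3 * (2 * real N + 1))\<^sup>2"
      by (simp only: power_mult_distrib) simp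
  qed simp
  also have "\<dots> \<le> pi * (2 * real N + 1)"
    using pi_gt3 by (intro mult_right_mono) auto
  finally have "4 / pi * (1 / (2 * real N + 1)) * (2 * sqrt (real N + 1)) \<le> 1"
    by (simp add: pos_divide_le_eq add_nonneg_pos)
  then have le: "4 / pi * (1 / (2 * real N + 1)) * (sqrt (real N + 1) + sqrt (real N)) \<le> 1"
    by (rule order_trans[rotated]) (intro mult_left_mono, auto)
  have "(sqrt (real N + 1) - sqrt (real N)) * (sqrt (real N + 1) + sqrt (real N)) = 1"
    by (simp add: algebra_simps)
  then have "4 / pi * (1 / (2 * real N + 1)) \<le> sqrt (real N + 1) - sqrt (real N)"
    using le by (smt (verit) mult_right_le_imp_le real_sqrt_gt_zero of_nat_0_le_iff real_sqrt_ge_zero)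
  then show ?case
    using step.IH by (simp add: distrib_left add.commute)
qed

text \<open>The left side increases with \<open>s\<close>, and at \<open>s = 1\<close> its
  denominator is the square of \<open>2 j + 1\<close>.\<close>

lemma shifted_pair_le:
  fixes s :: real
  assumes "0 < s" "s \<le> 1"
  shows "(2 * real j + 1) * s / (4 * real j * (real j + 1) + s) \<le> 1 / (2 * real j + 1)"
proof -
  have "0 < 4 * real j * (real j + 1) + s"
    using assms by (intro add_nonneg_pos) auto
  moreover have "4 * real j * (real j + 1) * s \<le> 4 * real j * (real j + 1)"
    using assms by (intro mult_left_le) auto
  ultimately show ?thesis
    by (simp add: field_simps)
qed

text \<open>The pairs grow with \<open>s\<close>, but \<open>- pi * s / 12\<close> works against
  them. The pair \<open>j = 0\<close> does not depend on \<open>s\<close>; the pair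
  \<open>j = 1\<close>, present because \<open>N >= 2\<close>, grows fast enough to
  compensate.\<close>

lemma lebesgue_sum_le:
  fixes s :: real
  assumes "2 \<le> N" "0 < s" "s \<le> 1"
  shows "4 / pi * (\<Sum>j<N. (2 * real j + 1) * s / (4 * real j * (real j + 1) + s)) - pi * s / 12
    \<le> 4 / pi * (\<Sum>j<N. 1 / (2 * real j + 1)) - pi / 12"
proof -
  obtain m where N: "N = Suc (Suc m)"
    using assms(1) by (metis Suc_le_D numeral_2_eq_2 Suc_le_mono le_Suc_ex plus_nat.simps(2))
  \<comment> \<open>The gap of the pair \<open>j = 1\<close> is
    \<open>8 (1 - s) / (3 (8 + s))\<close>, at least \<open>8 (1 - s) / 27\<close>. Comparing it
    with \<open>(1 - s) pi / 12\<close> leaves \<open>27 pi^2 <= 384\<close>.\<close>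
  have "27 * pi\<^sup>2 \<le> 27 * 3.15\<^sup>2"
    using pi_approx by (intro mult_left_mono power_mono) auto
  then have "27 * pi\<^sup>2 \<le> 384"
    by (simp add: power2_eq_square)
  then have "pi / 12 \<le> 4 / pi * (8 / 27)"
    by (simp add: field_simps power2_eq_square)
  also have "\<dots> \<le> 4 / pi * (8 / (3 * (8 + s)))"
    using assms by (intro mult_left_mono divide_left_mono) auto
  finally have "(1 - s) * (pi / 12) \<le> (1 - s) * (4 / pi * (8 / (3 * (8 + s))))"
    using assms by (intro mult_left_mono) auto
  also have "\<dots> = 4 / pi * (1 / 3 - 3 * s / (8 + s))"
    using assms by (simp add: divide_simps)
  finally have 1: "4 / pi * (3 * s / (8 + s)) - pi * s / 12 \<le> 4 / pi * (1 / 3) - pi / 12"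
    by (simp add: left_diff_distrib right_diff_distrib diff_divide_distrib mult.commute)
  have "(\<Sum>j<m. (2 * real (Suc (Suc j)) + 1) * s / (4 * real (Suc (Suc j)) * (real (Suc (Suc j)) + 1) + s))
      \<le> (\<Sum>j<m. 1 / (2 * real (Suc (Suc j)) + 1))"
    using assms by (intro sum_mono shifted_pair_le) auto
  then have 2: "4 / pi * (\<Sum>j<m. (2 * real (Suc (Suc j)) + 1) * s / (4 * real (Suc (Suc j)) * (real (Suc (Suc j)) + 1) + s))
      \<le> 4 / pi * (\<Sum>j<m. 1 / (2 * real (Suc (Suc j)) + 1))"
    by (intro mult_left_mono) auto
  have split: "c * (\<Sum>j<N. F j) = c * F 0 + c * F 1 + c * (\<Sum>j<m. F (Suc (Suc j)))" for c and F :: "nat \<Rightarrow> real"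
    unfolding N by (simp add: sum.lessThan_Suc_shift distrib_left del: sum.lessThan_Suc)
  have "(2 * real 0 + 1) * s / (4 * real 0 * (real 0 + 1) + s) = 1 / (2 * real 0 + 1)"
    "(2 * real 1 + 1) * s / (4 * real 1 * (real 1 + 1) + s) = 3 * s / (8 + s)" "1 / (2 * real 1 + 1) = 1 / 3"
    using assms by simp_all
  moreover define c where "c = 4 / pi"
  ultimately show ?thesis
    using 1 2 unfolding split c_def[symmetric] by (simp only:)
qed

text \<open>By periodicity the sum may be arranged symmetrically around the two nodes next to \<open>\<theta>\<close>;
  with \<open>cot v \<le> 1 / v - v / 3\<close> the paired terms depend only on \<open>w = \<psi> (\<pi> - \<psi>)\<close> and are largest
  midway between two nodes.\<close>

lemma sum_cardinal_cos_le_odd_harmonic: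
  assumes N: "2 \<le> N"
  shows "(\<Sum>k\<le>N. \<bar>cardinal_cos N k \<theta>\<bar>) \<le> max 1 (4 / pi * (\<Sum>j<N. 1 / (2 * real j + 1)) - pi / 12)"
proof -
  define m where "m = \<lfloor>\<theta> * real N / pi\<rfloor>"
  define \<phi> where "\<phi> = \<theta> - pi * of_int m / real N"
  have "of_int m \<le> \<theta> * real N / pi" "\<theta> * real N / pi < of_int m + 1"
    by (auto simp: m_def)
  then have "pi * of_int m / real N \<le> \<theta>" "\<theta> < pi * of_int m / real N + pi / real N"
    using N by (auto simp: field_simps simp flip: add_divide_distrib)
  then have \<phi>: "0 \<le> \<phi>" "\<phi> < pi / real N"
    by (auto simp: \<phi>_def)
  \<comment> \<open>Centred at the gap that contains \<open>\<theta>\<close>: the points come in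
    pairs, at distance \<open>pi (j + 1) / N - \<phi>\<close> on the right and
    \<open>pi j / N + \<phi>\<close> on the left.\<close>
  have "real N * (\<Sum>k\<le>N. \<bar>cardinal_cos N k \<theta>\<bar>) \<le>
    (\<Sum>j<N. \<bar>dirichlet_mod N (\<theta> - pi * of_int (m + 1 + int j) / real N)\<bar>
         + \<bar>dirichlet_mod N (\<theta> - pi * of_int (m + 1 - 1 - int j) / real N)\<bar>)"
    using N by (intro sum_cardinal_cos_le) auto
  also have "\<dots> = (\<Sum>j<N. \<bar>dirichlet_mod N (pi * (real j + 1) / real N - \<phi>)\<bar>
         + \<bar>dirichlet_mod N (pi * real j / real N + \<phi>)\<bar>)"
  proof (rule sum.cong[OF refl])
    fix j
    have "\<theta> - pi * of_int (m + 1 + int j) / real N = - (pi * (real j + 1) / real N - \<phi>)"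
      "\<theta> - pi * of_int (m + 1 - 1 - int j) / real N = pi * real j / real N + \<phi>"
      by (auto simp: \<phi>_def add_divide_distrib diff_divide_distrib algebra_simps)
    then show "\<bar>dirichlet_mod N (\<theta> - pi * of_int (m + 1 + int j) / real N)\<bar>
         + \<bar>dirichlet_mod N (\<theta> - pi * of_int (m + 1 - 1 - int j) / real N)\<bar>
      = \<bar>dirichlet_mod N (pi * (real j + 1) / real N - \<phi>)\<bar> + \<bar>dirichlet_mod N (pi * real j / real N + \<phi>)\<bar>"
      by (simp only: dirichlet_mod_minus)
  qed
  finally have le: "real N * (\<Sum>k\<le>N. \<bar>cardinal_cos N k \<theta>\<bar>) \<le> \<dots>" .
  show ?thesis
  proof (cases "\<phi> = 0")
    case True
    have "dirichlet_mod N (pi * (real j + 1) / real N) = 0"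
      "dirichlet_mod N (pi * real j / real N) = (if j = 0 then real N else 0)" if "j < N" for j
    proof -
      have "\<not> 2 * int N dvd int j + 1" "2 * int N dvd int j \<longleftrightarrow> j = 0"
        using that zdvd_imp_le[of "2 * int N" "int j + 1"] zdvd_imp_le[of "2 * int N" "int j"] by auto
      then show "dirichlet_mod N (pi * (real j + 1) / real N) = 0"
        "dirichlet_mod N (pi * real j / real N) = (if j = 0 then real N else 0)"
        using N dirichlet_mod_node[of N "int j + 1"] dirichlet_mod_node[of N "int j"] by auto
    qed
    then have "(\<Sum>j<N. \<bar>dirichlet_mod N (pi * (real j + 1) / real N - \<phi>)\<bar>
         + \<bar>dirichlet_mod N (pi * real j / real N + \<phi>)\<bar>) = (\<Sum>j<N. if j = 0 then real N else 0)"
      using True by (intro sum.cong) auto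
    then have "real N * (\<Sum>k\<le>N. \<bar>cardinal_cos N k \<theta>\<bar>) \<le> real N * 1"
      using le N by simp
    then have "(\<Sum>k\<le>N. \<bar>cardinal_cos N k \<theta>\<bar>) \<le> 1"
      using N by (subst (asm) mult_le_cancel_left_pos) auto
    then show ?thesis by simp
  next
    case False
    define \<psi> where "\<psi> = real N * \<phi>"
    have \<psi>: "0 < \<psi>" "\<psi> < pi"
      using \<phi> False N by (auto simp: \<psi>_def field_simps)
    define w where "w = \<psi> * (pi - \<psi>)"
    have w: "0 < w" "w \<le> pi\<^sup>2 / 4"
    proof -
      have "0 \<le> (pi / 2 - \<psi>)\<^sup>2" by simp
      then show "w \<le> pi\<^sup>2 / 4"
        unfolding w_def by (simp add: power2_eq_square algebra_simps)
    qed (use \<psi> in \<open>auto simp: w_def\<close>)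
    have term_le: "\<bar>dirichlet_mod N (pi * (real j + 1) / real N - \<phi>)\<bar> + \<bar>dirichlet_mod N (pi * real j / real N + \<phi>)\<bar>
      \<le> real N * (sin \<psi> * ((2 * real j + 1) * pi / (real j * (real j + 1) * pi\<^sup>2 + w)))
        - sin \<psi> * ((2 * real j + 1) * pi / (12 * real N))" if j: "j < N" for j
    proof -
      define u1 where "u1 = pi * (real j + 1) / real N - \<phi>"
      define u2 where "u2 = pi * real j / real N + \<phi>"
      have N0: "0 < real N" using N by simp
      have u1: "u1 = (pi * (real j + 1) - \<psi>) / real N" and u2: "u2 = (pi * real j + \<psi>) / real N"
        using N0 by (auto simp: u1_def u2_def \<psi>_def field_simps)
      have jN: "real j + 1 \<le> real N" using j by simp
      have "pi * (real j + 1) \<le> pi * real N"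
        using jN by (intro mult_left_mono) auto
      moreover have "0 \<le> pi * real j" "pi * (real j + 1) = pi * real j + pi"
        by (simp_all add: algebra_simps)
      ultimately have "0 < pi * (real j + 1) - \<psi>" "pi * (real j + 1) - \<psi> \<le> pi * real N"
        "0 < pi * real j + \<psi>" "pi * real j + \<psi> \<le> pi * real N"
        using \<psi> by linarith+
      then have r: "0 < u1" "u1 \<le> pi" "0 < u2" "u2 \<le> pi"
        unfolding u1 u2 using \<psi> N0 by (auto simp: zero_less_divide_iff pos_divide_le_eq mult.commute)
      have a1: "\<bar>sin (real N * u1)\<bar> = sin \<psi>"
      proof -
        have "real N * u1 = pi * (real j + 1) - \<psi>" using N0 by (simp add: u1)
        then have "sin (real N * u1) = (-1) ^ j * sin \<psi>"
          using sin_npi[of "Suc j"] cos_npi[of "Suc j"] by (simp add: sin_diff mult.commute add.commute)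
        then show ?thesis
          using \<psi> sin_gt_zero[of \<psi>] by (simp add: abs_mult power_abs)
      qed
      have a2: "\<bar>sin (real N * u2)\<bar> = sin \<psi>"
      proof -
        have "real N * u2 = pi * real j + \<psi>" using N0 by (simp add: u2)
        then have "sin (real N * u2) = (-1) ^ j * sin \<psi>"
          using sin_npi[of j] cos_npi[of j] by (simp add: sin_add mult.commute)
        then show ?thesis
          using \<psi> sin_gt_zero[of \<psi>] by (simp add: abs_mult power_abs)
      qed
      \<comment> \<open>The sum of the two distances of a pair does not depend on
        \<open>\<psi>\<close>, and \<open>\<psi>\<close> enters their product only through
        \<open>w\<close>.\<close>
      have "1 / u1 + 1 / u2 = real N * ((2 * real j + 1) * pi / (real j * (real j + 1) * pi\<^sup>2 + w))"
      proof -
        define p where "p = pi * (real j + 1) - \<psi>"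
        define p' where "p' = pi * real j + \<psi>"
        have p: "0 < p" "0 < p'"
          using r N0 unfolding u1 u2 p_def p'_def by (auto simp: zero_less_divide_iff)
        have "1 / u1 + 1 / u2 = real N * ((p + p') / (p * p'))"
          unfolding u1 u2 p_def[symmetric] p'_def[symmetric] using p N0 by (simp add: field_simps)
        moreover have "p + p' = (2 * real j + 1) * pi" "p * p' = real j * (real j + 1) * pi\<^sup>2 + w"
          by (simp_all add: p_def p'_def w_def algebra_simps power2_eq_square)
        ultimately show ?thesis by simp
      qed
      moreover have "u1 / 12 + u2 / 12 = (2 * real j + 1) * pi / (12 * real N)"
        using N0 by (simp add: u1 u2 field_simps)
      moreover have "\<bar>dirichlet_mod N u1\<bar> + \<bar>dirichlet_mod N u2\<bar> \<le> sin \<psi> * (1 / u1 + 1 / u2) - sin \<psi> * (u1 / 12 + u2 / 12)"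
        using dirichlet_mod_abs_le[OF r(1,2), of N] dirichlet_mod_abs_le[OF r(3,4), of N]
        unfolding a1 a2 by (simp add: algebra_simps)
      ultimately show ?thesis
        by (simp add: u1_def u2_def mult.left_commute)
    qed
    define R where "R = (\<Sum>j<N. (2 * real j + 1) * pi / (real j * (real j + 1) * pi\<^sup>2 + w))"
    have odd: "(\<Sum>j<N. 2 * real j + 1) = (real N)\<^sup>2"
      by (induction N) (auto simp: power2_eq_square algebra_simps)
    have "real N * (\<Sum>k\<le>N. \<bar>cardinal_cos N k \<theta>\<bar>)
        \<le> (\<Sum>j<N. real N * (sin \<psi> * ((2 * real j + 1) * pi / (real j * (real j + 1) * pi\<^sup>2 + w)))
        - sin \<psi> * ((2 * real j + 1) * pi / (12 * real N)))"
      by (rule order_trans[OF le sum_mono]) (use term_le in auto)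
    also have "\<dots> = real N * (sin \<psi> * R) - sin \<psi> * ((\<Sum>j<N. 2 * real j + 1) * pi / (12 * real N))"
      by (simp add: R_def sum_subtractf sum_distrib_left sum_distrib_right sum_divide_distrib)
    also have "\<dots> = real N * (sin \<psi> * (R - pi / 12))"
      unfolding odd using N by (simp add: field_simps power2_eq_square)
    finally have "(\<Sum>k\<le>N. \<bar>cardinal_cos N k \<theta>\<bar>) \<le> sin \<psi> * (R - pi / 12)"
      using N by (subst (asm) mult_le_cancel_left_pos) auto
    also have "\<dots> \<le> 4 * w / pi\<^sup>2 * (R - pi / 12)"
    proof (rule mult_right_mono)
      show "sin \<psi> \<le> 4 * w / pi\<^sup>2"
        using sin_le_parabola[of \<psi>] \<psi> by (simp add: w_def)
      \<comment> \<open>Replacing \<open>sin \<psi>\<close> by the larger parabola requires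
        \<open>R - pi / 12\<close> to be nonnegative; the term \<open>j = 0\<close> alone ensures
        this.\<close>
      have "pi / w \<le> R"
      proof -
        have "(\<Sum>j\<in>{0}. (2 * real j + 1) * pi / (real j * (real j + 1) * pi\<^sup>2 + w)) \<le> R"
          unfolding R_def using N w by (intro sum_mono2) auto
        then show ?thesis by simp
      qed
      moreover have "pi / 12 \<le> pi / w"
      proof (rule divide_left_mono)
        have "pi\<^sup>2 \<le> 4\<^sup>2" using pi_less_4 by (intro power_mono) auto
        then show "w \<le> 12" using w by simp
      qed (use w in auto)
      ultimately show "0 \<le> R - pi / 12" by linarith
    qed
    \<comment> \<open>The substitution \<open>s = 4 w / pi^2\<close>, which lies in
      \<open>(0, 1]\<close> and is 1 midway between two points.\<close>
    also have "\<dots> = 4 / pi * (\<Sum>j<N. (2 * real j + 1) * (4 * w / pi\<^sup>2) / (4 * real j * (real j + 1) + 4 * w / pi\<^sup>2))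
        - pi * (4 * w / pi\<^sup>2) / 12"
    proof -
      have "4 * w / pi\<^sup>2 * ((2 * real j + 1) * pi / (real j * (real j + 1) * pi\<^sup>2 + w)) =
        4 / pi * ((2 * real j + 1) * (4 * w / pi\<^sup>2) / (4 * real j * (real j + 1) + 4 * w / pi\<^sup>2))" for j
      proof -
        have "0 < real j * (real j + 1) * pi\<^sup>2 + w"
          using w by (intro add_nonneg_pos) auto
        moreover have "4 * real j * (real j + 1) + 4 * w / pi\<^sup>2 = 4 * (real j * (real j + 1) * pi\<^sup>2 + w) / pi\<^sup>2"
          by (simp add: field_simps)
        ultimately show ?thesis
          by (simp add: divide_simps power2_eq_square)
      qed
      then show ?thesis
        by (simp add: R_def right_diff_distrib sum_distrib_left)
    qed
    also have "\<dots> \<le> 4 / pi * (\<Sum>j<N. 1 / (2 * real j + 1)) - pi / 12"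
      by (rule lebesgue_sum_le[OF N]) (use w in \<open>auto simp: field_simps\<close>)
    finally show ?thesis by simp
  qed
qed

lemma sum_cardinal_cos_le_sqrt:
  assumes "1 \<le> N"
  shows "(\<Sum>k\<le>N. \<bar>cardinal_cos N k \<theta>\<bar>) \<le> sqrt (real N)"
proof -
  consider "N = 1" | "N = 2" | "3 \<le> N"
    using assms by linarith
  then show ?thesis
  proof cases
    case 3
    then have "1 \<le> sqrt (real N)" by simp
    then show ?thesis
      using sum_cardinal_cos_le_odd_harmonic[of N \<theta>] odd_harmonic_le_sqrt[of N] 3 by linarith
  qed (use sum_cardinal_cos_le_one[of \<theta>] sum_cardinal_cos_le_two[of \<theta>] in auto)
qed

section \<open>Aliasing errors\<close>

text \<open>Frequencies are integers because the recurrence is started from negative ones.\<close>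

definition alias_error :: "nat \<Rightarrow> real \<Rightarrow> int \<Rightarrow> real" where
  "alias_error N \<theta> k = cos (of_int k * \<theta>) - (\<Sum>j\<le>N. cardinal_cos N j \<theta> * cos (of_int k * cheb_angle N j))"

lemma alias_error_zero:
  assumes "1 \<le> N" "\<bar>k\<bar> \<le> int N"
  shows "alias_error N \<theta> k = 0"
proof -
  have c: "cos (of_int k * u) = cos (real (nat \<bar>k\<bar>) * u)" for u :: real
    by (cases "0 \<le> k") (auto simp: abs_if)
  show ?thesis
    unfolding alias_error_def c using cardinal_cos_reproduces[OF assms(1), of "nat \<bar>k\<bar>" \<theta>] assms(2) by simp
qed

text \<open>The frequencies \<open>k\<close> and \<open>k + 2 N\<close> coincide at the nodes and so
  have the same interpolant; the errors differ exactly as the two cosines do.\<close>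

lemma alias_error_shift:
  assumes "1 \<le> N"
  shows "alias_error N \<theta> (k + 2 * int N)
    = alias_error N \<theta> k - 2 * sin (real N * \<theta>) * sin (of_int (k + int N) * \<theta>)"
proof -
  have "cos (of_int (k + 2 * int N) * cheb_angle N j) = cos (of_int k * cheb_angle N j)" for j
  proof -
    have "of_int (k + 2 * int N) * cheb_angle N j = of_int k * cheb_angle N j + 2 * pi * of_int (int j)"
      using assms by (simp add: cheb_angle_def field_simps)
    then show ?thesis by (simp only: cos_add_int_multiple)
  qed
  moreover have "cos (of_int (k + 2 * int N) * \<theta>) = cos (of_int k * \<theta>) - 2 * sin (real N * \<theta>) * sin (of_int (k + int N) * \<theta>)"
  proof -
    define b where "b = of_int (k + int N) * \<theta>"
    have "of_int (k + 2 * int N) * \<theta> = b + real N * \<theta>" "of_int k * \<theta> = b - real N * \<theta>"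
      by (auto simp: b_def algebra_simps)
    then show ?thesis
      by (simp only: b_def[symmetric]) (simp add: cos_add cos_diff)
  qed
  ultimately show ?thesis
    by (simp add: alias_error_def)
qed

lemma abs_alias_error_le: "\<bar>alias_error N \<theta> k\<bar> \<le> 1 + (\<Sum>j\<le>N. \<bar>cardinal_cos N j \<theta>\<bar>)"
proof -
  have "\<bar>\<Sum>j\<le>N. cardinal_cos N j \<theta> * cos (of_int k * cheb_angle N j)\<bar> \<le> (\<Sum>j\<le>N. \<bar>cardinal_cos N j \<theta>\<bar>)"
    by (rule order_trans[OF sum_abs sum_mono]) (auto simp: abs_mult intro: mult_left_le)
  then show ?thesis
    unfolding alias_error_def using abs_cos_le_one[of "of_int k * \<theta>"] by linarith
qed

section \<open>Generating functions of sequences that are periodic up to given increments\<close>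

lemma summable_bounded_mult_power:
  fixes b :: "nat \<Rightarrow> 'a :: {real_normed_field, banach}"
  assumes "\<And>l. norm (b l) \<le> M" "norm x < 1"
  shows "summable (\<lambda>l. b l * x ^ l)"
proof (rule summable_comparison_test')
  show "summable (\<lambda>l. M * norm x ^ l)"
    using assms(2) by (intro summable_mult summable_geometric) auto
  show "norm (b n * x ^ n) \<le> M * norm x ^ n" for n
    using assms(1)[of n] by (auto simp: norm_mult norm_power intro: mult_right_mono)
qed

text \<open>Subtracting the series shifted by a period is multiplication by
  \<open>1 - x ^ P\<close>, and it leaves the increments. A general field is allowed because the
  lemma is applied at real \<open>x\<close> and at the complex point
  \<open>x cis \<theta>\<close>.\<close>

lemma suminf_recurrence:
  fixes a g :: "nat \<Rightarrow> 'a :: {real_normed_field, banach}"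
  assumes "\<And>l. l < P \<Longrightarrow> a l = g l" "\<And>l. a (l + P) = a l + g (l + P)"
    and "summable (\<lambda>l. a l * x ^ l)" "summable (\<lambda>l. g l * x ^ l)"
  shows "(\<Sum>l. a l * x ^ l) * (1 - x ^ P) = (\<Sum>l. g l * x ^ l)"
proof -
  have sg: "summable (\<lambda>l. g (l + P) * x ^ (l + P))"
    using assms(4) by (rule summable_ignore_initial_segment)
  have "(\<Sum>l. a l * x ^ l) = (\<Sum>l. a (l + P) * x ^ (l + P)) + (\<Sum>l<P. a l * x ^ l)"
    by (rule suminf_split_initial_segment[OF assms(3)])
  also have "(\<Sum>l. a (l + P) * x ^ (l + P)) = (\<Sum>l. x ^ P * (a l * x ^ l) + g (l + P) * x ^ (l + P))"
    by (simp add: assms(2) algebra_simps power_add)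
  also have "\<dots> = x ^ P * (\<Sum>l. a l * x ^ l) + (\<Sum>l. g (l + P) * x ^ (l + P))"
    using suminf_add[OF summable_mult[OF assms(3), of "x ^ P"] sg] suminf_mult[OF assms(3), of "x ^ P"] by simp
  also have "(\<Sum>l<P. a l * x ^ l) = (\<Sum>l<P. g l * x ^ l)"
    by (intro sum.cong) (auto simp: assms(1))
  finally show ?thesis
    using suminf_split_initial_segment[OF assms(4), of P] by (simp add: algebra_simps)
qed

text \<open>Squaring \<open>a (l + P) = a l + g (l + P)\<close> gives a recurrence of the same kind
  for the squares, with increments \<open>h\<close>; their mixed part remains as the last
  sum.\<close>

lemma suminf_recurrence_square:
  fixes a g :: "nat \<Rightarrow> real"
  assumes "\<And>l. l < P \<Longrightarrow> a l = g l" "\<And>l. a (l + P) = a l + g (l + P)"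
    and ba: "\<And>l. \<bar>a l\<bar> \<le> A" and bg: "\<And>l. \<bar>g l\<bar> \<le> G" and x: "0 < x" "x < 1"
  shows "(\<Sum>l. (a l)\<^sup>2 * x ^ l) * (1 - x ^ P)
    = (\<Sum>l. (g l)\<^sup>2 * x ^ l) + 2 * x ^ P * (\<Sum>l. a l * g (l + P) * x ^ l)"
proof -
  define h where "h = (\<lambda>l. if l < P then (g l)\<^sup>2 else (g l)\<^sup>2 + 2 * a (l - P) * g l)"
  have b1: "(a l)\<^sup>2 \<le> A\<^sup>2" "(g l)\<^sup>2 \<le> G\<^sup>2" for l
    using power_mono[OF ba[of l], of 2] power_mono[OF bg[of l], of 2] by auto
  have b2: "\<bar>a l * g k\<bar> \<le> A * G" for l k
    unfolding abs_mult using ba[of l] bg[of k] by (intro mult_mono) auto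
  have sa: "summable (\<lambda>l. (a l)\<^sup>2 * x ^ l)" and sg: "summable (\<lambda>l. (g l)\<^sup>2 * x ^ l)"
    and sag: "summable (\<lambda>l. a l * g (l + P) * x ^ l)"
    using x b1 b2 summable_bounded_mult_power[of "\<lambda>l. (a l)\<^sup>2" "A\<^sup>2" x]
      summable_bounded_mult_power[of "\<lambda>l. (g l)\<^sup>2" "G\<^sup>2" x]
      summable_bounded_mult_power[of "\<lambda>l. a l * g (l + P)" "A * G" x] by auto
  have hs: "(g (l + P))\<^sup>2 * x ^ (l + P) + 2 * x ^ P * (a l * g (l + P) * x ^ l) = h (l + P) * x ^ (l + P)" for l
    by (simp add: h_def algebra_simps power_add)
  have "summable (\<lambda>l. h (l + P) * x ^ (l + P))"
    unfolding hs[symmetric]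
    by (intro summable_add summable_mult sag summable_ignore_initial_segment[OF sg])
  then have sh: "summable (\<lambda>l. h l * x ^ l)"
    by (subst (asm) summable_iff_shift)
  have "(\<Sum>l. (a l)\<^sup>2 * x ^ l) * (1 - x ^ P) = (\<Sum>l. h l * x ^ l)"
    by (rule suminf_recurrence[OF _ _ sa sh]) (auto simp: assms(1,2) h_def power2_sum)
  also have "\<dots> = (\<Sum>l. h (l + P) * x ^ (l + P)) + (\<Sum>l<P. h l * x ^ l)"
    by (rule suminf_split_initial_segment[OF sh])
  also have "(\<Sum>l. h (l + P) * x ^ (l + P))
      = (\<Sum>l. (g (l + P))\<^sup>2 * x ^ (l + P)) + 2 * x ^ P * (\<Sum>l. a l * g (l + P) * x ^ l)"
    unfolding hs[symmetric]
    using suminf_add[OF summable_ignore_initial_segment[OF sg] summable_mult[OF sag]] suminf_mult[OF sag] by simp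
  also have "(\<Sum>l<P. h l * x ^ l) = (\<Sum>l<P. (g l)\<^sup>2 * x ^ l)"
    by (intro sum.cong) (auto simp: h_def)
  finally show ?thesis
    using suminf_split_initial_segment[OF sg, of P] by simp
qed

lemma suminf_geometric_cis:
  fixes x :: real
  assumes "0 < x" "x < 1"
  shows "(\<lambda>l. cis (real l * \<alpha>) * of_real x ^ l) sums (1 / (1 - of_real x * cis \<alpha>))"
proof -
  have "(\<lambda>l. (of_real x * cis \<alpha>) ^ l) sums (1 / (1 - of_real x * cis \<alpha>))"
    using assms by (intro geometric_sums) (auto simp: norm_mult)
  then show ?thesis
    by (simp add: power_mult_distrib Complex.DeMoivre mult.commute[of _ "cis _"])
qed

text \<open>The errors \<open>a l\<close> of the frequencies \<open>N + l\<close> satisfy \<open>a (l + 2 N) = a l + g (l + 2 N)\<close> with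
  \<open>g l\<close> a multiple of \<open>sin (l \<theta>)\<close>. Squaring this recurrence leaves only a cross term, which is the
  generating function of \<open>a\<close> at \<open>x cis \<theta>\<close>, and the recurrence makes that a quotient of
  geometric series.\<close>

lemma alias_energy_identity:
  fixes x \<theta> :: real
  assumes N: "1 \<le> N" and x: "0 < x" "x < 1"
  defines "q \<equiv> x ^ (2 * N)" and "s \<equiv> sin (real N * \<theta>)"
    and "\<epsilon> \<equiv> cis (2 * real N * \<theta>)" and "\<eta> \<equiv> cis (2 * \<theta>)"
  shows "(\<Sum>l. (alias_error N \<theta> (int N + int l))\<^sup>2 * x ^ l) * (1 - q)
    = 2 * s\<^sup>2 * Re ((1 / (1 - of_real x) - 1 / (1 - of_real x * \<eta>)) * ((1 + of_real q * \<epsilon>) / (1 - of_real q * \<epsilon>)))"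
proof -
  define a where "a l = alias_error N \<theta> (int N + int l)" for l
  define g where "g l = - 2 * s * sin (real l * \<theta>)" for l
  \<comment> \<open>The generating function of \<open>1 - \<eta> ^ l\<close>. Its real part carries
    the squares of \<open>sin (l \<theta>)\<close> and so yields the sum over the squared
    \<open>g l\<close>; multiplied by \<open>- \<i> * s\<close> it is the generating function of
    \<open>g\<close> at \<open>x cis \<theta>\<close>.\<close>
  define K where "K = 1 / (1 - of_real x) - 1 / (1 - of_real x * \<eta>)"
  \<comment> \<open>The frequency \<open>l + N\<close> arises by the shift \<open>2 N\<close> from
    \<open>l - N\<close>, whose modulus is at most \<open>N\<close> and which is therefore
    reproduced.\<close>
  have a0: "a l = g l" if "l < 2 * N" for l
  proof -
    have "alias_error N \<theta> (int l - int N + 2 * int N) = alias_error N \<theta> (int l - int N) - 2 * s * sin (of_int (int l - int N + int N) * \<theta>)"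
      unfolding s_def by (rule alias_error_shift[OF N])
    moreover have "alias_error N \<theta> (int l - int N) = 0"
      using that by (intro alias_error_zero[OF N]) auto
    ultimately show ?thesis
      by (simp add: a_def g_def add.commute)
  qed
  have a1: "a (l + 2 * N) = a l + g (l + 2 * N)" for l
    using alias_error_shift[OF N, of \<theta> "int N + int l"] by (simp add: a_def g_def s_def algebra_simps)
  define A where "A = 1 + (\<Sum>j\<le>N. \<bar>cardinal_cos N j \<theta>\<bar>)"
  have ba: "\<bar>a l\<bar> \<le> A" for l
    unfolding a_def A_def by (rule abs_alias_error_le)
  have bg: "\<bar>g l\<bar> \<le> 2" for l
    using mult_mono[of "\<bar>s\<bar>" 1 "\<bar>sin (real l * \<theta>)\<bar>" 1] by (simp add: g_def s_def abs_mult)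
  have q: "0 < q" "q < 1"
    using x N by (auto simp: q_def power_less_one_iff)
  have nz: "1 - of_real q * \<epsilon> \<noteq> 0"
  proof
    assume "1 - of_real q * \<epsilon> = 0"
    then have "norm (of_real q * \<epsilon>) = 1" by simp
    then show False using q by (simp add: norm_mult \<epsilon>_def)
  qed
  have geo: "(\<lambda>l. \<eta> ^ l * of_real x ^ l) sums (1 / (1 - of_real x * \<eta>))"
    "(\<lambda>l. of_real x ^ l) sums (1 / (1 - of_real x :: complex))"
    using suminf_geometric_cis[OF x, of "2 * \<theta>"] suminf_geometric_cis[OF x, of 0]
    by (simp_all add: \<eta>_def Complex.DeMoivre)
  have K: "(\<lambda>l. (1 - \<eta> ^ l) * of_real x ^ l) sums K"
    using sums_diff[OF geo(2,1)] by (simp add: K_def left_diff_distrib)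
  have cc: "cis \<alpha> * cis \<alpha> = cis (2 * \<alpha>)" for \<alpha>
    by (simp add: cis_mult)
  have Z: "(\<Sum>l. (a l)\<^sup>2 * x ^ l) * (1 - q) = (\<Sum>l. (g l)\<^sup>2 * x ^ l) + 2 * q * (\<Sum>l. a l * g (l + 2 * N) * x ^ l)"
    unfolding q_def by (rule suminf_recurrence_square[where a = a and g = g, OF a0 a1 ba bg x])
  have G: "(\<Sum>l. (g l)\<^sup>2 * x ^ l) = 2 * s\<^sup>2 * Re K"
  proof (rule sums_unique[symmetric])
    have "(\<lambda>l. 2 * s\<^sup>2 * Re ((1 - \<eta> ^ l) * of_real x ^ l)) sums (2 * s\<^sup>2 * Re K)"
      by (intro sums_mult sums_Re K)
    moreover have "(\<lambda>l. 2 * s\<^sup>2 * Re ((1 - \<eta> ^ l) * of_real x ^ l)) = (\<lambda>l. (g l)\<^sup>2 * x ^ l)"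
    proof (rule ext)
      fix l
      have "Re (1 - \<eta> ^ l) = 2 * (sin (real l * \<theta>))\<^sup>2"
        using cos_double_sin[of "real l * \<theta>"] by (simp add: \<eta>_def Complex.DeMoivre mult.left_commute)
      then show "2 * s\<^sup>2 * Re ((1 - \<eta> ^ l) * of_real x ^ l) = (g l)\<^sup>2 * x ^ l"
        by (simp add: g_def power_mult_distrib flip: of_real_power)
    qed
    ultimately show "(\<lambda>l. (g l)\<^sup>2 * x ^ l) sums (2 * s\<^sup>2 * Re K)" by (simp only:)
  qed
  \<comment> \<open>The cross term contains \<open>sin ((l + 2 N) \<theta>)\<close>, the imaginary
    part of \<open>\<epsilon> cis (l \<theta>)\<close>. With the weight \<open>x ^ l\<close> this is
    the generating function of \<open>a\<close> at \<open>v\<close>, rotated by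
    \<open>\<epsilon>\<close>.\<close>
  define v where "v = of_real x * cis \<theta>"
  have nv: "norm v < 1"
    using x by (simp add: v_def norm_mult)
  have gv: "(\<lambda>l. of_real (g l) * v ^ l) sums (- \<i> * of_real s * K)"
  proof -
    have "(\<lambda>l. - \<i> * of_real s * ((1 - \<eta> ^ l) * of_real x ^ l)) sums (- \<i> * of_real s * K)"
      by (intro sums_mult K)
    moreover have "- \<i> * of_real s * ((1 - \<eta> ^ l) * of_real x ^ l) = of_real (g l) * v ^ l" for l
    proof -
      let ?c = "cis (real l * \<theta>)"
      have "2 * of_real (sin (real l * \<theta>)) * ?c = \<i> * (1 - ?c * ?c)"
      proof -
        have "1 = cnj ?c * ?c"
          by (simp add: cis_mult cis_cnj)
        then have "\<i> * (1 - ?c * ?c) = \<i> * (cnj ?c - ?c) * ?c"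
          by (simp add: algebra_simps)
        also have "\<i> * (cnj ?c - ?c) = 2 * of_real (sin (real l * \<theta>))"
          by (simp add: complex_eq_iff)
        finally show ?thesis by simp
      qed
      moreover have "\<eta> ^ l = ?c * ?c"
        by (simp add: \<eta>_def Complex.DeMoivre cis_mult mult_ac)
      moreover have "v ^ l = of_real x ^ l * ?c"
        by (simp add: v_def power_mult_distrib Complex.DeMoivre)
      ultimately show ?thesis
        by (simp add: g_def mult.assoc)
    qed
    ultimately show ?thesis by simp
  qed
  define \<Phi> where "\<Phi> = (\<Sum>l. of_real (a l) * v ^ l)"
  have sa: "summable (\<lambda>l. complex_of_real (a l) * v ^ l)"
    using ba by (intro summable_bounded_mult_power[OF _ nv]) auto
  have "\<Phi> * (1 - v ^ (2 * N)) = (\<Sum>l. of_real (g l) * v ^ l)"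
    unfolding \<Phi>_def
    by (rule suminf_recurrence[OF _ _ sa sums_summable[OF gv]]) (auto simp: a0 a1)
  moreover have "v ^ (2 * N) = of_real q * \<epsilon>"
    unfolding v_def q_def \<epsilon>_def power_mult_distrib Complex.DeMoivre by simp
  ultimately have "\<Phi> * (1 - of_real q * \<epsilon>) = - \<i> * of_real s * K"
    using sums_unique[OF gv] by simp
  then have \<Phi>: "\<Phi> = - \<i> * of_real s * K / (1 - of_real q * \<epsilon>)"
    by (simp only: nonzero_eq_divide_eq[OF nz])
  have H: "(\<Sum>l. a l * g (l + 2 * N) * x ^ l) = 2 * s\<^sup>2 * Re (\<epsilon> * K / (1 - of_real q * \<epsilon>))"
  proof -
    have "(\<lambda>l. of_real (a l) * v ^ l) sums \<Phi>"
      unfolding \<Phi>_def using sa by (rule summable_sums)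
    then have "(\<lambda>l. - 2 * s * Im (\<epsilon> * (of_real (a l) * v ^ l))) sums (- 2 * s * Im (\<epsilon> * \<Phi>))"
      by (intro sums_mult sums_Im)
    moreover have "- 2 * s * Im (\<epsilon> * (of_real (a l) * v ^ l)) = a l * g (l + 2 * N) * x ^ l" for l
    proof -
      have eq: "\<epsilon> * (of_real (a l) * v ^ l) = of_real (a l * x ^ l) * cis (real (l + 2 * N) * \<theta>)"
        by (simp add: v_def power_mult_distrib Complex.DeMoivre \<epsilon>_def distrib_right flip: cis_mult)
      show ?thesis
        unfolding eq g_def by simp
    qed
    ultimately have "(\<lambda>l. a l * g (l + 2 * N) * x ^ l) sums (- 2 * s * Im (\<epsilon> * \<Phi>))"
      by simp
    moreover have "\<epsilon> * \<Phi> = - \<i> * of_real s * (\<epsilon> * K / (1 - of_real q * \<epsilon>))"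
      by (simp add: \<Phi>)
    then have "- 2 * s * Im (\<epsilon> * \<Phi>) = 2 * s\<^sup>2 * Re (\<epsilon> * K / (1 - of_real q * \<epsilon>))"
      by (simp only:) (simp add: power2_eq_square del: times_divide_eq_right)
    ultimately show ?thesis
      by (simp add: sums_iff)
  qed
  have "(1 + of_real q * \<epsilon>) / (1 - of_real q * \<epsilon>) = 1 + 2 * of_real q * \<epsilon> / (1 - of_real q * \<epsilon>)"
    using nz by (simp add: divide_simps)
  then have "K * ((1 + of_real q * \<epsilon>) / (1 - of_real q * \<epsilon>)) = K + of_real (2 * q) * (\<epsilon> * K / (1 - of_real q * \<epsilon>))"
    by (simp add: algebra_simps)
  then have "Re (K * ((1 + of_real q * \<epsilon>) / (1 - of_real q * \<epsilon>))) = Re K + 2 * q * Re (\<epsilon> * K / (1 - of_real q * \<epsilon>))"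
    by (simp only: plus_complex.sel Re_complex_of_real times_complex.sel Im_complex_of_real)
  then show ?thesis
    using Z[unfolded G H] unfolding K_def[symmetric] a_def[symmetric]
    by (simp only: distrib_left) simp
qed

text \<open>\<open>Re w + cmod w\<close> is the largest real part of \<open>(1 + \<zeta>) w\<close>
  over \<open>|\<zeta>| = 1\<close>, the form in which the bound is needed. Clearing denominators
  leaves a polynomial inequality in \<open>q\<close> and \<open>\<sigma>\<close>.\<close>

lemma moebius_energy_bound:
  fixes q \<alpha> :: real
  assumes q: "0 \<le> q" "q \<le> 1 / 4"
  defines "\<sigma> \<equiv> (sin \<alpha>)\<^sup>2" and "w \<equiv> (1 + of_real q * cis (2 * \<alpha>)) / (1 - of_real q * cis (2 * \<alpha>))"
  shows "\<sigma> * (Re w + cmod w) \<le> 2 * (1 - q)"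
proof -
  let ?c = "of_real q * cis (2 * \<alpha>)"
  define E where "E = (1 - q)\<^sup>2 + 4 * q * \<sigma>"
  have \<sigma>: "0 \<le> \<sigma>" "\<sigma> \<le> 1"
    using abs_sin_le_one[of \<alpha>] by (auto simp: \<sigma>_def abs_square_le_1)
  have c2: "cos (2 * \<alpha>) = 1 - 2 * \<sigma>"
    by (simp add: cos_double_sin \<sigma>_def)
  have s2: "(sin (2 * \<alpha>))\<^sup>2 = 1 - (1 - 2 * \<sigma>)\<^sup>2"
    using sin_cos_squared_add[of "2 * \<alpha>"] c2 by simp
  have m1: "(cmod (1 - ?c))\<^sup>2 = E"
    by (simp add: cmod_power2 c2 power_mult_distrib s2 E_def) (simp add: power2_eq_square algebra_simps)
  have m2: "(cmod (1 + ?c))\<^sup>2 = (1 + q)\<^sup>2 - 4 * q * \<sigma>"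
    by (simp add: cmod_power2 c2 power_mult_distrib s2) (simp add: power2_eq_square algebra_simps)
  have E: "0 < E"
    unfolding E_def using q \<sigma> by (intro add_pos_nonneg) auto
  have q2: "0 < 1 - q\<^sup>2"
    using q power_mono[of q "1/4" 2] by (simp add: power2_eq_square)
  have w: "w = (1 + ?c) * cnj (1 - ?c) / of_real E"
    unfolding w_def using complex_div_cnj[of "1 + ?c" "1 - ?c"] m1
    by simp
  have rw: "Re w = (1 - q\<^sup>2) / E"
  proof -
    have "Re ((1 + ?c) * cnj (1 - ?c))
        = 1 - q\<^sup>2 * ((cos (2 * \<alpha>))\<^sup>2 + (sin (2 * \<alpha>))\<^sup>2)"
      by (simp add: algebra_simps power2_eq_square del: sin_cos_squared_add2)
    then show ?thesis
      unfolding w by (simp add: Re_divide_of_real)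
  qed
  \<comment> \<open>The tangent bound \<open>sqrt (A^2 + y) <= A + y / (2 A)\<close> for the root in
    \<open>cmod w\<close>, with \<open>A = 1 - q^2\<close> and
    \<open>y = 16 q^2 \<sigma> (1 - \<sigma>)\<close>.\<close>
  define t where "t = 8 * q\<^sup>2 * \<sigma> * (1 - \<sigma>) / (1 - q\<^sup>2)"
  have tq: "(1 - q\<^sup>2) * t = 8 * q\<^sup>2 * \<sigma> * (1 - \<sigma>)"
    using q2 by (simp add: t_def)
  have t0: "0 \<le> t"
    unfolding t_def using q2 \<sigma> by auto
  have "cmod (1 + ?c) * cmod (1 - ?c) \<le> (1 - q\<^sup>2) + t"
  proof (rule power2_le_imp_le)
    have "(cmod (1 + ?c) * cmod (1 - ?c))\<^sup>2
        = ((1 + q)\<^sup>2 - 4 * q * \<sigma>) * E"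
      by (simp add: power_mult_distrib m1 m2)
    also have "\<dots> = (1 - q\<^sup>2)\<^sup>2 + 16 * q\<^sup>2 * \<sigma> * (1 - \<sigma>)"
      by (simp add: E_def power2_eq_square algebra_simps)
    also have "\<dots> = (1 - q\<^sup>2)\<^sup>2 + 2 * (1 - q\<^sup>2) * t"
    proof -
      have "2 * ((1 - q\<^sup>2) * t) = 16 * q\<^sup>2 * \<sigma> * (1 - \<sigma>)"
        unfolding tq by simp
      then show ?thesis by (simp only: mult.assoc)
    qed
    also have "\<dots> \<le> (1 - q\<^sup>2 + t)\<^sup>2"
      by (simp add: power2_sum)
    finally show "(cmod (1 + ?c) * cmod (1 - ?c))\<^sup>2 \<le> (1 - q\<^sup>2 + t)\<^sup>2" .
  qed (use q2 t0 in auto)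
  then have cw: "cmod w \<le> ((1 - q\<^sup>2) + t) / E"
    unfolding w norm_divide norm_mult complex_mod_cnj using E by (simp add: divide_right_mono)
  have main: "\<sigma> * (2 * (1 - q\<^sup>2) + t) \<le> 2 * (1 - q) * E"
  proof -
    have "\<sigma> * (1 - \<sigma>) \<le> 1 / 4"
      using zero_le_power2[of "\<sigma> - 1 / 2"] by (simp add: power2_eq_square algebra_simps)
    then have 1: "\<sigma> * (\<sigma> * (1 - \<sigma>)) \<le> 1 * (1 / 4)"
      using \<sigma> by (intro mult_mono) auto
    have q2': "(15 / 16)\<^sup>2 \<le> (1 - q\<^sup>2)\<^sup>2"
      using power_mono[of q "1/4" 2] q by (intro power_mono) (auto simp: power2_eq_square)
    have "4 * q\<^sup>2 * (\<sigma> * (\<sigma> * (1 - \<sigma>))) \<le> 4 * q\<^sup>2 * (1 / 4)"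
      using 1 by (intro mult_left_mono) auto
    also have "\<dots> = q * q" by (simp add: power2_eq_square)
    also have "\<dots> \<le> q * (1 - q\<^sup>2)\<^sup>2"
      using q q2' by (intro mult_left_mono) (auto simp: power2_eq_square)
    \<comment> \<open>Written as the value at \<open>\<sigma> = 1\<close>, the worst case of the
      bracket, which decreases in \<open>\<sigma>\<close> because \<open>3 q <= 1\<close>.\<close>
    also have "\<dots> = (1 - q)\<^sup>2 * (1 + q) * ((1 - q)\<^sup>2 - 1 * (1 - 3 * q))"
      by (simp add: power2_eq_square algebra_simps)
    also have "\<dots> \<le> (1 - q)\<^sup>2 * (1 + q) * ((1 - q)\<^sup>2 - \<sigma> * (1 - 3 * q))"
      using q \<sigma> by (intro mult_left_mono diff_left_mono mult_right_mono) auto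
    also have "\<dots> = (1 - q) * (1 - q\<^sup>2) * E - \<sigma> * (1 - q\<^sup>2)\<^sup>2"
      by (simp add: E_def power2_eq_square algebra_simps)
    finally have "4 * q\<^sup>2 * (\<sigma> * (\<sigma> * (1 - \<sigma>))) \<le> (1 - q) * (1 - q\<^sup>2) * E - \<sigma> * (1 - q\<^sup>2)\<^sup>2" .
    note le = this
    have "(1 - q\<^sup>2) * (\<sigma> * (2 * (1 - q\<^sup>2) + t)) \<le> (1 - q\<^sup>2) * (2 * (1 - q) * E)"
    proof -
      have "(1 - q\<^sup>2) * (\<sigma> * (2 * (1 - q\<^sup>2) + t)) = 2 * (\<sigma> * (1 - q\<^sup>2)\<^sup>2) + \<sigma> * ((1 - q\<^sup>2) * t)"
        by (simp add: power2_eq_square algebra_simps)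
      then show ?thesis
        using le unfolding tq by (simp add: algebra_simps)
    qed
    then show ?thesis
      using q2 by (subst (asm) mult_le_cancel_left_pos) auto
  qed
  have "\<sigma> * (Re w + cmod w) \<le> \<sigma> * ((1 - q\<^sup>2) / E + ((1 - q\<^sup>2) + t) / E)"
    using rw cw \<sigma> by (intro mult_left_mono) auto
  also have "\<dots> = \<sigma> * (2 * (1 - q\<^sup>2) + t) / E"
    by (simp add: add_divide_distrib[symmetric])
  also have "\<dots> \<le> 2 * (1 - q)"
    using main E by (simp add: divide_le_eq)
  finally show ?thesis .
qed

text \<open>The factor \<open>1 - x ^ (2 * N)\<close> of the identity cancels against the one in
  \<open>moebius_energy_bound\<close>, which leaves a bound independent of \<open>N\<close> and
  \<open>\<theta>\<close>.\<close>

lemma alias_energy_le: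
  fixes x \<theta> :: real
  assumes N: "1 \<le> N" and x: "0 < x" "x < 1" and q: "x ^ (2 * N) \<le> 1 / 4"
  shows "summable (\<lambda>l. (alias_error N \<theta> (int N + int l))\<^sup>2 * x ^ l)"
    and "(\<Sum>l. (alias_error N \<theta> (int N + int l))\<^sup>2 * x ^ l) \<le> 4 * x / (1 - x\<^sup>2)"
proof -
  let ?Z = "\<Sum>l. (alias_error N \<theta> (int N + int l))\<^sup>2 * x ^ l"
  let ?A = "1 + (\<Sum>j\<le>N. \<bar>cardinal_cos N j \<theta>\<bar>)"
  have "(alias_error N \<theta> k)\<^sup>2 \<le> ?A\<^sup>2" for k
    using power_mono[OF abs_alias_error_le[of N \<theta> k], of 2] by simp
  then show "summable (\<lambda>l. (alias_error N \<theta> (int N + int l))\<^sup>2 * x ^ l)"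
    using x by (intro summable_bounded_mult_power[where M = "?A\<^sup>2"]) auto
  define q' where "q' = x ^ (2 * N)"
  define w where "w = (1 + of_real q' * cis (2 * (real N * \<theta>))) / (1 - of_real q' * cis (2 * (real N * \<theta>)))"
  define \<eta> where "\<eta> = cis (2 * \<theta>)"
  \<comment> \<open>\<open>(1 - \<eta>) / (1 - x \<eta>)\<close> lies on the circle through \<open>0\<close> and \<open>2 / (1 + x)\<close>:
    it is \<open>(1 + \<zeta>) / (1 + x)\<close> with \<open>\<bar>\<zeta>\<bar> = 1\<close>.\<close>
  define \<zeta> where "\<zeta> = (of_real x - \<eta>) / (1 - of_real x * \<eta>)"
  have nz: "1 - of_real x * \<eta> \<noteq> 0"
  proof
    assume "1 - of_real x * \<eta> = 0"
    then have "norm (of_real x * \<eta>) = 1" by simp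
    then show False using x by (simp add: norm_mult \<eta>_def)
  qed
  have "cmod (of_real x - \<eta>) = cmod (1 - of_real x * \<eta>)"
  proof -
    have "of_real x - \<eta> = - (\<eta> * cnj (1 - of_real x * \<eta>))"
      by (simp add: \<eta>_def right_diff_distrib cis_cnj cis_mult)
    then have "cmod (of_real x - \<eta>) = cmod \<eta> * cmod (cnj (1 - of_real x * \<eta>))"
      by (simp only: norm_minus_cancel norm_mult)
    then show ?thesis
      unfolding complex_mod_cnj by (simp add: \<eta>_def)
  qed
  then have \<zeta>: "cmod \<zeta> = 1"
    using nz by (simp add: \<zeta>_def norm_divide)
  have x2: "0 < 1 - x\<^sup>2"
    using x by (simp add: power_less_one_iff)
  have x3: "1 - complex_of_real x \<noteq> 0" "1 + complex_of_real x \<noteq> 0"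
    using x by (auto simp: complex_eq_iff)
  have K: "1 / (1 - of_real x) - 1 / (1 - of_real x * \<eta>) = of_real (x / (1 - x\<^sup>2)) * (1 + \<zeta>)"
  proof -
    have e: "complex_of_real (x / (1 - x\<^sup>2)) = of_real x / ((1 - of_real x) * (1 + of_real x))"
      by (simp add: power2_eq_square algebra_simps)
    have "1 + \<zeta> = (1 + of_real x) * ((1 - \<eta>) / (1 - of_real x * \<eta>))"
      using nz by (simp add: \<zeta>_def divide_simps) (simp add: algebra_simps)
    moreover have "1 / (1 - of_real x) - 1 / (1 - of_real x * \<eta>)
        = of_real x / (1 - of_real x) * ((1 - \<eta>) / (1 - of_real x * \<eta>))"
      using nz x3 by (simp add: divide_simps) (simp add: algebra_simps)
    ultimately show ?thesis
      unfolding e using x3 by simp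
  qed
  have q': "0 \<le> q'" "q' \<le> 1 / 4"
    using q x by (auto simp: q'_def)
  have "?Z * (1 - q')
     = 2 * (sin (real N * \<theta>))\<^sup>2 * Re (of_real (x / (1 - x\<^sup>2)) * (1 + \<zeta>) * w)"
    using alias_energy_identity[OF N x, of \<theta>] unfolding w_def K[symmetric] q'_def \<eta>_def mult.assoc .
  also have "\<dots> = 2 * x / (1 - x\<^sup>2) * ((sin (real N * \<theta>))\<^sup>2 * Re ((1 + \<zeta>) * w))"
    by (simp add: mult.assoc Re_divide_of_real del: of_real_divide)
  \<comment> \<open>This discards how \<open>\<theta>\<close> enters through \<open>\<zeta>\<close>;
    what remains depends on \<open>\<theta>\<close> only through \<open>N \<theta>\<close>.\<close>
  also have "\<dots> \<le> 2 * x / (1 - x\<^sup>2) * ((sin (real N * \<theta>))\<^sup>2 * (Re w + cmod w))"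
  proof (intro mult_left_mono)
    have "Re (\<zeta> * w) \<le> cmod (\<zeta> * w)" by (rule complex_Re_le_cmod)
    then show "Re ((1 + \<zeta>) * w) \<le> Re w + cmod w"
      by (simp add: norm_mult \<zeta> distrib_right)
  qed (use x x2 in auto)
  also have "\<dots> \<le> 2 * x / (1 - x\<^sup>2) * (2 * (1 - q'))"
    unfolding w_def using moebius_energy_bound[OF q', of "real N * \<theta>"] x x2
    by (intro mult_left_mono) auto
  also have "\<dots> = 4 * x / (1 - x\<^sup>2) * (1 - q')"
    by simp
  finally show "?Z \<le> 4 * x / (1 - x\<^sup>2)"
    using q' by (subst (asm) mult_le_cancel_right_pos) auto
qed

section \<open>Cauchy's formula on Bernstein ellipses\<close>

definition joukowski :: "complex \<Rightarrow> complex" where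
  "joukowski w = (w + 1 / w) / 2"

definition circle_param :: "real \<Rightarrow> real \<Rightarrow> complex" where
  "circle_param r t = of_real r * cis (2 * pi * t)"

definition chebyshev_kernel :: "real \<Rightarrow> complex \<Rightarrow> complex" where
  "chebyshev_kernel \<theta> w = 1 / (1 - cis \<theta> / w) + 1 / (1 - cis (- \<theta>) / w) - 1"

text \<open>\<open>joukowski w - 1\<close> and \<open>joukowski w + 1\<close> are squares divided by
  \<open>2 w\<close>, and the parallelogram law adds their moduli. Hence the circle of radius
  \<open>r\<close> is mapped to the boundary of \<open>bernstein_ellipse r\<close>.\<close>

lemma joukowski_foci_dist:
  assumes "w \<noteq> 0"
  shows "cmod (joukowski w - 1) + cmod (joukowski w + 1) = cmod w + 1 / cmod w"
proof -
  have "joukowski w - 1 = (w - 1)\<^sup>2 / (2 * w)" "joukowski w + 1 = (w + 1)\<^sup>2 / (2 * w)"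
    using assms by (simp_all add: joukowski_def field_simps power2_eq_square)
  then have "cmod (joukowski w - 1) + cmod (joukowski w + 1)
      = ((cmod (w - 1))\<^sup>2 + (cmod (w + 1))\<^sup>2) / (2 * cmod w)"
    by (simp add: norm_divide norm_mult norm_power add_divide_distrib)
  also have "(cmod (w - 1))\<^sup>2 + (cmod (w + 1))\<^sup>2 = 2 * (cmod w)\<^sup>2 + 2"
    unfolding cmod_power2 by (simp add: power2_eq_square algebra_simps)
  also have "(2 * (cmod w)\<^sup>2 + 2) / (2 * cmod w) = cmod w + 1 / cmod w"
    using assms by (simp add: field_simps power2_eq_square)
  finally show ?thesis .
qed

lemma add_inverse_strict_mono:
  fixes r \<rho> :: real
  assumes "1 \<le> r" "r < \<rho>"
  shows "r + 1 / r < \<rho> + 1 / \<rho>"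
proof -
  have "1 * 1 < r * \<rho>"
    using assms by (intro mult_le_less_imp_less) auto
  then have "0 < (\<rho> - r) * (r * \<rho> - 1)"
    using assms by simp
  also have "\<dots> = ((\<rho> + 1 / \<rho>) - (r + 1 / r)) * (r * \<rho>)"
    using assms by (simp add: field_simps)
  finally have "0 < ((\<rho> + 1 / \<rho>) - (r + 1 / r)) * (r * \<rho>)" .
  moreover have "0 < r * \<rho>"
    using assms by (intro mult_pos_pos) auto
  ultimately have "0 < (\<rho> + 1 / \<rho>) - (r + 1 / r)"
    by (rule zero_less_mult_pos2)
  then show ?thesis by simp
qed

lemma joukowski_in_bernstein_ellipse:
  assumes "1 \<le> cmod w" "cmod w < \<rho>"
  shows "joukowski w \<in> bernstein_ellipse \<rho>"
proof -
  have "w \<noteq> 0" using assms by auto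
  then show ?thesis
    using joukowski_foci_dist[of w] add_inverse_strict_mono[OF assms]
    by (simp add: bernstein_ellipse_def)
qed

text \<open>Convexity makes Cauchy's integral formula available for any closed path in the ellipse,
  without a homotopy argument.\<close>

lemma convex_bernstein_ellipse: "convex (bernstein_ellipse \<rho>)"
proof (rule convexI)
  fix z w :: complex and u v :: real
  assume z: "z \<in> bernstein_ellipse \<rho>" and w: "w \<in> bernstein_ellipse \<rho>"
    and uv: "0 \<le> u" "0 \<le> v" "u + v = 1"
  have tri: "cmod (u *\<^sub>R z + v *\<^sub>R w - c) \<le> u * cmod (z - c) + v * cmod (w - c)" for c
  proof -
    have "u *\<^sub>R z + v *\<^sub>R w - c = u *\<^sub>R z + v *\<^sub>R w - (u + v) *\<^sub>R c"
      using uv by simp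
    also have "\<dots> = u *\<^sub>R (z - c) + v *\<^sub>R (w - c)"
      by (simp add: algebra_simps)
    finally show ?thesis
      using norm_triangle_ineq[of "u *\<^sub>R (z - c)" "v *\<^sub>R (w - c)"] uv by simp
  qed
  have "cmod (u *\<^sub>R z + v *\<^sub>R w - 1) + cmod (u *\<^sub>R z + v *\<^sub>R w + 1)
      \<le> u * (cmod (z - 1) + cmod (z + 1)) + v * (cmod (w - 1) + cmod (w + 1))"
    using tri[of 1] tri[of "- 1"] by (simp add: algebra_simps)
  also have "\<dots> < \<rho> + 1 / \<rho>"
    by (rule convex_bound_lt) (use z w uv in \<open>auto simp: bernstein_ellipse_def\<close>)
  finally show "u *\<^sub>R z + v *\<^sub>R w \<in> bernstein_ellipse \<rho>"
    by (simp add: bernstein_ellipse_def)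
qed

lemma open_bernstein_ellipse: "open (bernstein_ellipse \<rho>)"
  unfolding bernstein_ellipse_def by (intro open_Collect_less continuous_intros)

text \<open>The preimages of \<open>cos \<theta>\<close> are \<open>cis \<theta>\<close> and
  \<open>cis (- \<theta>)\<close>, both on the unit circle, so the image of a circle of radius
  \<open>r > 1\<close> avoids \<open>cos \<theta>\<close>.\<close>

lemma joukowski_minus_cos:
  assumes "w \<noteq> 0"
  shows "joukowski w - of_real (cos \<theta>) = (w - cis \<theta>) * (w - cis (- \<theta>)) / (2 * w)"
proof -
  have "cis \<theta> + cis (- \<theta>) = 2 * of_real (cos \<theta>)" "cis \<theta> * cis (- \<theta>) = 1"
    by (simp add: complex_eq_iff) (simp add: cis_mult)
  then have "(w - cis \<theta>) * (w - cis (- \<theta>)) = w\<^sup>2 - 2 * of_real (cos \<theta>) * w + 1"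
    by (simp add: algebra_simps power2_eq_square flip: distrib_left distrib_right)
  then show ?thesis
    using assms by (simp add: joukowski_def field_simps power2_eq_square)
qed

lemma of_real_cos_in_bernstein_ellipse:
  assumes "1 < \<rho>"
  shows "of_real (cos \<theta>) \<in> bernstein_ellipse \<rho>"
proof -
  have "joukowski (cis \<theta>) = of_real (cos \<theta>)"
    using joukowski_minus_cos[of "cis \<theta>" \<theta>] by simp
  then show ?thesis
    using joukowski_in_bernstein_ellipse[of "cis \<theta>" \<rho>] assms by simp
qed

text \<open>The logarithmic derivative of the factorization in \<open>joukowski_minus_cos\<close>.
  The first form serves Cauchy's formula, the second the winding number.\<close>

lemma joukowski_deriv_kernel:
  assumes "1 < cmod w"
  shows "deriv joukowski w / (joukowski w - of_real (cos \<theta>)) = chebyshev_kernel \<theta> w / w"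
    "deriv joukowski w / (joukowski w - of_real (cos \<theta>)) = 1 / (w - cis \<theta>) + 1 / (w - cis (- \<theta>)) - 1 / w"
proof -
  have nz: "w \<noteq> 0" "w - cis \<theta> \<noteq> 0" "w - cis (- \<theta>) \<noteq> 0"
    using assms by auto
  have d: "deriv joukowski w = (1 - 1 / w\<^sup>2) / 2"
  proof (rule DERIV_imp_deriv)
    show "(joukowski has_field_derivative (1 - 1 / w\<^sup>2) / 2) (at w)"
      unfolding joukowski_def
      by (rule derivative_eq_intros | use nz in \<open>force simp: power2_eq_square\<close>)+
  qed
  have s: "cis \<theta> * cis (- \<theta>) = 1"
    by (simp add: cis_mult)
  have num: "w * (w - cis (- \<theta>)) + w * (w - cis \<theta>) - (w - cis \<theta>) * (w - cis (- \<theta>)) = w\<^sup>2 - 1"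
    using s by (simp add: algebra_simps power2_eq_square)
  have "deriv joukowski w / (joukowski w - of_real (cos \<theta>)) = (w\<^sup>2 - 1) / (w * ((w - cis \<theta>) * (w - cis (- \<theta>))))"
  proof -
    define P where "P = (w - cis \<theta>) * (w - cis (- \<theta>))"
    have "P \<noteq> 0" using nz by (simp add: P_def)
    then show ?thesis
      unfolding d joukowski_minus_cos[OF nz(1)] P_def[symmetric] using nz(1)
      by (simp add: divide_simps power2_eq_square)
  qed
  also have "\<dots> = 1 / (w - cis \<theta>) + 1 / (w - cis (- \<theta>)) - 1 / w"
  proof -
    have "1 / (w - cis \<theta>) = w * (w - cis (- \<theta>)) / (w * ((w - cis \<theta>) * (w - cis (- \<theta>))))"
      "1 / (w - cis (- \<theta>)) = w * (w - cis \<theta>) / (w * ((w - cis \<theta>) * (w - cis (- \<theta>))))"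
      "1 / w = (w - cis \<theta>) * (w - cis (- \<theta>)) / (w * ((w - cis \<theta>) * (w - cis (- \<theta>))))"
      using nz by simp_all
    then show ?thesis
      unfolding num[symmetric] by (simp only: diff_divide_distrib add_divide_distrib)
  qed
  finally show *: "deriv joukowski w / (joukowski w - of_real (cos \<theta>)) = 1 / (w - cis \<theta>) + 1 / (w - cis (- \<theta>)) - 1 / w" .
  have "1 / (w - c) = 1 / (1 - c / w) / w" if "w - c \<noteq> 0" for c
    using nz that by (simp add: field_simps)
  then show "deriv joukowski w / (joukowski w - of_real (cos \<theta>)) = chebyshev_kernel \<theta> w / w"
    unfolding * chebyshev_kernel_def using nz by (simp add: add_divide_distrib diff_divide_distrib)
qed

lemma circlepath_eq_circle_param: "circlepath 0 r t = circle_param r t"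
  by (simp add: circlepath circle_param_def cis_conv_exp mult_ac)

text \<open>Cauchy's formula on the image of a circle under the Joukowski map. The kernel is
  \<open>1 + 2 (\<Sum>k\<ge>1. cos (k \<theta>) / w ^ k)\<close>, so interpolation in \<open>\<theta>\<close> acts on it frequency by frequency.\<close>

lemma has_integral_chebyshev_kernel:
  assumes F: "F holomorphic_on bernstein_ellipse \<rho>" and r: "1 < r" "r < \<rho>"
  shows "((\<lambda>t. F (joukowski (circle_param r t)) * chebyshev_kernel \<theta> (circle_param r t))
    has_integral F (of_real (cos \<theta>))) {0..1}"
proof -
  define x :: complex where "x = of_real (cos \<theta>)"
  define \<gamma> where "\<gamma> = joukowski \<circ> circlepath 0 r"
  have pi: "path_image (circlepath 0 r) \<subseteq> - {0}" "\<And>w. w \<in> path_image (circlepath 0 r) \<Longrightarrow> cmod w = r"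
    using r by auto
  have an: "joukowski analytic_on - {0}"
    unfolding joukowski_def[abs_def] by (auto intro!: analytic_intros)
  have vp: "valid_path \<gamma>"
    unfolding \<gamma>_def by (rule valid_path_compose_analytic[OF _ an pi(1)]) simp
  have loop: "pathfinish \<gamma> = pathstart \<gamma>"
    by (simp add: \<gamma>_def pathfinish_compose pathstart_compose)
  have img: "path_image \<gamma> \<subseteq> bernstein_ellipse \<rho> - {x}"
  proof
    fix z assume "z \<in> path_image \<gamma>"
    then obtain w where "w \<in> path_image (circlepath 0 r)" and w2: "z = joukowski w"
      unfolding \<gamma>_def path_image_compose by blast
    then have w: "cmod w = r" "z = joukowski w"
      using pi(2) by blast+
    have "w \<noteq> 0" "w \<noteq> cis \<theta>" "w \<noteq> cis (- \<theta>)"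
      using w r by auto
    then have "z - x \<noteq> 0"
      unfolding w(2) x_def by (subst joukowski_minus_cos) auto
    then show "z \<in> bernstein_ellipse \<rho> - {x}"
      using joukowski_in_bernstein_ellipse[of w \<rho>] w r by auto
  qed
  have "x \<in> bernstein_ellipse \<rho>"
    unfolding x_def using r by (intro of_real_cos_in_bernstein_ellipse) auto
  then have xin: "x \<in> interior (bernstein_ellipse \<rho>)"
    by (simp add: interior_open open_bernstein_ellipse)
  have ci: "((\<lambda>w. F w / (w - x)) has_contour_integral (2 * pi * \<i> * winding_number \<gamma> x * F x)) \<gamma>"
    by (rule Cauchy_integral_formula_convex_simple[OF convex_bernstein_ellipse F xin vp img loop])
  \<comment> \<open>Pulled back to the circle the integrand splits into three partial fractions, all
    with poles inside; they contribute 1, 1 and -1.\<close>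
  have wn: "winding_number \<gamma> x = 1"
  proof -
    have "contour_integral \<gamma> (\<lambda>w. 1 / (w - x))
        = contour_integral (circlepath 0 r) (\<lambda>w. deriv joukowski w * (1 / (joukowski w - x)))"
      unfolding \<gamma>_def by (rule contour_integral_comp_analyticW[OF an _ pi(1)]) simp
    also have "\<dots> = contour_integral (circlepath 0 r) (\<lambda>w. 1 / (w - cis \<theta>) + 1 / (w - cis (- \<theta>)) - 1 / (w - 0))"
    proof (rule contour_integral_eq)
      fix w assume "w \<in> path_image (circlepath 0 r)"
      then have "1 < cmod w" using pi(2) r by auto
      from joukowski_deriv_kernel(2)[OF this, of \<theta>]
      show "deriv joukowski w * (1 / (joukowski w - x)) = 1 / (w - cis \<theta>) + 1 / (w - cis (- \<theta>)) - 1 / (w - 0)"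
        by (simp add: x_def)
    qed
    also have "\<dots> = 2 * pi * \<i> * 1 + 2 * pi * \<i> * 1 - 2 * pi * \<i> * 1"
    proof (rule contour_integral_unique, intro has_contour_integral_add has_contour_integral_diff)
      have *: "((\<lambda>w. 1 / (w - a)) has_contour_integral 2 * pi * \<i> * 1) (circlepath 0 r)" if "cmod a < r" for a
        using has_contour_integral_winding_number[of "circlepath 0 r" a] winding_number_circlepath[of a 0 r] that
        by (auto simp: sphere_def)
      show "((\<lambda>w. 1 / (w - cis \<theta>)) has_contour_integral 2 * pi * \<i> * 1) (circlepath 0 r)"
        "((\<lambda>w. 1 / (w - cis (- \<theta>))) has_contour_integral 2 * pi * \<i> * 1) (circlepath 0 r)"
        "((\<lambda>w. 1 / (w - 0)) has_contour_integral 2 * pi * \<i> * 1) (circlepath 0 r)"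
        by (rule *, use r in simp)+
    qed
    finally have "contour_integral \<gamma> (\<lambda>w. 1 / (w - x)) = 2 * pi * \<i>" by simp
    then show ?thesis
      using winding_number_valid_path[OF vp, of x] img by auto
  qed
  have "contour_integral \<gamma> (\<lambda>w. F w / (w - x)) = 2 * pi * \<i> * F x"
    using contour_integral_unique[OF ci] wn by simp
  also have "contour_integral \<gamma> (\<lambda>w. F w / (w - x))
      = contour_integral (circlepath 0 r) (\<lambda>w. deriv joukowski w * (F (joukowski w) / (joukowski w - x)))"
    unfolding \<gamma>_def by (rule contour_integral_comp_analyticW[OF an _ pi(1)]) simp
  also have "\<dots> = contour_integral (circlepath 0 r) (\<lambda>w. F (joukowski w) * chebyshev_kernel \<theta> w / w)"
  proof (rule contour_integral_eq)
    fix w assume "w \<in> path_image (circlepath 0 r)"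
    then have "1 < cmod w" using pi(2) r by auto
    from joukowski_deriv_kernel(1)[OF this, of \<theta>]
    show "deriv joukowski w * (F (joukowski w) / (joukowski w - x)) = F (joukowski w) * chebyshev_kernel \<theta> w / w"
      by (simp add: x_def) (metis mult.commute times_divide_eq_right)
  qed
  finally have eq: "contour_integral (circlepath 0 r) (\<lambda>w. F (joukowski w) * chebyshev_kernel \<theta> w / w) = 2 * pi * \<i> * F x" .
  have "(\<lambda>w. F (joukowski w) * chebyshev_kernel \<theta> w / w) contour_integrable_on circlepath 0 r"
  proof (rule contour_integrable_continuous_circlepath)
    have "continuous_on (path_image (circlepath 0 r)) (\<lambda>w. F (joukowski w))"
    proof (rule continuous_on_compose2[OF holomorphic_on_imp_continuous_on[OF F]])
      show "continuous_on (path_image (circlepath 0 r)) joukowski"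
        unfolding joukowski_def[abs_def] using pi by (auto intro!: continuous_intros)
      show "joukowski ` path_image (circlepath 0 r) \<subseteq> bernstein_ellipse \<rho>"
        using pi(2) r by (auto intro!: joukowski_in_bernstein_ellipse)
    qed
    moreover have "1 - cis a / w \<noteq> 0" if "w \<in> path_image (circlepath 0 r)" for a w
    proof
      assume "1 - cis a / w = 0"
      then have "cmod (cis a / w) = 1" by simp
      then show False using pi(2)[OF that] r by (simp add: norm_divide)
    qed
    ultimately show "continuous_on (path_image (circlepath 0 r)) (\<lambda>w. F (joukowski w) * chebyshev_kernel \<theta> w / w)"
      unfolding chebyshev_kernel_def using pi(1) by (intro continuous_intros) auto
  qed
  then have "((\<lambda>w. F (joukowski w) * chebyshev_kernel \<theta> w / w) has_contour_integral 2 * pi * \<i> * F x) (circlepath 0 r)"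
    using has_contour_integral_integral eq by metis
  then have "((\<lambda>t. F (joukowski (circle_param r t)) * chebyshev_kernel \<theta> (circle_param r t) / circle_param r t
      * (2 * pi * \<i> * circle_param r t)) has_integral 2 * pi * \<i> * F x) {0..1}"
    unfolding has_contour_integral vector_derivative_circlepath circlepath_eq_circle_param
    by (simp add: circle_param_def cis_conv_exp mult_ac)
  moreover have "circle_param r t \<noteq> 0" for t
    using r by (simp add: circle_param_def)
  ultimately have "((\<lambda>t. 2 * pi * \<i> * (F (joukowski (circle_param r t)) * chebyshev_kernel \<theta> (circle_param r t)))
      has_integral 2 * pi * \<i> * F x) {0..1}"
    by (simp add: mult_ac)
  from has_integral_mult_right[OF this, of "1 / (2 * pi * \<i>)"]
  show ?thesis by (simp add: x_def)
qed

text \<open>Two geometric series, cut after \<open>K\<close> terms with an explicit remainder so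
  that later only finite sums are integrated. The \<open>- 1\<close> corrects frequency 0, which the
  factor 2 counts twice.\<close>

lemma chebyshev_kernel_expansion:
  assumes "1 < cmod w"
  shows "cmod (chebyshev_kernel \<theta> w - (2 * (\<Sum>k<K. of_real (cos (real k * \<theta>)) / w ^ k) - 1))
    \<le> 2 * (1 / cmod w) ^ K / (1 - 1 / cmod w)"
proof -
  have w: "w \<noteq> 0" using assms by auto
  have 1: "1 / (1 - v) = (\<Sum>k<K. v ^ k) + v ^ K / (1 - v)" if "cmod v < 1" for v :: complex
    using that sum_gp_strict[of v K] by (auto simp: diff_divide_distrib)
  have lt: "cmod (cis a / w) = 1 / cmod w" "1 / cmod w < 1" for a
    using assms w by (auto simp: norm_divide)
  have tail: "cmod ((cis a / w) ^ K / (1 - cis a / w)) \<le> (1 / cmod w) ^ K / (1 - 1 / cmod w)" for a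
  proof -
    have "1 - 1 / cmod w \<le> cmod (1 - cis a / w)"
      using norm_triangle_ineq2[of 1 "cis a / w"] lt(1)[of a] by simp
    then show ?thesis
      using lt(2) w unfolding norm_divide[of "(_ :: complex) ^ _"] norm_power lt(1)
      by (intro divide_left_mono mult_pos_pos) auto
  qed
  have c: "(cis \<theta> / w) ^ k + (cis (- \<theta>) / w) ^ k = 2 * (of_real (cos (real k * \<theta>)) / w ^ k)" for k
  proof -
    have "cis (real k * \<theta>) + cis (- (real k * \<theta>)) = 2 * of_real (cos (real k * \<theta>))"
      by (simp add: complex_eq_iff)
    then show ?thesis
      by (simp add: power_divide Complex.DeMoivre flip: add_divide_distrib)
  qed
  have "chebyshev_kernel \<theta> w = (\<Sum>k<K. (cis \<theta> / w) ^ k + (cis (- \<theta>) / w) ^ k)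
      + ((cis \<theta> / w) ^ K / (1 - cis \<theta> / w) + (cis (- \<theta>) / w) ^ K / (1 - cis (- \<theta>) / w)) - 1"
    unfolding chebyshev_kernel_def using 1[of "cis \<theta> / w"] 1[of "cis (- \<theta>) / w"] lt by (simp add: sum.distrib)
  then have "chebyshev_kernel \<theta> w - (2 * (\<Sum>k<K. of_real (cos (real k * \<theta>)) / w ^ k) - 1)
      = (cis \<theta> / w) ^ K / (1 - cis \<theta> / w) + (cis (- \<theta>) / w) ^ K / (1 - cis (- \<theta>) / w)"
    unfolding c by (simp add: sum_distrib_left)
  then show ?thesis
    using norm_triangle_ineq[of "(cis \<theta> / w) ^ K / (1 - cis \<theta> / w)" "(cis (- \<theta>) / w) ^ K / (1 - cis (- \<theta>) / w)"]
      tail[of \<theta>] tail[of "- \<theta>"] by simp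
qed

lemma has_integral_cos_period:
  "((\<lambda>t. cos (2 * pi * of_int m * t)) has_integral (if m = 0 then 1 else 0)) {0..1}"
proof (cases "m = 0")
  case True
  then show ?thesis
    using has_integral_const_real[of "1::real" 0 1] by simp
next
  case False
  have "((\<lambda>t. cos (2 * pi * of_int m * t)) has_integral
     sin (2 * pi * of_int m * 1) / (2 * pi * of_int m) - sin (2 * pi * of_int m * 0) / (2 * pi * of_int m)) {0..1}"
  proof (rule fundamental_theorem_of_calculus)
    show "((\<lambda>t. sin (2 * pi * of_int m * t) / (2 * pi * of_int m)) has_vector_derivative cos (2 * pi * of_int m * t))
      (at t within {0..1})" for t
      unfolding has_real_derivative_iff_has_vector_derivative[symmetric] using False
      by (auto intro!: derivative_eq_intros)
  qed simp
  moreover have "sin (2 * pi * of_int m) = 0"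
    by (simp add: sin_zero_iff_int2)
  ultimately show ?thesis
    using False by simp
qed

text \<open>Parseval's identity on the circle of radius \<open>r\<close>: the off-diagonal terms of
  the expanded square integrate to 0.\<close>

lemma has_integral_norm_trig_sum:
  fixes a :: "nat \<Rightarrow> real"
  assumes "0 < r"
  shows "((\<lambda>t. (cmod (\<Sum>k<K. of_real (a k) / circle_param r t ^ k))\<^sup>2)
    has_integral (\<Sum>k<K. (a k)\<^sup>2 * (1 / r\<^sup>2) ^ k)) {0..1}"
proof -
  have eq: "(cmod (\<Sum>k<K. of_real (a k) / circle_param r t ^ k))\<^sup>2
    = (\<Sum>j<K. \<Sum>k<K. a j / r ^ j * (a k / r ^ k) * cos (2 * pi * of_int (int j - int k) * t))" for t
  proof -
    have t: "of_real (a k) / circle_param r t ^ k = of_real (a k / r ^ k) * cis (- (real k * (2 * pi * t)))" for k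
      by (simp add: circle_param_def power_mult_distrib Complex.DeMoivre divide_inverse)
    have "complex_of_real ((cmod (\<Sum>k<K. of_real (a k) / circle_param r t ^ k))\<^sup>2)
      = (\<Sum>k<K. of_real (a k / r ^ k) * cis (- (real k * (2 * pi * t)))) * cnj (\<Sum>k<K. of_real (a k / r ^ k) * cis (- (real k * (2 * pi * t))))"
      unfolding t complex_norm_square ..
    also have "\<dots> = (\<Sum>j<K. \<Sum>k<K. of_real (a j / r ^ j * (a k / r ^ k)) * cis (real k * (2 * pi * t) - real j * (2 * pi * t)))"
    proof -
      have "of_real (a j / r ^ j) * cis (- (real j * (2 * pi * t))) * cnj (of_real (a k / r ^ k) * cis (- (real k * (2 * pi * t))))
        = of_real (a j / r ^ j * (a k / r ^ k)) * (cis (real k * (2 * pi * t)) * cis (- (real j * (2 * pi * t))))" for j k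
        unfolding complex_cnj_mult complex_cnj_complex_of_real cis_cnj of_real_mult minus_minus by (simp only: mult_ac)
      then show ?thesis
        unfolding cnj_sum sum_product by (simp only: cis_mult diff_conv_add_uminus)
    qed
    finally have "(cmod (\<Sum>k<K. of_real (a k) / circle_param r t ^ k))\<^sup>2
      = Re (\<Sum>j<K. \<Sum>k<K. of_real (a j / r ^ j * (a k / r ^ k)) * cis (real k * (2 * pi * t) - real j * (2 * pi * t)))"
      by (metis Re_complex_of_real)
    also have "\<dots> = (\<Sum>j<K. \<Sum>k<K. a j / r ^ j * (a k / r ^ k) * cos (real k * (2 * pi * t) - real j * (2 * pi * t)))"
      by (simp only: Re_sum Re_complex_of_real times_complex.sel Im_complex_of_real cis.sel) simp
    also have "\<dots> = (\<Sum>j<K. \<Sum>k<K. a j / r ^ j * (a k / r ^ k) * cos (2 * pi * of_int (int j - int k) * t))"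
    proof (intro sum.cong refl arg_cong2[where f = "(*)"])
      fix j k
      have "real k * (2 * pi * t) - real j * (2 * pi * t) = - (2 * pi * of_int (int j - int k) * t)"
        by (simp add: algebra_simps)
      then show "cos (real k * (2 * pi * t) - real j * (2 * pi * t)) = cos (2 * pi * of_int (int j - int k) * t)"
        by (simp only: cos_minus)
    qed
    finally show ?thesis .
  qed
  have "((\<lambda>t. \<Sum>j<K. \<Sum>k<K. a j / r ^ j * (a k / r ^ k) * cos (2 * pi * of_int (int j - int k) * t))
    has_integral (\<Sum>j<K. \<Sum>k<K. a j / r ^ j * (a k / r ^ k) * (if int j - int k = 0 then 1 else 0))) {0..1}"
    by (intro has_integral_sum has_integral_mult_right has_integral_cos_period) auto
  moreover have "(\<Sum>j<K. \<Sum>k<K. a j / r ^ j * (a k / r ^ k) * (if int j - int k = 0 then 1 else 0))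
      = (\<Sum>k<K. (a k)\<^sup>2 * (1 / r\<^sup>2) ^ k)"
  proof (rule sum.cong[OF refl])
    fix j assume j: "j \<in> {..<K}"
    have d: "int j - int k = 0 \<longleftrightarrow> k = j" for k
      by auto
    have "(\<Sum>k<K. a j / r ^ j * (a k / r ^ k) * (if int j - int k = 0 then 1 else 0)) = a j / r ^ j * (a j / r ^ j)"
      unfolding d using j by (simp add: if_distrib[of "\<lambda>x. _ * x"] cong: if_cong)
    also have "\<dots> = (a j)\<^sup>2 * (1 / r\<^sup>2) ^ j"
      by (simp add: power2_eq_square power_divide power_mult_distrib)
    finally show "(\<Sum>k<K. a j / r ^ j * (a k / r ^ k) * (if int j - int k = 0 then 1 else 0)) = (a j)\<^sup>2 * (1 / r\<^sup>2) ^ j" .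
  qed
  ultimately show ?thesis
    unfolding eq by simp
qed

section \<open>Univariate error bounds\<close>

lemma sum_alias_error_le:
  fixes x \<theta> :: real
  assumes N: "1 \<le> N" and x: "0 < x" "x < 1" and q: "x ^ (2 * N) \<le> 1 / 4"
  shows "(\<Sum>k<N + K. (alias_error N \<theta> (int k))\<^sup>2 * x ^ k) \<le> 4 * x ^ (N + 1) / (1 - x\<^sup>2)"
proof -
  have "(\<Sum>k<N + K. (alias_error N \<theta> (int k))\<^sup>2 * x ^ k)
      = (\<Sum>k<N. (alias_error N \<theta> (int k))\<^sup>2 * x ^ k) + (\<Sum>l<K. (alias_error N \<theta> (int (l + N)))\<^sup>2 * x ^ (l + N))"
    using sum.atLeastLessThan_concat[of 0 N "N + K" "\<lambda>k. (alias_error N \<theta> (int k))\<^sup>2 * x ^ k"]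
      sum.shift_bounds_nat_ivl[of "\<lambda>k. (alias_error N \<theta> (int k))\<^sup>2 * x ^ k" 0 N K]
    by (simp add: add.commute lessThan_atLeast0)
  also have "(\<Sum>k<N. (alias_error N \<theta> (int k))\<^sup>2 * x ^ k) = 0"
    by (intro sum.neutral) (auto simp: alias_error_zero[OF N])
  also have "(\<Sum>l<K. (alias_error N \<theta> (int (l + N)))\<^sup>2 * x ^ (l + N))
      = x ^ N * (\<Sum>l<K. (alias_error N \<theta> (int N + int l))\<^sup>2 * x ^ l)"
    by (simp add: sum_distrib_left power_add mult_ac add.commute)
  also have "(\<Sum>l<K. (alias_error N \<theta> (int N + int l))\<^sup>2 * x ^ l) \<le> 4 * x / (1 - x\<^sup>2)"
    by (rule order_trans[OF sum_le_suminf alias_energy_le(2)[OF N x q, of \<theta>]])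
      (use x alias_energy_le(1)[OF N x q, of \<theta>] in auto)
  finally show ?thesis
    using x by (simp add: mult_left_mono mult_ac)
qed

definition cheb_interp_error :: "nat \<Rightarrow> (complex \<Rightarrow> complex) \<Rightarrow> real \<Rightarrow> complex" where
  "cheb_interp_error N F \<theta> = F (of_real (cos \<theta>))
     - (\<Sum>j\<le>N. of_real (cardinal_cos N j \<theta>) * F (of_real (cos (cheb_angle N j))))"

text \<open>Interpolating Cauchy's formula in \<open>\<theta>\<close> leaves \<open>F\<close> alone
  and changes only the kernel, to \<open>Q\<close>. There the frequency \<open>k\<close> has
  coefficient \<open>2 * e k\<close>, and Parseval reduces the mean square to the energy
  bound.\<close>

lemma cheb_interp_error_le_inner:
  assumes F: "F holomorphic_on bernstein_ellipse \<rho>" and B: "\<And>z. z \<in> bernstein_ellipse \<rho> \<Longrightarrow> cmod (F z) \<le> B"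
    and r: "1 < r" "r < \<rho>" and N: "1 \<le> N" and x: "x = 1 / r\<^sup>2" and q: "x ^ N \<le> 1 / 2"
  shows "cmod (cheb_interp_error N F \<theta>) \<le> 4 * B * sqrt (x ^ (N + 1) / (1 - x\<^sup>2))"
proof -
  define Q where "Q w = chebyshev_kernel \<theta> w
    - (\<Sum>j\<le>N. of_real (cardinal_cos N j \<theta>) * chebyshev_kernel (cheb_angle N j) w)" for w
  define e where "e k = alias_error N \<theta> (int k)" for k
  define A where "A = 1 + (\<Sum>j\<le>N. \<bar>cardinal_cos N j \<theta>\<bar>)"
  define S where "S K w = (\<Sum>k<K. of_real (e k) / w ^ k)" for K and w :: complex
  define \<tau> where "\<tau> K = A * (2 * (1 / r) ^ K / (1 - 1 / r))" for K
  define T where "T = 4 * x ^ (N + 1) / (1 - x\<^sup>2)"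
  have x01: "0 < x" "x < 1"
    using r by (auto simp: x one_less_power)
  have x2: "x\<^sup>2 < 1"
    using x01 by (simp add: power_less_one_iff)
  have T: "0 < T"
    unfolding T_def using x01 x2 by (intro divide_pos_pos) auto
  have B0: "0 \<le> B"
    using B[OF of_real_cos_in_bernstein_ellipse[of \<rho> 0]] r by (smt (verit) norm_ge_zero)
  have q': "x ^ (2 * N) \<le> 1 / 4"
    using power_mono[OF q, of 2] x01 by (simp add: power_even_eq power2_eq_square)
  have cw: "cmod (circle_param r t) = r" for t
    using r by (simp add: circle_param_def norm_mult)
  have int: "((\<lambda>t. F (joukowski (circle_param r t)) * Q (circle_param r t)) has_integral cheb_interp_error N F \<theta>) {0..1}"
  proof -
    have "((\<lambda>t. F (joukowski (circle_param r t)) * chebyshev_kernel \<theta> (circle_param r t)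
        - (\<Sum>j\<le>N. of_real (cardinal_cos N j \<theta>) * (F (joukowski (circle_param r t)) * chebyshev_kernel (cheb_angle N j) (circle_param r t))))
      has_integral cheb_interp_error N F \<theta>) {0..1}"
      unfolding cheb_interp_error_def
      by (intro has_integral_diff has_integral_sum has_integral_mult_right has_integral_chebyshev_kernel[OF F r]) auto
    then show ?thesis
      by (simp add: Q_def right_diff_distrib sum_distrib_left mult.left_commute)
  qed
  have QS: "cmod (Q w - 2 * S K w) \<le> \<tau> K" if w: "cmod w = r" for w K
  proof -
    define C where "C \<alpha> = (\<Sum>k<K. of_real (cos (real k * \<alpha>)) / w ^ k)" for \<alpha>
    define D where "D \<alpha> = chebyshev_kernel \<alpha> w - (2 * C \<alpha> - 1)" for \<alpha>
    have D: "cmod (D \<alpha>) \<le> 2 * (1 / r) ^ K / (1 - 1 / r)" for \<alpha>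
      unfolding D_def C_def using chebyshev_kernel_expansion[of w \<alpha> K] w r by simp
    \<comment> \<open>Frequency 0 is reproduced, so the cardinal functions sum to 1; this cancels
      the constants \<open>- 1\<close> of the expansions in \<open>Q\<close>.\<close>
    have "alias_error N \<theta> 0 = 0"
      by (rule alias_error_zero[OF N]) simp
    then have "(\<Sum>j\<le>N. cardinal_cos N j \<theta>) = 1"
      by (simp add: alias_error_def)
    then have one: "(\<Sum>j\<le>N. complex_of_real (cardinal_cos N j \<theta>)) = 1"
      by (metis of_real_1 of_real_sum)
    have SK: "S K w = C \<theta> - (\<Sum>j\<le>N. of_real (cardinal_cos N j \<theta>) * C (cheb_angle N j))"
      unfolding S_def C_def e_def alias_error_def sum_distrib_left
      by (subst sum.swap) (simp add: diff_divide_distrib sum_subtractf sum_divide_distrib)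
    have SD: "(\<Sum>j\<le>N. of_real (cardinal_cos N j \<theta>) * D (cheb_angle N j))
      = (\<Sum>j\<le>N. of_real (cardinal_cos N j \<theta>) * chebyshev_kernel (cheb_angle N j) w)
        - 2 * (\<Sum>j\<le>N. of_real (cardinal_cos N j \<theta>) * C (cheb_angle N j))
        + (\<Sum>j\<le>N. complex_of_real (cardinal_cos N j \<theta>))"
      unfolding D_def sum_distrib_left[of 2] sum_subtractf[symmetric] sum.distrib[symmetric]
      by (intro sum.cong) (auto simp: algebra_simps)
    have "Q w - 2 * S K w = D \<theta> - (\<Sum>j\<le>N. of_real (cardinal_cos N j \<theta>) * D (cheb_angle N j))"
      unfolding Q_def SK SD one D_def[of \<theta>] by (simp add: algebra_simps)
    also have "cmod \<dots> \<le> cmod (D \<theta>) + (\<Sum>j\<le>N. cmod (of_real (cardinal_cos N j \<theta>) * D (cheb_angle N j)))"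
      by (rule order_trans[OF norm_triangle_ineq4 add_left_mono[OF norm_sum]])
    also have "\<dots> \<le> 2 * (1 / r) ^ K / (1 - 1 / r) + (\<Sum>j\<le>N. \<bar>cardinal_cos N j \<theta>\<bar> * (2 * (1 / r) ^ K / (1 - 1 / r)))"
      unfolding norm_mult norm_of_real by (intro add_mono sum_mono mult_left_mono D) auto
    also have "\<dots> = \<tau> K"
      unfolding \<tau>_def A_def distrib_right sum_distrib_right by simp
    finally show ?thesis .
  qed
  \<comment> \<open>Cauchy-Schwarz in the form \<open>2 s \<le> c + s\<^sup>2 / c\<close>, with \<open>c\<close> optimized after integrating.\<close>
  have bound: "cmod (cheb_interp_error N F \<theta>) \<le> B * (\<tau> (N + K) + c + T / c)" if c: "0 < c" for K c
  proof -
    have "cmod (F (joukowski (circle_param r t)) * Q (circle_param r t))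
        \<le> B * (\<tau> (N + K) + c + (1 / c) * (cmod (S (N + K) (circle_param r t)))\<^sup>2)" for t
    proof -
      let ?w = "circle_param r t" and ?s = "cmod (S (N + K) (circle_param r t))"
      have "cmod (Q ?w) \<le> \<tau> (N + K) + 2 * ?s"
        using QS[OF cw, of t "N + K"] norm_triangle_ineq2[of "Q ?w" "2 * S (N + K) ?w"] by (simp add: norm_mult)
      also have "2 * ?s \<le> c + (1 / c) * ?s\<^sup>2"
      proof -
        have "2 * ?s * c \<le> c * c + ?s\<^sup>2"
          using sum_squares_bound[of ?s c] by (simp add: power2_eq_square)
        then show ?thesis
          using c by (simp add: field_simps)
      qed
      finally have "cmod (Q ?w) \<le> \<tau> (N + K) + c + (1 / c) * ?s\<^sup>2" by simp
      moreover have "joukowski ?w \<in> bernstein_ellipse \<rho>"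
        using r by (intro joukowski_in_bernstein_ellipse) (auto simp: cw)
      ultimately show ?thesis
        unfolding norm_mult using B B0 by (intro mult_mono) auto
    qed
    note le = this
    have hb: "((\<lambda>t. B * (\<tau> (N + K) + c + (1 / c) * (cmod (S (N + K) (circle_param r t)))\<^sup>2))
      has_integral B * (\<tau> (N + K) + c + (1 / c) * (\<Sum>k<N + K. (e k)\<^sup>2 * x ^ k))) {0..1}"
    proof (intro has_integral_mult_right has_integral_add[of "\<lambda>_. \<tau> (N + K) + c"])
      show "((\<lambda>_. \<tau> (N + K) + c) has_integral \<tau> (N + K) + c) {0..1::real}"
        using has_integral_const_real[of "\<tau> (N + K) + c" 0 1] by simp
      show "((\<lambda>t. (cmod (S (N + K) (circle_param r t)))\<^sup>2) has_integral (\<Sum>k<N + K. (e k)\<^sup>2 * x ^ k)) {0..1}"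
        unfolding S_def x using r by (intro has_integral_norm_trig_sum) auto
    qed
    have "cmod (integral {0..1} (\<lambda>t. F (joukowski (circle_param r t)) * Q (circle_param r t)))
      \<le> integral {0..1} (\<lambda>t. B * (\<tau> (N + K) + c + (1 / c) * (cmod (S (N + K) (circle_param r t)))\<^sup>2))"
      by (rule integral_norm_bound_integral[OF has_integral_integrable[OF int] has_integral_integrable[OF hb] le])
    then have "cmod (cheb_interp_error N F \<theta>) \<le> B * (\<tau> (N + K) + c + (1 / c) * (\<Sum>k<N + K. (e k)\<^sup>2 * x ^ k))"
      unfolding integral_unique[OF int] integral_unique[OF hb] .
    also have "\<dots> \<le> B * (\<tau> (N + K) + c + (1 / c) * T)"
      unfolding T_def e_def using c B0 sum_alias_error_le[OF N x01 q', where K = K and \<theta> = \<theta>]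
      by (intro mult_left_mono add_left_mono) auto
    finally show ?thesis by simp
  qed
  \<comment> \<open>\<open>K\<close> tends to infinity to remove the truncation error
    \<open>\<tau>\<close>, and \<open>c = sqrt T\<close> minimizes \<open>c + T / c\<close>.\<close>
  have lim: "(\<lambda>K. B * (\<tau> (N + K) + sqrt T + T / sqrt T)) \<longlonglongrightarrow> B * (A * (2 * 0 / (1 - 1 / r)) + sqrt T + T / sqrt T)"
  proof -
    have "(\<lambda>K. (1 / r) ^ (N + K)) \<longlonglongrightarrow> 0"
      using LIMSEQ_ignore_initial_segment[OF LIMSEQ_power_zero[of "1 / r"], of N] r by (simp add: add.commute)
    then show ?thesis
      unfolding \<tau>_def using r by (intro tendsto_intros) auto
  qed
  have "cmod (cheb_interp_error N F \<theta>) \<le> B * (A * (2 * 0 / (1 - 1 / r)) + sqrt T + T / sqrt T)"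
    by (rule LIMSEQ_le_const[OF lim]) (use bound[of "sqrt T"] T in auto)
  also have "\<dots> = 2 * B * sqrt T"
    using T by (simp add: real_div_sqrt)
  also have "sqrt T = 2 * sqrt (x ^ (N + 1) / (1 - x\<^sup>2))"
    unfolding T_def times_divide_eq_right[symmetric] real_sqrt_mult by simp
  finally show ?thesis by simp
qed

text \<open>\<open>F\<close> is given on the open ellipse only, so \<open>r\<close> tends to
  \<open>\<rho>\<close> from below; the strict inequality for \<open>x ^ N\<close> persists for
  \<open>r\<close> near \<open>\<rho>\<close>.\<close>

lemma cheb_interp_error_le_energy:
  assumes F: "F holomorphic_on bernstein_ellipse \<rho>" and B: "\<And>z. z \<in> bernstein_ellipse \<rho> \<Longrightarrow> cmod (F z) \<le> B"
    and \<rho>: "1 < \<rho>" and N: "1 \<le> N" and x: "x = 1 / \<rho>\<^sup>2" and q: "x ^ N < 1 / 2"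
  shows "cmod (cheb_interp_error N F \<theta>) \<le> 4 * B * sqrt (x ^ (N + 1) / (1 - x\<^sup>2))"
proof (rule tendsto_lowerbound)
  let ?x = "\<lambda>r::real. 1 / r\<^sup>2"
  have "x < 1"
    using \<rho> by (simp add: x one_less_power)
  moreover have "0 < x" using \<rho> by (simp add: x)
  ultimately have x2: "x\<^sup>2 < 1"
    by (simp add: power_less_one_iff)
  have lim: "(?x \<longlongrightarrow> x) (at_left \<rho>)"
    unfolding x using \<rho> by (intro tendsto_intros) auto
  then show "((\<lambda>r. 4 * B * sqrt (?x r ^ (N + 1) / (1 - (?x r)\<^sup>2))) \<longlongrightarrow> 4 * B * sqrt (x ^ (N + 1) / (1 - x\<^sup>2))) (at_left \<rho>)"
    using x2 by (intro tendsto_intros) auto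
  have "((\<lambda>r. ?x r ^ N) \<longlongrightarrow> x ^ N) (at_left \<rho>)"
    using lim by (intro tendsto_intros)
  then have "eventually (\<lambda>r. ?x r ^ N < 1 / 2) (at_left \<rho>)"
    using q by (rule order_tendstoD)
  moreover have "eventually (\<lambda>r. r \<in> {1<..<\<rho>}) (at_left \<rho>)"
    using \<rho> by (rule eventually_at_left_real)
  ultimately show "eventually (\<lambda>r. cmod (cheb_interp_error N F \<theta>) \<le> 4 * B * sqrt (?x r ^ (N + 1) / (1 - (?x r)\<^sup>2))) (at_left \<rho>)"
    by eventually_elim (rule cheb_interp_error_le_inner[OF F B _ _ N refl], auto)
qed simp

lemma cheb_interp_abs_le:
  assumes B: "\<And>z. z \<in> bernstein_ellipse \<rho> \<Longrightarrow> cmod (F z) \<le> B" and \<rho>: "1 < \<rho>" and N: "1 \<le> N"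
  shows "cmod (\<Sum>j\<le>N. of_real (cardinal_cos N j \<theta>) * F (of_real (cos (cheb_angle N j)))) \<le> sqrt (real N) * B"
proof -
  have B0: "0 \<le> B"
    using B[OF of_real_cos_in_bernstein_ellipse[OF \<rho>, of 0]] by (smt (verit) norm_ge_zero)
  have "cmod (\<Sum>j\<le>N. of_real (cardinal_cos N j \<theta>) * F (of_real (cos (cheb_angle N j))))
      \<le> (\<Sum>j\<le>N. \<bar>cardinal_cos N j \<theta>\<bar> * B)"
    by (rule order_trans[OF norm_sum sum_mono])
      (auto simp: norm_mult intro!: mult_left_mono B of_real_cos_in_bernstein_ellipse[OF \<rho>])
  also have "\<dots> \<le> sqrt (real N) * B"
    unfolding sum_distrib_right[symmetric] using B0 sum_cardinal_cos_le_sqrt[OF N] by (intro mult_right_mono)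
  finally show ?thesis .
qed

text \<open>For small \<open>x ^ N\<close> the energy bound is deliberately weakened, by
  \<open>4 x <= (1 + x)^2\<close>, to the factor \<open>(1 + x) / (1 - x)\<close> that the induction
  over coordinates needs.\<close>

lemma cheb_interp_error_le:
  assumes F: "F holomorphic_on bernstein_ellipse \<rho>" and B: "\<And>z. z \<in> bernstein_ellipse \<rho> \<Longrightarrow> cmod (F z) \<le> B"
    and \<rho>: "1 < \<rho>" and N: "1 \<le> N" and x: "x = 1 / \<rho>\<^sup>2"
  shows "cmod (cheb_interp_error N F \<theta>) \<le> 2 * B * sqrt (x ^ N * ((1 + x) / (1 - x)))"
proof -
  have x01: "0 < x" "x < 1"
    using \<rho> by (auto simp: x one_less_power)
  have B0: "0 \<le> B"
    using B[OF of_real_cos_in_bernstein_ellipse[OF \<rho>, of 0]] by (smt (verit) norm_ge_zero)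
  show ?thesis
  proof (cases "x ^ N < 1 / 2")
    case True
    have "sqrt (x ^ (N + 1) / (1 - x\<^sup>2)) \<le> sqrt (x ^ N * ((1 + x) / (1 - x)) / 4)"
    proof (rule real_sqrt_le_mono)
      have "4 * x \<le> (1 + x) * (1 + x)"
        using zero_le_power2[of "1 - x"] by (simp add: power2_eq_square algebra_simps)
      then have "x / (1 + x) \<le> (1 + x) / 4"
        using x01 by (simp add: field_simps)
      then have "x ^ N / (1 - x) * (x / (1 + x)) \<le> x ^ N / (1 - x) * ((1 + x) / 4)"
        using x01 by (intro mult_left_mono) auto
      moreover have "1 - x\<^sup>2 = (1 - x) * (1 + x)"
        by (simp add: power2_eq_square algebra_simps)
      ultimately show "x ^ (N + 1) / (1 - x\<^sup>2) \<le> x ^ N * ((1 + x) / (1 - x)) / 4"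
        by (simp add: mult_ac)
    qed
    also have "\<dots> = sqrt (x ^ N * ((1 + x) / (1 - x))) / 2"
      by (simp only: real_sqrt_divide real_sqrt_four)
    finally have "4 * B * sqrt (x ^ (N + 1) / (1 - x\<^sup>2)) \<le> 4 * B * (sqrt (x ^ N * ((1 + x) / (1 - x))) / 2)"
      using B0 by (intro mult_left_mono) auto
    then show ?thesis
      using cheb_interp_error_le_energy[OF F B \<rho> N x True, of \<theta>] by simp
  next
    case False
    have "sqrt (real N) \<le> sqrt (x ^ N * ((1 + x) / (1 - x)))"
    proof (rule real_sqrt_le_mono)
      \<comment> \<open>The chain is \<open>N (1 - x) <= - ln (x ^ N) <= ln 2 <= 25/36 <= 3/4 <= x ^
        N (1 + x)\<close>; the last step uses \<open>x >= x ^ N >= 1/2\<close>.\<close>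
      have "real N * (1 - x) \<le> real N * - ln x"
        using x01 ln_le_minus_one[of x] by (intro mult_left_mono) auto
      also have "\<dots> = - ln (x ^ N)"
        using x01 by (simp add: ln_realpow)
      also have "\<dots> \<le> - ln (1 / 2)"
        using False x01 by (simp only: neg_le_iff_le) (intro ln_mono, auto)
      also have "\<dots> \<le> 1 / 2 * (1 + 1 / 2)"
        using ln2_le_25_over_36 by (simp add: ln_div)
      also have "\<dots> \<le> x ^ N * (1 + x)"
      proof -
        have "x ^ N \<le> x ^ 1"
          using x01 N by (intro power_decreasing) auto
        then show ?thesis
          using False x01 by (intro mult_mono) auto
      qed
      finally show "real N \<le> x ^ N * ((1 + x) / (1 - x))"
        using x01 by (simp add: field_simps)
    qed
    moreover have "1 \<le> sqrt (real N)"
      using N by simp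
    ultimately have "1 + sqrt (real N) \<le> 2 * sqrt (x ^ N * ((1 + x) / (1 - x)))"
      by linarith
    then have "(1 + sqrt (real N)) * B \<le> 2 * sqrt (x ^ N * ((1 + x) / (1 - x))) * B"
      using B0 by (rule mult_right_mono)
    moreover have "cmod (cheb_interp_error N F \<theta>) \<le> B + sqrt (real N) * B"
      unfolding cheb_interp_error_def
      by (rule order_trans[OF norm_triangle_ineq4 add_mono])
        (auto intro!: B of_real_cos_in_bernstein_ellipse[OF \<rho>] cheb_interp_abs_le[OF B \<rho> N])
    ultimately show ?thesis
      by (simp add: algebra_simps)
  qed
qed

section \<open>Numerical inequalities for the norm of interpolation on holomorphic functions\<close>

lemma ln_one_minus_le_cubic:
  fixes d :: real
  assumes "0 \<le> d" "d < 1"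
  shows "ln (1 - d) \<le> - (d + d\<^sup>2 / 2 + d ^ 3 / 3)"
proof -
  have "ln (1 - d) + d + d\<^sup>2 / 2 + d ^ 3 / 3 \<le> ln (1 - 0) + 0 + 0\<^sup>2 / 2 + 0 ^ 3 / 3"
  proof (rule DERIV_nonpos_imp_nonincreasing[OF assms(1)])
    fix u assume u: "0 \<le> u" "u \<le> d"
    have "((\<lambda>u. ln (1 - u) + u + u\<^sup>2 / 2 + u ^ 3 / 3) has_real_derivative - (u ^ 3 / (1 - u))) (at u)"
      using u assms by (auto intro!: derivative_eq_intros simp: field_simps power2_eq_square power3_eq_cube)
    moreover have "- (u ^ 3 / (1 - u)) \<le> 0"
      using u assms by simp
    ultimately show "\<exists>y. ((\<lambda>u. ln (1 - u) + u + u\<^sup>2 / 2 + u ^ 3 / 3) has_real_derivative y) (at u) \<and> y \<le> 0"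
      by blast
  qed
  then show ?thesis by simp
qed

text \<open>\<open>16 / exp 2\<close> is about 2.165; \<open>217 / 100\<close> is slightly above it
  and still small enough for \<open>small_power_bound\<close>.\<close>

lemma exp_two_ge: "(217 / 100) * exp (2::real) \<ge> 16"
proof -
  have "(\<Sum>n<8. 2 ^ n / fact n) \<le> exp (2::real)"
    unfolding exp_def using summable_exp[of "2::real"]
    by (intro order_trans[OF _ sum_le_suminf[of "\<lambda>n. 2 ^ n /\<^sub>R fact n" "{..<8}"]])
      (auto simp: divide_inverse mult.commute)
  moreover have "(\<Sum>n<8. 2 ^ n / fact n) = (2325 / 315 :: real)"
    by (simp add: eval_nat_numeral fact_numeral)
  ultimately show ?thesis by simp
qed

text \<open>With \<open>x = 1 - d\<close> this implies
  \<open>4 sqrt (x ^ (N + 1) / (1 - x^2)) <= sqrt (2 / d) - 1\<close>: square, multiply by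
  \<open>(sqrt 2 + sqrt d)^2\<close> and bound that factor on the left by \<open>8/3 + 4 d\<close>.
  For \<open>d >= 1/2\<close>, \<open>N d > 2\<close> forces \<open>N >= 3\<close> or
  \<open>N >= 4\<close>, and crude powers suffice.\<close>

lemma small_power_bound:
  fixes d :: real
  assumes d: "0 < d" "d < 1" and N: "2 < real N * d"
  shows "16 * (1 - d) ^ (N + 1) * (8 / 3 + 4 * d) \<le> (2 - d) ^ 3"
proof -
  define x where "x = 1 - d"
  have x: "0 < x" "x < 1" "d = 1 - x" using d by (auto simp: x_def)
  consider "2 / 3 \<le> d" | "1 / 2 \<le> d" "d < 2 / 3" | "d < 1 / 2" by linarith
  then show ?thesis
  proof cases
    case 1
    have "real N * d \<le> real N"
      using d by (intro mult_left_le) auto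
    then have "3 \<le> N" using N by linarith
    then have "x ^ (N + 1) \<le> x ^ 4"
      using x by (intro power_decreasing) auto
    also have "x ^ 4 = x * x ^ 3" by (simp add: eval_nat_numeral)
    also have "\<dots> \<le> x * (1 / 3) ^ 3"
      using x 1 by (intro mult_left_mono power_mono) auto
    finally have "16 * x ^ (N + 1) * (8 / 3 + 4 * d) \<le> 16 * (x * (1 / 3) ^ 3) * (20 / 3)"
      using x d by (intro mult_mono) auto
    also have "\<dots> \<le> 1 + 3 * x"
      using x by (simp add: power3_eq_cube)
    also have "\<dots> \<le> (1 + x) ^ 3"
      using x by (simp add: power3_eq_cube algebra_simps)
    finally show ?thesis
      by (simp add: x_def)
  next
    case 2
    have "real N * d \<le> real N * (2 / 3)"
      using 2 by (intro mult_left_mono) auto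
    then have "4 \<le> N" using N by linarith
    then have "x ^ (N + 1) \<le> x ^ 5"
      using x by (intro power_decreasing) auto
    also have "x ^ 5 = x * x ^ 4" by (simp add: eval_nat_numeral)
    also have "\<dots> \<le> x * (1 / 2) ^ 4"
      using x 2 by (intro mult_left_mono power_mono) auto
    finally have "16 * x ^ (N + 1) * (8 / 3 + 4 * d) \<le> 16 * (x * (1 / 2) ^ 4) * (16 / 3)"
      using x d 2 by (intro mult_mono) auto
    also have "\<dots> \<le> 1 + 3 * x + 3 * x\<^sup>2"
      using zero_le_power2[of "x - 7 / 18"] by (simp add: power2_eq_square eval_nat_numeral algebra_simps)
    also have "\<dots> \<le> (1 + x) ^ 3"
      using x by (simp add: power3_eq_cube power2_eq_square algebra_simps)
    finally show ?thesis
      by (simp add: x_def)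
  next
    case 3
    \<comment> \<open>For small \<open>d\<close> the power is close to \<open>exp (- 2)\<close>, so
      exponentials are needed. \<open>N + 1 >= 2 / d + 1\<close> and the cubic bound for the
      logarithm give \<open>x ^ (N + 1) <= exp (- (2 + z))\<close>.\<close>
    define z where "z = 2 * d + d\<^sup>2"
    have z0: "0 \<le> z" using d by (simp add: z_def)
    have "ln x \<le> - (d + d\<^sup>2 / 2 + d ^ 3 / 3)"
      unfolding x_def using d by (intro ln_one_minus_le_cubic) auto
    moreover have "2 / d + 1 \<le> real N + 1"
      using N d by (simp add: field_simps)
    ultimately have "(2 / d + 1) * (d + d\<^sup>2 / 2 + d ^ 3 / 3) \<le> (real N + 1) * - ln x"
      using d by (intro mult_mono) (auto intro: add_nonneg_nonneg)
    moreover have "2 + z \<le> (2 / d + 1) * (d + d\<^sup>2 / 2 + d ^ 3 / 3)"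
      using d by (simp add: z_def field_simps power2_eq_square power3_eq_cube)
    ultimately have "(real N + 1) * ln x \<le> - (2 + z)"
      by simp
    then have "exp ((real N + 1) * ln x + (2 + z)) \<le> 1"
      by simp
    moreover have "exp ((real N + 1) * ln x) = x ^ (N + 1)"
      using x exp_of_nat_mult[of "N + 1" "ln x"] by (simp add: add.commute)
    ultimately have "x ^ (N + 1) * exp (2 + z) \<le> 1"
      by (simp only: exp_add)
    then have 1: "x ^ (N + 1) * (exp 2 * exp z) \<le> 1"
      by (simp add: exp_add)
    have "(217 / 100) * (8 / 3 + 4 * d) \<le> (2 - d) ^ 3 * (1 + z + z\<^sup>2 / 2)"
    proof -
      \<comment> \<open>The left side increases on this range, and \<open>5 / 8\<close> is its value
        at the right end \<open>d = 1 / 2\<close>.\<close>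
      have "d\<^sup>2 * (4 - 3 * d) \<le> 5 / 8"
      proof -
        have "0 \<le> (1 / 2 - d) * (5 / 4 + (5 / 2) * d - 3 * d\<^sup>2)"
          using 3 d mult_mono[of d "1/2" d "1/2"] by (intro mult_nonneg_nonneg) (auto simp: power2_eq_square)
        also have "(1 / 2 - d) * (5 / 4 + (5 / 2) * d - 3 * d\<^sup>2) = 5 / 8 - d\<^sup>2 * (4 - 3 * d)"
          by (simp add: power2_eq_square field_simps)
        finally show ?thesis by simp
      qed
      then have a: "d\<^sup>2 * (d\<^sup>2 * (4 - 3 * d)) \<le> d\<^sup>2 * (5 / 8)"
        by (intro mult_left_mono) auto
      have b: "d\<^sup>2 * d \<le> d\<^sup>2 * (1 / 2)"
        using 3 by (intro mult_left_mono) auto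
      have c: "d ^ 7 \<le> d ^ 6" "0 \<le> d ^ 6"
        using d by (intro power_decreasing) auto
      have expand: "(2 - d) ^ 3 * (1 + z + z\<^sup>2 / 2) = 8 + 4 * d + 6 * d\<^sup>2 - 9 * (d\<^sup>2 * d) - d\<^sup>2 * (d\<^sup>2 * (4 - 3 * d)) + d ^ 6 - d ^ 7 / 2"
      proof -
        define u where "u = d / 2"
        have du: "d = 2 * u" by (simp add: u_def)
        have z: "1 + z + z\<^sup>2 / 2 = 1 + 4 * (u + u\<^sup>2) + 8 * (u + u\<^sup>2)\<^sup>2" and d7: "d ^ 7 / 2 = 64 * u ^ 7"
          unfolding z_def du by (simp_all add: power2_eq_square algebra_simps eval_nat_numeral)
        show ?thesis
          unfolding z d7 unfolding du by (simp add: power2_eq_square eval_nat_numeral algebra_simps)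
      qed
      \<comment> \<open>Estimates \<open>a\<close> and \<open>b\<close> reduce \<open>expand\<close>
        to a quadratic with leading coefficient \<open>7/8 = 6 - 9/2 - 5/8\<close>. Its excess over
        the left side is expanded at \<open>d = 1/2\<close>, where it equals
        \<open>221/2400\<close>.\<close>
      have "0 \<le> (1 / 2 - d) * (468 / 100 - 875 / 1000 * (1 / 2 + d)) + 221 / 2400"
        using 3 d by (intro add_nonneg_nonneg mult_nonneg_nonneg) auto
      also have "\<dots> = 8 + 4 * d + 7 / 8 * d\<^sup>2 - 217 / 100 * (8 / 3 + 4 * d)"
        by (simp add: power2_eq_square field_simps)
      finally have "217 / 100 * (8 / 3 + 4 * d) \<le> 8 + 4 * d + 7 / 8 * d\<^sup>2"
        by simp
      also have "\<dots> \<le> (2 - d) ^ 3 * (1 + z + z\<^sup>2 / 2)"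
      proof -
        define p q where "p = d\<^sup>2 * (d\<^sup>2 * (4 - 3 * d))" and "q = d\<^sup>2 * d"
        show ?thesis
          unfolding expand using a b c unfolding p_def[symmetric] q_def[symmetric] by linarith
      qed
      finally show ?thesis by simp
    qed
    also have "\<dots> \<le> (2 - d) ^ 3 * exp z"
      using exp_lower_Taylor_quadratic[OF z0] d by (intro mult_left_mono) auto
    finally have 2: "(217 / 100) * (8 / 3 + 4 * d) \<le> (2 - d) ^ 3 * exp z" .
    have "16 * x ^ (N + 1) * (8 / 3 + 4 * d) \<le> ((217 / 100) * exp 2) * x ^ (N + 1) * (8 / 3 + 4 * d)"
      using exp_two_ge x d by (intro mult_right_mono) auto
    also have "\<dots> = (x ^ (N + 1) * exp 2) * ((217 / 100) * (8 / 3 + 4 * d))"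
      by simp
    also have "\<dots> \<le> (x ^ (N + 1) * exp 2) * ((2 - d) ^ 3 * exp z)"
      using 2 x by (intro mult_left_mono) auto
    also have "\<dots> = (x ^ (N + 1) * (exp 2 * exp z)) * (2 - d) ^ 3"
      by simp
    also have "\<dots> \<le> 1 * (2 - d) ^ 3"
      using 1 d by (intro mult_right_mono) auto
    finally show ?thesis
      by (simp add: x_def)
  qed
qed

text \<open>For \<open>N (1 - x) \<le> 2\<close> the Lebesgue constant alone suffices; otherwise the interpolation
  error is so small that adding it to \<open>B\<close> stays below the bound.\<close>

lemma cheb_interp_bounded_le:
  assumes F: "F holomorphic_on bernstein_ellipse \<rho>" and B: "\<And>z. z \<in> bernstein_ellipse \<rho> \<Longrightarrow> cmod (F z) \<le> B"
    and \<rho>: "1 < \<rho>" and N: "1 \<le> N" and x: "x = 1 / \<rho>\<^sup>2"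
  shows "cmod (\<Sum>j\<le>N. of_real (cardinal_cos N j \<theta>) * F (of_real (cos (cheb_angle N j)))) \<le> B * sqrt (2 / (1 - x))"
proof -
  have x01: "0 < x" "x < 1"
    using \<rho> by (auto simp: x one_less_power)
  have B0: "0 \<le> B"
    using B[OF of_real_cos_in_bernstein_ellipse[OF \<rho>, of 0]] by (smt (verit) norm_ge_zero)
  show ?thesis
  proof (cases "real N * (1 - x) \<le> 2")
    case True
    then have "real N \<le> 2 / (1 - x)"
      using x01 by (simp add: field_simps)
    then have "sqrt (real N) * B \<le> sqrt (2 / (1 - x)) * B"
      using B0 by (intro mult_right_mono real_sqrt_le_mono)
    then show ?thesis
      using cheb_interp_abs_le[where F = F, OF B \<rho> N, of \<theta>] by (simp add: mult.commute)
  next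
    case False
    define d where "d = 1 - x"
    have d: "0 < d" "d < 1" "x = 1 - d" using x01 by (auto simp: d_def)
    have Nd: "2 < real N * d" using False by (simp add: d_def)
    have "real N * ln x \<le> real N * - d"
      using x01 ln_le_minus_one[of x] by (intro mult_left_mono) (auto simp: d_def)
    moreover have "real N * - d = - (real N * (1 - x))"
      by (simp add: d_def algebra_simps)
    ultimately have "real N * ln x \<le> - 1"
      using False by linarith
    then have "exp (real N * ln x) \<le> exp (- 1)"
      by simp
    moreover have "exp (real N * ln x) = x ^ N"
      using x01 exp_of_nat_mult[of N "ln x"] by simp
    moreover have "exp (- 1 :: real) < 1 / 2"
      using exp_ge_add_one_self[of "1 :: real"] exp_lower_Taylor_quadratic[of "1 :: real"] by (simp add: exp_minus field_simps)
    ultimately have "x ^ N < 1 / 2"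
      by linarith
    from cheb_interp_error_le_energy[OF F B \<rho> N x this, of \<theta>]
    have err: "cmod (cheb_interp_error N F \<theta>) \<le> B * (4 * sqrt (x ^ (N + 1) / (1 - x\<^sup>2)))"
      by simp
    have le: "4 * sqrt (x ^ (N + 1) / (1 - x\<^sup>2)) \<le> sqrt (2 / d) - 1"
    proof -
      have s: "0 < sqrt d" "sqrt d < sqrt 2" using d(1,2) by auto
      have prod: "(sqrt 2 - sqrt d) * (sqrt 2 + sqrt d) = 2 - d"
        using d(1) by (simp add: algebra_simps)
      \<comment> \<open>The inequality of arithmetic and geometric means,
        \<open>2 sqrt (2 d) <= 2/3 + 3 d\<close>, with equality at \<open>d = 2/9\<close>; it
        removes the roots.\<close>
      have "(sqrt 2 + sqrt d)\<^sup>2 \<le> 8 / 3 + 4 * d"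
      proof -
        have "0 \<le> (sqrt 2 - 3 * sqrt d)\<^sup>2 / 3" by simp
        also have "\<dots> = (8 / 3 + 4 * d) - (sqrt 2 + sqrt d)\<^sup>2"
          using d(1) by (simp add: power2_sum power2_diff power_mult_distrib diff_divide_distrib add_divide_distrib)
        finally show ?thesis by simp
      qed
      then have "16 * x ^ (N + 1) * (sqrt 2 + sqrt d)\<^sup>2 \<le> 16 * x ^ (N + 1) * (8 / 3 + 4 * d)"
        using x01 by (intro mult_left_mono) auto
      also have "\<dots> \<le> (2 - d) ^ 3"
        unfolding d(3) using d(1,2) Nd by (rule small_power_bound)
      also have "\<dots> = (2 - d) * ((sqrt 2 - sqrt d) * (sqrt 2 + sqrt d))\<^sup>2"
        unfolding prod by (simp add: power2_eq_square power3_eq_cube)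
      also have "\<dots> = (2 - d) * (sqrt 2 - sqrt d)\<^sup>2 * (sqrt 2 + sqrt d)\<^sup>2"
        by (simp add: power_mult_distrib)
      finally have "16 * x ^ (N + 1) * (sqrt 2 + sqrt d)\<^sup>2 \<le> (2 - d) * (sqrt 2 - sqrt d)\<^sup>2 * (sqrt 2 + sqrt d)\<^sup>2" .
      moreover have "0 < (sqrt 2 + sqrt d)\<^sup>2"
        using s by (intro zero_less_power add_pos_pos) auto
      ultimately have sle: "16 * x ^ (N + 1) \<le> (2 - d) * (sqrt 2 - sqrt d)\<^sup>2"
        by (rule mult_right_le_imp_le)
      have xd: "1 - x\<^sup>2 = d * (2 - d)"
        unfolding d(3) by (simp add: power2_eq_square algebra_simps)
      have "16 * x ^ (N + 1) / (1 - x\<^sup>2) \<le> (2 - d) * (sqrt 2 - sqrt d)\<^sup>2 / (d * (2 - d))"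
        unfolding xd using d(1,2) sle by (intro divide_right_mono) auto
      also have "\<dots> = ((sqrt 2 - sqrt d) / sqrt d)\<^sup>2"
        using d(1,2) by (simp add: power_divide)
      finally have "sqrt (16 * x ^ (N + 1) / (1 - x\<^sup>2)) \<le> sqrt (((sqrt 2 - sqrt d) / sqrt d)\<^sup>2)"
        by (rule real_sqrt_le_mono)
      also have "\<dots> = (sqrt 2 - sqrt d) / sqrt d"
        using s by (intro real_sqrt_unique) auto
      finally have "sqrt (16 * x ^ (N + 1) / (1 - x\<^sup>2)) \<le> (sqrt 2 - sqrt d) / sqrt d" .
      moreover have "sqrt (16 * x ^ (N + 1) / (1 - x\<^sup>2)) = 4 * sqrt (x ^ (N + 1) / (1 - x\<^sup>2))"
        unfolding times_divide_eq_right[symmetric] real_sqrt_mult[of 16] by simp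
      moreover have "(sqrt 2 - sqrt d) / sqrt d = sqrt (2 / d) - 1"
        using s by (simp add: real_sqrt_divide diff_divide_distrib)
      ultimately show ?thesis by simp
    qed
    have "cmod (F (of_real (cos \<theta>)) - cheb_interp_error N F \<theta>) \<le> B + B * (4 * sqrt (x ^ (N + 1) / (1 - x\<^sup>2)))"
      by (rule order_trans[OF norm_triangle_ineq4 add_mono[OF B err]]) (rule of_real_cos_in_bernstein_ellipse[OF \<rho>])
    also have "\<dots> \<le> B + B * (sqrt (2 / d) - 1)"
      using le B0 by (intro add_left_mono mult_left_mono)
    also have "\<dots> = B * sqrt (2 / (1 - x))"
      by (simp add: d_def algebra_simps)
    finally show ?thesis
      by (simp add: cheb_interp_error_def)
  qed
qed

section \<open>Tensor products\<close>

definition node_override :: "'i set \<Rightarrow> ('i \<Rightarrow> real) \<Rightarrow> ('i \<Rightarrow> complex) \<Rightarrow> 'i \<Rightarrow> complex" where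
  "node_override U \<theta> z = (\<lambda>i. if i \<in> U then of_real (cos (\<theta> i)) else z i)"

text \<open>Interpolation in the coordinates of \<open>U\<close> only; the others stay at the
  complex point \<open>z\<close>, in which the result remains holomorphic. Points are plain
  functions, so that single coordinates can be updated and \<open>U\<close> can grow by
  induction.\<close>

definition tensor_interp ::
    "('i \<Rightarrow> nat) \<Rightarrow> ('i \<Rightarrow> real) \<Rightarrow> 'i set \<Rightarrow> (('i \<Rightarrow> complex) \<Rightarrow> complex) \<Rightarrow> ('i \<Rightarrow> complex) \<Rightarrow> complex" where
  "tensor_interp N \<theta> U F z = (\<Sum>k\<in>Pi\<^sub>E U (\<lambda>i. {..N i}).
     of_real (\<Prod>i\<in>U. cardinal_cos (N i) (k i) (\<theta> i)) *
     F (node_override U (\<lambda>i. cheb_angle (N i) (k i)) z))"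

lemma tensor_interp_insert:
  assumes "finite U" "j \<notin> U"
  shows "tensor_interp N \<theta> (insert j U) F z = (\<Sum>m\<le>N j. of_real (cardinal_cos (N j) m (\<theta> j)) *
    tensor_interp N \<theta> U F (z(j := of_real (cos (cheb_angle (N j) m)))))"
proof -
  have inj: "inj_on (\<lambda>(m, k). k(j := m)) ({..N j} \<times> Pi\<^sub>E U (\<lambda>i. {..N i}))"
    using assms(2) by (rule inj_combinator)
  have ov: "node_override (insert j U) (\<lambda>i. cheb_angle (N i) ((k(j := m)) i)) z
      = node_override U (\<lambda>i. cheb_angle (N i) (k i)) (z(j := of_real (cos (cheb_angle (N j) m))))" for k m
    using assms(2) by (auto simp: node_override_def fun_eq_iff)
  have pr: "(\<Prod>i\<in>insert j U. cardinal_cos (N i) ((k(j := m)) i) (\<theta> i))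
      = cardinal_cos (N j) m (\<theta> j) * (\<Prod>i\<in>U. cardinal_cos (N i) (k i) (\<theta> i))" for k m
  proof -
    have "(\<Prod>i\<in>U. cardinal_cos (N i) ((k(j := m)) i) (\<theta> i)) = (\<Prod>i\<in>U. cardinal_cos (N i) (k i) (\<theta> i))"
      using assms(2) by (intro prod.cong) auto
    then show ?thesis
      using assms by simp
  qed
  have "tensor_interp N \<theta> (insert j U) F z = (\<Sum>(m, k)\<in>{..N j} \<times> Pi\<^sub>E U (\<lambda>i. {..N i}).
     of_real (cardinal_cos (N j) m (\<theta> j)) * (of_real (\<Prod>i\<in>U. cardinal_cos (N i) (k i) (\<theta> i)) *
     F (node_override U (\<lambda>i. cheb_angle (N i) (k i)) (z(j := of_real (cos (cheb_angle (N j) m)))))))"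
    unfolding tensor_interp_def PiE_insert_eq sum.reindex[OF inj] o_def
    by (intro sum.cong refl) (auto simp only: split_def fst_conv snd_conv pr ov of_real_mult mult.assoc)
  then show ?thesis
    unfolding tensor_interp_def sum_distrib_left sum.cartesian_product[symmetric] by simp
qed

lemma two_term_cauchy_schwarz:
  fixes a b c d :: real
  assumes "0 \<le> a" "0 \<le> b" "0 \<le> c" "0 \<le> d"
  shows "a * b + c * d \<le> sqrt (a\<^sup>2 + c\<^sup>2) * sqrt (b\<^sup>2 + d\<^sup>2)"
proof -
  have "0 \<le> (a * d - c * b)\<^sup>2" by simp
  then have "(a * b + c * d)\<^sup>2 \<le> (a\<^sup>2 + c\<^sup>2) * (b\<^sup>2 + d\<^sup>2)"
    by (simp add: power2_eq_square algebra_simps)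
  then show ?thesis
    by (simp add: real_le_rsqrt flip: real_sqrt_mult)
qed

text \<open>The \<open>- 1\<close> under the last root is what lets the induction over the coordinates close: with
  \<open>c\<^sup>2 = 2 / (1 - x)\<close> the univariate error has the factor \<open>c\<^sup>2 - 1 = (1 + x) / (1 - x)\<close>,
  interpolation has norm at most \<open>c\<close>, and \<open>(c\<^sup>2 - 1) + c\<^sup>2 (P - 1) = c\<^sup>2 P - 1\<close>.\<close>

lemma tensor_interp_error:
  fixes F :: "('i::finite \<Rightarrow> complex) \<Rightarrow> complex" and \<rho> :: "'i \<Rightarrow> real"
  assumes \<rho>: "\<And>i. 1 < \<rho> i" and N: "\<And>i. 1 \<le> N i"
    and hol: "\<And>z i. (\<And>j. z j \<in> bernstein_ellipse (\<rho> j)) \<Longrightarrow> (\<lambda>\<zeta>. F (z(i := \<zeta>))) holomorphic_on bernstein_ellipse (\<rho> i)"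
    and B: "\<And>z. (\<And>j. z j \<in> bernstein_ellipse (\<rho> j)) \<Longrightarrow> cmod (F z) \<le> B"
    and z: "\<And>j. z j \<in> bernstein_ellipse (\<rho> j)"
  shows "cmod (F (node_override U \<theta> z) - tensor_interp N \<theta> U F z)
    \<le> 2 * B * sqrt (\<Sum>i\<in>U. (1 / (\<rho> i)\<^sup>2) ^ N i) * sqrt ((\<Prod>i\<in>U. 2 / (1 - 1 / (\<rho> i)\<^sup>2)) - 1)"
  using finite[of U] z
proof (induction U arbitrary: z rule: finite_induct)
  case empty
  have "node_override {} \<theta> z = z" "node_override {} (\<lambda>i. cheb_angle (N i) undefined) z = z"
    by (auto simp: node_override_def)
  then show ?case
    by (simp add: tensor_interp_def node_override_def)
next
  case (insert j U)
  define x where "x i = 1 / (\<rho> i)\<^sup>2" for i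
  have x: "0 < x i" "x i < 1" for i
    using \<rho>[of i] by (auto simp: x_def one_less_power)
  define S where "S = (\<Sum>i\<in>U. x i ^ N i)"
  define P where "P = (\<Prod>i\<in>U. 2 / (1 - x i))"
  have S0: "0 \<le> S"
    unfolding S_def using x by (intro sum_nonneg zero_le_power) (auto intro: less_imp_le)
  have P1: "1 \<le> P"
    unfolding P_def using x by (intro prod_ge_1) (auto simp: le_divide_eq, smt (verit) x)
  have B0: "0 \<le> B"
    using B[OF insert.prems] norm_ge_zero order_trans by blast
  have upd: "(z(j := \<zeta>)) i \<in> bernstein_ellipse (\<rho> i)" if "\<zeta> \<in> bernstein_ellipse (\<rho> j)" for \<zeta> i
    using that insert.prems by auto
  have ovin: "node_override U' \<alpha> y i \<in> bernstein_ellipse (\<rho> i)"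
    if "\<And>i. y i \<in> bernstein_ellipse (\<rho> i)" for U' \<alpha> y i
    using that of_real_cos_in_bernstein_ellipse[OF \<rho>] by (auto simp: node_override_def)
  have ovupd: "node_override U \<alpha> (z(j := \<zeta>)) = (node_override U \<alpha> z)(j := \<zeta>)" for \<alpha> \<zeta>
    using insert.hyps(2) by (auto simp: node_override_def fun_eq_iff)
  \<comment> \<open>Slices in the new coordinate: \<open>\<phi>\<close> is exact in the coordinates
    of \<open>U\<close>, \<open>\<psi>\<close> is the error of interpolating those. The induction
    hypothesis holds for complex \<open>z\<close> and so bounds \<open>\<psi>\<close> on the whole
    ellipse; this bound later takes the place of \<open>B\<close> in
    \<open>cheb_interp_bounded_le\<close>.\<close>
  define \<phi> where "\<phi> \<zeta> = F (node_override U \<theta> (z(j := \<zeta>)))" for \<zeta>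
  define \<psi> where "\<psi> \<zeta> = \<phi> \<zeta> - tensor_interp N \<theta> U F (z(j := \<zeta>))" for \<zeta>
  have hol': "(\<lambda>\<zeta>. F (node_override U \<alpha> (z(j := \<zeta>)))) holomorphic_on bernstein_ellipse (\<rho> j)" for \<alpha>
    unfolding ovupd using insert.prems by (intro hol ovin)
  have \<phi>hol: "\<phi> holomorphic_on bernstein_ellipse (\<rho> j)"
    unfolding \<phi>_def by (rule hol')
  have \<psi>hol: "\<psi> holomorphic_on bernstein_ellipse (\<rho> j)"
    unfolding \<psi>_def tensor_interp_def using \<phi>hol hol' by (intro holomorphic_intros)
  have \<phi>B: "cmod (\<phi> \<zeta>) \<le> B" if "\<zeta> \<in> bernstein_ellipse (\<rho> j)" for \<zeta>
    unfolding \<phi>_def using upd[OF that] by (intro B ovin)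
  have \<psi>B: "cmod (\<psi> \<zeta>) \<le> 2 * B * sqrt S * sqrt (P - 1)" if "\<zeta> \<in> bernstein_ellipse (\<rho> j)" for \<zeta>
    unfolding \<psi>_def \<phi>_def S_def P_def x_def using upd[OF that] by (rule insert.IH)
  have "node_override (insert j U) \<theta> z = node_override U \<theta> (z(j := of_real (cos (\<theta> j))))"
    using insert.hyps(2) by (auto simp: node_override_def fun_eq_iff)
  then have "F (node_override (insert j U) \<theta> z) - tensor_interp N \<theta> (insert j U) F z
     = cheb_interp_error (N j) \<phi> (\<theta> j)
      + (\<Sum>m\<le>N j. of_real (cardinal_cos (N j) m (\<theta> j)) * \<psi> (of_real (cos (cheb_angle (N j) m))))"
    unfolding tensor_interp_insert[OF insert.hyps] cheb_interp_error_def \<psi>_def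
    by (simp add: \<phi>_def right_diff_distrib sum_subtractf)
  also have "cmod \<dots> \<le> 2 * B * sqrt (x j ^ N j * ((1 + x j) / (1 - x j)))
      + 2 * B * sqrt S * sqrt (P - 1) * sqrt (2 / (1 - x j))"
    by (rule order_trans[OF norm_triangle_ineq add_mono[OF
      cheb_interp_error_le[OF \<phi>hol \<phi>B \<rho> N x_def] cheb_interp_bounded_le[OF \<psi>hol \<psi>B \<rho> N x_def]]])
  also have "\<dots> = 2 * B * (sqrt (x j ^ N j) * sqrt ((1 + x j) / (1 - x j)) + sqrt S * sqrt (2 / (1 - x j) * (P - 1)))"
    by (simp only: real_sqrt_mult) (simp add: algebra_simps)
  also have "\<dots> \<le> 2 * B * (sqrt (x j ^ N j + S) * sqrt (2 / (1 - x j) * P - 1))"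
  proof (rule mult_left_mono)
    have x1: "0 \<le> (1 + x j) / (1 - x j)" "0 \<le> 2 / (1 - x j)" "(1 + x j) / (1 - x j) = 2 / (1 - x j) - 1"
      using x[of j] by (auto simp: field_simps)
    have "sqrt (x j ^ N j) * sqrt ((1 + x j) / (1 - x j)) + sqrt S * sqrt (2 / (1 - x j) * (P - 1))
      \<le> sqrt ((sqrt (x j ^ N j))\<^sup>2 + (sqrt S)\<^sup>2) * sqrt ((sqrt ((1 + x j) / (1 - x j)))\<^sup>2 + (sqrt (2 / (1 - x j) * (P - 1)))\<^sup>2)"
      using x1 x[of j] S0 P1 by (intro two_term_cauchy_schwarz) auto
    also have "(sqrt (x j ^ N j))\<^sup>2 = x j ^ N j"
      using x[of j] by simp
    also have "(sqrt S)\<^sup>2 = S"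
      using S0 by simp
    also have "(sqrt ((1 + x j) / (1 - x j)))\<^sup>2 = 2 / (1 - x j) - 1"
      using x1 by simp
    also have "(sqrt (2 / (1 - x j) * (P - 1)))\<^sup>2 = 2 / (1 - x j) * (P - 1)"
      using x1(2) P1 by (intro real_sqrt_pow2 mult_nonneg_nonneg) auto
    also have "2 / (1 - x j) - 1 + 2 / (1 - x j) * (P - 1) = 2 / (1 - x j) * P - 1"
      by (simp add: right_diff_distrib)
    finally show "sqrt (x j ^ N j) * sqrt ((1 + x j) / (1 - x j)) + sqrt S * sqrt (2 / (1 - x j) * (P - 1))
      \<le> sqrt (x j ^ N j + S) * sqrt (2 / (1 - x j) * P - 1)" .
  qed (use B0 in auto)
  finally show ?case
    using insert.hyps by (simp add: S_def P_def x_def)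
qed

section \<open>Interpolation on the box\<close>

definition box_angle :: "real^'d \<Rightarrow> real^'d \<Rightarrow> real^'d \<Rightarrow> 'd \<Rightarrow> real" where
  "box_angle xl xu x i = arccos ((2 * x $ i - xl $ i - xu $ i) / (xu $ i - xl $ i))"

lemma interval_map_of_real: "interval_map a b (of_real r) = (of_real (interval_map a b r) :: 'a::real_field)"
  by (simp add: interval_map_def)

lemma interval_map_diff: "interval_map a b z - interval_map a b w = (b - a) / 2 * (z - w)" for z w :: real
  by (simp add: interval_map_def left_diff_distrib right_diff_distrib diff_divide_distrib)

lemma interval_map_in:
  assumes "a \<le> b" "- 1 \<le> z" "z \<le> (1::real)"
  shows "a \<le> interval_map a b z" "interval_map a b z \<le> b"
proof -
  have "(b - a) / 2 * (1 - z) \<le> (b - a) / 2 * 2" "0 \<le> (b - a) / 2 * (1 - z)"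
    using assms by (intro mult_left_mono mult_nonneg_nonneg; simp)+
  moreover have "interval_map a b z = b - (b - a) / 2 * (1 - z)"
    by (simp add: interval_map_def left_diff_distrib right_diff_distrib diff_divide_distrib)
  ultimately show "a \<le> interval_map a b z" "interval_map a b z \<le> b"
    by auto
qed

lemma cos_box_angle:
  assumes "xl $ i < xu $ i" "x \<in> cbox xl xu"
  shows "cos (box_angle xl xu x i) = (2 * x $ i - xl $ i - xu $ i) / (xu $ i - xl $ i)"
    and "interval_map (xl $ i) (xu $ i) (cos (box_angle xl xu x i)) = x $ i"
    and "0 \<le> box_angle xl xu x i" "box_angle xl xu x i \<le> pi"
proof -
  have x: "xl $ i \<le> x $ i" "x $ i \<le> xu $ i"
    using assms(2) by (auto simp: mem_box_cart)
  have r: "- 1 \<le> (2 * x $ i - xl $ i - xu $ i) / (xu $ i - xl $ i)" "(2 * x $ i - xl $ i - xu $ i) / (xu $ i - xl $ i) \<le> 1"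
    using x assms(1) by (auto simp: field_simps)
  show 1: "cos (box_angle xl xu x i) = (2 * x $ i - xl $ i - xu $ i) / (xu $ i - xl $ i)"
    unfolding box_angle_def using r by (rule cos_arccos)
  show "interval_map (xl $ i) (xu $ i) (cos (box_angle xl xu x i)) = x $ i"
  proof -
    have "(xl $ i - xu $ i) / 2 * (1 - (2 * x $ i - xl $ i - xu $ i) / (xu $ i - xl $ i)) = x $ i - xu $ i"
      using assms(1) by (simp add: divide_simps) (simp add: algebra_simps)
    then show ?thesis
      unfolding 1 interval_map_def by (simp only: of_real_eq_id id_apply)
  qed
  show "0 \<le> box_angle xl xu x i" "box_angle xl xu x i \<le> pi"
    unfolding box_angle_def using r by (auto intro: arccos_lbound arccos_ubound)
qed

lemma cheb_cos:
  assumes "0 \<le> \<theta>" "\<theta> \<le> pi"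
  shows "cheb m (cos \<theta>) = cos (real m * \<theta>)"
  using assms by (simp add: cheb_def arccos_cos)

lemma inv_box_map:
  assumes "\<And>i. xl $ i < xu $ i" "x \<in> cbox xl xu"
  shows "inv_into (cbox (-1) 1) (box_map xl xu) x = (\<chi> i. cos (box_angle xl xu x i))"
proof (rule inv_into_f_eq)
  show "inj_on (box_map xl xu) (cbox (-1) 1)"
  proof (rule inj_onI)
    fix z w assume "box_map xl xu z = box_map xl xu w"
    then have "interval_map (xl $ i) (xu $ i) (z $ i) - interval_map (xl $ i) (xu $ i) (w $ i) = 0" for i
      by (simp add: box_map_def vec_eq_iff)
    then have "(xu $ i - xl $ i) / 2 * (z $ i - w $ i) = 0" for i
      unfolding interval_map_diff .
    moreover have "xu $ i - xl $ i \<noteq> 0" for i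
      using assms(1)[of i] by simp
    ultimately show "z = w"
      by (auto simp: vec_eq_iff)
  qed
  show "(\<chi> i. cos (box_angle xl xu x i)) \<in> cbox (-1) 1"
    by (auto simp: mem_box_cart)
  show "box_map xl xu (\<chi> i. cos (box_angle xl xu x i)) = x"
    using cos_box_angle(2)[OF assms] by (simp add: box_map_def vec_eq_iff)
qed

lemma cheb_basis_in_box:
  assumes "\<And>i. xl $ i < xu $ i" "x \<in> cbox xl xu"
  shows "cheb_basis xl xu j x = (\<Prod>i\<in>UNIV. cos (real (j $ i) * box_angle xl xu x i))"
  using assms cos_box_angle(3,4)[OF assms]
  by (simp add: cheb_basis_def inv_box_map cheb_tensor_def cheb_cos)

lemma cheb_basis_outside: "x \<notin> cbox xl xu \<Longrightarrow> cheb_basis xl xu j x = 0"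
  by (simp add: cheb_basis_def)

lemma cheb_angle_bounds:
  assumes "k \<le> n" "1 \<le> n"
  shows "0 \<le> cheb_angle n k" "cheb_angle n k \<le> pi"
  using assms by (auto simp: cheb_angle_def field_simps)

lemma cheb_node_nth: "cheb_node xl xu N k $ i = interval_map (xl $ i) (xu $ i) (cos (cheb_angle (N $ i) (k $ i)))"
  by (simp add: cheb_node_def box_map_def ref_node_def cheb_angle_def)

lemma cheb_node_in_box:
  assumes "\<And>i. xl $ i < xu $ i"
  shows "cheb_node xl xu N k \<in> cbox xl xu"
  unfolding mem_box_cart cheb_node_nth by (auto intro!: interval_map_in[OF less_imp_le[OF assms]])

lemma cheb_tensor_ref_node:
  assumes "\<And>i. 1 \<le> N $ i" "k \<in> multi_indices N"
  shows "cheb_tensor j (ref_node N k) = (\<Prod>i\<in>UNIV. cos (real (j $ i) * cheb_angle (N $ i) (k $ i)))"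
proof -
  have "k $ i \<le> N $ i" for i
    using assms(2) by (simp add: multi_indices_def)
  then have "cheb (j $ i) (cos (cheb_angle (N $ i) (k $ i))) = cos (real (j $ i) * cheb_angle (N $ i) (k $ i))" for i
    by (intro cheb_cos cheb_angle_bounds assms(1))
  then show ?thesis
    by (simp add: cheb_tensor_def ref_node_def flip: cheb_angle_def)
qed

lemma lagrange_tensor_eq_cardinal_cos:
  assumes box: "\<And>i. xl $ i < xu $ i" and x: "x \<in> cbox xl xu"
    and N: "\<And>i. 1 \<le> N $ i" and k: "k \<in> multi_indices N"
  shows "lagrange_tensor xl xu N k x = (\<Prod>i\<in>UNIV. cardinal_cos (N $ i) (k $ i) (box_angle xl xu x i))"
  unfolding lagrange_tensor_def Let_def
proof (rule prod.cong[OF refl])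
  fix i
  have ki: "k $ i \<le> N $ i"
    using k by (simp add: multi_indices_def)
  show "(\<Prod>m\<in>{..N $ i} - {k $ i}.
      (x $ i - interval_map (xl $ i) (xu $ i) (cos (pi * real m / real (N $ i)))) /
      (interval_map (xl $ i) (xu $ i) (cos (pi * real (k $ i) / real (N $ i))) -
       interval_map (xl $ i) (xu $ i) (cos (pi * real m / real (N $ i))))) =
    cardinal_cos (N $ i) (k $ i) (box_angle xl xu x i)"
    unfolding cardinal_cos_eq_lagrange[OF N ki] lagrange_cheb_def cheb_angle_def
  proof (rule prod.cong[OF refl])
    fix m
    show "(x $ i - interval_map (xl $ i) (xu $ i) (cos (pi * real m / real (N $ i)))) /
      (interval_map (xl $ i) (xu $ i) (cos (pi * real (k $ i) / real (N $ i))) -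
       interval_map (xl $ i) (xu $ i) (cos (pi * real m / real (N $ i)))) =
      (cos (box_angle xl xu x i) - cos (pi * real m / real (N $ i))) /
      (cos (pi * real (k $ i) / real (N $ i)) - cos (pi * real m / real (N $ i)))"
      unfolding interval_map_diff
      by (subst cos_box_angle(2)[OF box x, of i, symmetric]) (use box[of i] in \<open>simp add: interval_map_diff\<close>)
  qed
qed

lemma sum_multi_indices: "(\<Sum>k\<in>multi_indices N. f k) = (\<Sum>k\<in>Pi\<^sub>E UNIV (\<lambda>i. {..N $ i}). f (vec_lambda k))"
  by (rule sum.reindex_bij_witness[where i = vec_lambda and j = vec_nth]) (auto simp: multi_indices_def PiE_def Pi_def)

lemma finite_multi_indices: "finite (multi_indices N)"
proof -
  have "multi_indices N \<subseteq> vec_lambda ` Pi\<^sub>E UNIV (\<lambda>i. {..N $ i})"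
  proof
    fix k assume "k \<in> multi_indices N"
    then show "k \<in> vec_lambda ` Pi\<^sub>E UNIV (\<lambda>i. {..N $ i})"
      by (intro image_eqI[of _ _ "vec_nth k"]) (auto simp: multi_indices_def)
  qed
  then show ?thesis
    by (rule finite_subset) (intro finite_imageI finite_PiE, auto)
qed

lemma prod_sum_multi_indices:
  fixes g :: "'d::finite \<Rightarrow> nat \<Rightarrow> real"
  shows "(\<Sum>k\<in>multi_indices N. \<Prod>i\<in>UNIV. g i (k $ i)) = (\<Prod>i\<in>UNIV. \<Sum>m\<le>N $ i. g i m)"
  unfolding sum_multi_indices by (subst prod_sum_PiE) auto

text \<open>After interchanging the sums, the sum over \<open>j\<close> belonging to one node
  factorizes over the coordinates, and each factor is \<open>cardinal_cos_expand\<close>.\<close>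

lemma cheb_interp_eq_lagrange:
  assumes box: "\<And>i. xl $ i < xu $ i" and x: "x \<in> cbox xl xu" and N: "\<And>i. 1 \<le> N $ i"
  shows "cheb_interp xl xu N v x = (\<Sum>k\<in>multi_indices N. v k * lagrange_tensor xl xu N k x)"
proof -
  let ?\<theta> = "box_angle xl xu x"
  have coeff: "cheb_coeff N v j = (\<Sum>k\<in>multi_indices N. v k * (\<Prod>i\<in>UNIV.
      2 * end_weight (N $ i) (j $ i) / real (N $ i) * (end_weight (N $ i) (k $ i) * cos (real (j $ i) * cheb_angle (N $ i) (k $ i)))))"
    if "j \<in> multi_indices N" for j
  proof -
    have "(2 ^ (if 0 < j $ i \<and> j $ i < N $ i then 1 else 0) :: real) = 2 * end_weight (N $ i) (j $ i)" for i
      using that by (auto simp: end_weight_def multi_indices_def le_neq_implies_less)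
    moreover have "(if k $ i \<in> {0, N $ i} then 1 / 2 else 1) = end_weight (N $ i) (k $ i)" for i k
      by (simp add: end_weight_def)
    ultimately show ?thesis
      unfolding cheb_coeff_def sum_distrib_left
      by (intro sum.cong refl) (simp only: cheb_tensor_ref_node[OF N] prod.distrib mult_ac)
  qed
  have "cheb_interp xl xu N v x = (\<Sum>j\<in>multi_indices N. (\<Sum>k\<in>multi_indices N. v k * (\<Prod>i\<in>UNIV.
      2 * end_weight (N $ i) (j $ i) / real (N $ i) * (end_weight (N $ i) (k $ i) * cos (real (j $ i) * cheb_angle (N $ i) (k $ i)))))
      * (\<Prod>i\<in>UNIV. cos (real (j $ i) * ?\<theta> i)))"
    unfolding cheb_interp_def cheb_comb_def
    by (intro sum.cong refl) (simp only: coeff cheb_basis_in_box[OF box x])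
  also have "\<dots> = (\<Sum>k\<in>multi_indices N. v k * (\<Sum>j\<in>multi_indices N. \<Prod>i\<in>UNIV.
      2 * end_weight (N $ i) (j $ i) / real (N $ i) * (end_weight (N $ i) (k $ i) * cos (real (j $ i) * cheb_angle (N $ i) (k $ i)))
      * cos (real (j $ i) * ?\<theta> i)))"
    unfolding sum_distrib_right sum_distrib_left prod.distrib[symmetric] mult.assoc
    by (subst sum.swap) simp
  also have "\<dots> = (\<Sum>k\<in>multi_indices N. v k * lagrange_tensor xl xu N k x)"
  proof (rule sum.cong[OF refl])
    fix k assume k: "k \<in> multi_indices N"
    show "v k * (\<Sum>j\<in>multi_indices N. \<Prod>i\<in>UNIV.
        2 * end_weight (N $ i) (j $ i) / real (N $ i) * (end_weight (N $ i) (k $ i) * cos (real (j $ i) * cheb_angle (N $ i) (k $ i)))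
        * cos (real (j $ i) * ?\<theta> i)) = v k * lagrange_tensor xl xu N k x"
      unfolding lagrange_tensor_eq_cardinal_cos[OF box x N k] cardinal_cos_expand[OF N]
      by (subst prod_sum_multi_indices[symmetric]) simp
  qed
  finally show ?thesis .
qed

text \<open>Each basis cosine is reproduced by interpolation. This turns almost sure vanishing at
  the finitely many nodes into almost sure vanishing of a random polynomial.\<close>

lemma cheb_comb_eq_lagrange:
  assumes box: "\<And>i. xl $ i < xu $ i" and x: "x \<in> cbox xl xu" and N: "\<And>i. 1 \<le> N $ i"
  shows "cheb_comb xl xu N c x
    = (\<Sum>k\<in>multi_indices N. cheb_comb xl xu N c (cheb_node xl xu N k) * lagrange_tensor xl xu N k x)"
proof -
  let ?\<theta> = "box_angle xl xu x"
  have node: "cheb_basis xl xu j (cheb_node xl xu N k) = (\<Prod>i\<in>UNIV. cos (real (j $ i) * cheb_angle (N $ i) (k $ i)))"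
    if k: "k \<in> multi_indices N" for j k
  proof -
    have ang: "box_angle xl xu (cheb_node xl xu N k) i = cheb_angle (N $ i) (k $ i)" for i
    proof -
      have "(xu $ i - xl $ i) / 2 * (cos (box_angle xl xu (cheb_node xl xu N k) i) - cos (cheb_angle (N $ i) (k $ i))) = 0"
        using cos_box_angle(2)[of xl i xu, OF box cheb_node_in_box[of xl xu N k, OF box]]
        unfolding cheb_node_nth interval_map_diff[symmetric] by simp
      then have "cos (box_angle xl xu (cheb_node xl xu N k) i) = cos (cheb_angle (N $ i) (k $ i))"
        using box[of i] by simp
      moreover have "k $ i \<le> N $ i"
        using k by (simp add: multi_indices_def)
      ultimately show ?thesis
        using cos_box_angle(3,4)[of xl i xu, OF box cheb_node_in_box[of xl xu N k, OF box]]
          cheb_angle_bounds[of "k $ i" "N $ i", OF _ N]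
          cos_inj_pi by auto
    qed
    show ?thesis
      unfolding cheb_basis_in_box[OF box cheb_node_in_box[OF box]] ang ..
  qed
  have rep: "(\<Sum>k\<in>multi_indices N. cheb_basis xl xu j (cheb_node xl xu N k) * lagrange_tensor xl xu N k x) = cheb_basis xl xu j x"
    if j: "j \<in> multi_indices N" for j
  proof -
    have "(\<Sum>k\<in>multi_indices N. cheb_basis xl xu j (cheb_node xl xu N k) * lagrange_tensor xl xu N k x)
      = (\<Sum>k\<in>multi_indices N. \<Prod>i\<in>UNIV. cardinal_cos (N $ i) (k $ i) (?\<theta> i) * cos (real (j $ i) * cheb_angle (N $ i) (k $ i)))"
      by (intro sum.cong refl) (simp add: node lagrange_tensor_eq_cardinal_cos[OF box x N] prod.distrib)
    also have "\<dots> = (\<Prod>i\<in>UNIV. cos (real (j $ i) * ?\<theta> i))"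
      unfolding prod_sum_multi_indices[where g = "\<lambda>i m. cardinal_cos (N $ i) m (?\<theta> i) * cos (real (j $ i) * cheb_angle (N $ i) m)"]
      using j by (intro prod.cong refl cardinal_cos_reproduces N) (auto simp: multi_indices_def)
    finally show ?thesis
      by (simp add: cheb_basis_in_box[OF box x])
  qed
  have "(\<Sum>k\<in>multi_indices N. cheb_comb xl xu N c (cheb_node xl xu N k) * lagrange_tensor xl xu N k x)
    = (\<Sum>j\<in>multi_indices N. c j * (\<Sum>k\<in>multi_indices N. cheb_basis xl xu j (cheb_node xl xu N k) * lagrange_tensor xl xu N k x))"
    unfolding cheb_comb_def sum_distrib_right sum_distrib_left by (subst sum.swap) (simp add: mult.assoc)
  also have "\<dots> = cheb_comb xl xu N c x"
    unfolding cheb_comb_def by (intro sum.cong refl) (simp add: rep)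
  finally show ?thesis ..
qed

lemma continuous_on_lagrange_tensor: "continuous_on A (lagrange_tensor xl xu N k)"
  unfolding lagrange_tensor_def Let_def divide_inverse by (intro continuous_intros)

lemma sum_lagrange_le_lebesgue_const:
  assumes "x \<in> cbox xl xu"
  shows "(\<Sum>j\<in>multi_indices N. \<bar>lagrange_tensor xl xu N j x\<bar>) \<le> lebesgue_const xl xu N"
  unfolding lebesgue_const_def
proof (rule cSUP_upper[OF assms])
  have "compact ((\<lambda>x. \<Sum>j\<in>multi_indices N. \<bar>lagrange_tensor xl xu N j x\<bar>) ` cbox xl xu)"
    by (intro compact_continuous_image continuous_intros continuous_on_lagrange_tensor compact_cbox)
  then show "bdd_above ((\<lambda>x. \<Sum>j\<in>multi_indices N. \<bar>lagrange_tensor xl xu N j x\<bar>) ` cbox xl xu)"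
    by (intro bounded_imp_bdd_above compact_imp_bounded)
qed

lemma of_real_box_in_polyellipse:
  assumes "\<And>i. xl $ i < xu $ i" "\<And>i. 1 < \<rho> $ i" "x \<in> cbox xl xu"
  shows "(\<chi> i. complex_of_real (x $ i)) \<in> bernstein_polyellipse xl xu \<rho>"
proof -
  have "complex_of_real (x $ i) = interval_map (xl $ i) (xu $ i) (of_real (cos (box_angle xl xu x i)))" for i
    unfolding interval_map_of_real cos_box_angle(2)[OF assms(1,3)] ..
  then show ?thesis
    unfolding bernstein_polyellipse_def
    by (auto intro!: image_eqI of_real_cos_in_bernstein_ellipse assms(2))
qed

lemma analytic_extension_abs_le:
  assumes "\<And>i. xl $ i < xu $ i" "\<And>i. 1 < \<rho> $ i" "analytic_extension_bounded xl xu \<rho> B h" "x \<in> cbox xl xu"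
  shows "\<bar>h x\<bar> \<le> B"
proof -
  obtain F where F: "\<forall>x\<in>cbox xl xu. F (\<chi> i. complex_of_real (x $ i)) = complex_of_real (h x)"
    "\<forall>z\<in>bernstein_polyellipse xl xu \<rho>. cmod (F z) \<le> B"
    using assms(3) unfolding analytic_extension_bounded_def by blast
  then show ?thesis
    using of_real_box_in_polyellipse[OF assms(1,2,4)] assms(4) by (metis norm_of_real)
qed

text \<open>By the chain rule and complex linearity, the derivative along the line is multiplication
  by the scalar \<open>F' e\<close>.\<close>

lemma analytic_several_holomorphic_line:
  fixes c e :: "complex^'d"
  assumes F: "analytic_several S F" and S: "\<And>\<zeta>. \<zeta> \<in> A \<Longrightarrow> c + \<zeta> *s e \<in> S"
  shows "(\<lambda>\<zeta>. F (c + \<zeta> *s e)) holomorphic_on A"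
  unfolding holomorphic_on_def
proof
  fix \<zeta> assume "\<zeta> \<in> A"
  then obtain F' where F': "(F has_derivative F') (at (c + \<zeta> *s e))" "\<And>k v. F' (k *s v) = k * F' v"
    using F S unfolding analytic_several_def by blast
  have "bounded_linear (\<lambda>v. v *s e)"
    by (rule linear_conv_bounded_linear[THEN iffD1], rule linearI)
      (auto simp: vec_eq_iff algebra_simps)
  then have "((\<lambda>\<zeta>. c + \<zeta> *s e) has_derivative (\<lambda>v. v *s e)) (at \<zeta>)"
    by (auto intro!: derivative_eq_intros bounded_linear_imp_has_derivative)
  from diff_chain_at[OF this F'(1)]
  have "((\<lambda>\<zeta>. F (c + \<zeta> *s e)) has_derivative (\<lambda>v. F' e * v)) (at \<zeta>)"
    by (simp add: o_def F'(2) mult.commute)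
  then have "((\<lambda>\<zeta>. F (c + \<zeta> *s e)) has_field_derivative F' e) (at \<zeta>)"
    by (simp add: has_field_derivative_def)
  then show "(\<lambda>\<zeta>. F (c + \<zeta> *s e)) field_differentiable at \<zeta> within A"
    using field_differentiable_at_within field_differentiable_def by blast
qed

text \<open>The pullback to the reference box is an instance of \<open>tensor_interp_error\<close>
  with all coordinates interpolated. The numerators 2 in its product become
  \<open>2 powr (D / 2)\<close>, and the \<open>- 1\<close> under the root is dropped.\<close>

lemma cheb_interp_error_le_eps_int:
  fixes \<rho> :: "real^'d"
  assumes box: "\<And>i. xl $ i < xu $ i" and N: "\<And>i. 1 \<le> N $ i" and \<rho>: "\<And>i. 1 < \<rho> $ i"
    and an: "analytic_extension_bounded xl xu \<rho> B h" and x: "x \<in> cbox xl xu"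
  shows "\<bar>h x - cheb_interp xl xu N (\<lambda>k. h (cheb_node xl xu N k)) x\<bar> \<le> eps_int \<rho> N B"
proof -
  obtain F where F: "analytic_several (bernstein_polyellipse xl xu \<rho>) F"
    "\<And>x. x \<in> cbox xl xu \<Longrightarrow> F (\<chi> i. complex_of_real (x $ i)) = complex_of_real (h x)"
    "\<And>z. z \<in> bernstein_polyellipse xl xu \<rho> \<Longrightarrow> cmod (F z) \<le> B"
    using an unfolding analytic_extension_bounded_def by blast
  define G where "G z = F (\<chi> i. interval_map (xl $ i) (xu $ i) (z i))" for z
  have inE: "(\<chi> i. interval_map (xl $ i) (xu $ i) (z i)) \<in> bernstein_polyellipse xl xu \<rho>"
    if "\<And>i. z i \<in> bernstein_ellipse (\<rho> $ i)" for z
    using that by (auto simp: bernstein_polyellipse_def)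
  have B: "cmod (G z) \<le> B" if "\<And>i. z i \<in> bernstein_ellipse (\<rho> $ i)" for z
    unfolding G_def using that by (intro F(3) inE)
  have hol: "(\<lambda>\<zeta>. G (z(i := \<zeta>))) holomorphic_on bernstein_ellipse (\<rho> $ i)"
    if z: "\<And>j. z j \<in> bernstein_ellipse (\<rho> $ j)" for z i
  proof -
    define c where "c = (\<chi> j. interval_map (xl $ j) (xu $ j) ((z(i := 0)) j))"
    define e where "e = (\<chi> j. if j = i then complex_of_real ((xu $ i - xl $ i) / 2) else 0)"
    have line: "(\<chi> j. interval_map (xl $ j) (xu $ j) ((z(i := \<zeta>)) j)) = c + \<zeta> *s e" for \<zeta>
      by (auto simp: c_def e_def vec_eq_iff interval_map_def field_simps)
    show ?thesis
      unfolding G_def line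
      by (rule analytic_several_holomorphic_line[OF F(1)], subst line[symmetric], rule inE) (use z in auto)
  qed
  \<comment> \<open>Any point of the ellipses would serve as base point, because overriding on
    \<open>UNIV\<close> replaces every coordinate.\<close>
  define z0 :: "'d \<Rightarrow> complex" where "z0 = (\<lambda>_. of_real (cos 0))"
  have z0: "z0 j \<in> bernstein_ellipse (\<rho> $ j)" for j
    unfolding z0_def using \<rho> by (rule of_real_cos_in_bernstein_ellipse)
  define \<theta> where "\<theta> = box_angle xl xu x"
  have Gx: "G (node_override UNIV \<theta> z0) = of_real (h x)"
    using F(2)[OF x] cos_box_angle(2)[OF box x]
    by (simp add: G_def node_override_def interval_map_of_real \<theta>_def)
  have Gk: "G (node_override UNIV (\<lambda>i. cheb_angle (N $ i) (k i)) z0) = of_real (h (cheb_node xl xu N (vec_lambda k)))" for k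
    using F(2)[OF cheb_node_in_box[of xl xu N "vec_lambda k", OF box]]
    by (simp add: G_def node_override_def interval_map_of_real cheb_node_nth)
  have "tensor_interp (\<lambda>i. N $ i) \<theta> UNIV G z0 = of_real (cheb_interp xl xu N (\<lambda>k. h (cheb_node xl xu N k)) x)"
    unfolding cheb_interp_eq_lagrange[OF box x N] sum_multi_indices tensor_interp_def Gk of_real_sum
    by (intro sum.cong refl)
      (auto simp: lagrange_tensor_eq_cardinal_cos[OF box x N] multi_indices_def \<theta>_def PiE_def Pi_def)
  then have "\<bar>h x - cheb_interp xl xu N (\<lambda>k. h (cheb_node xl xu N k)) x\<bar>
      = cmod (G (node_override UNIV \<theta> z0) - tensor_interp (\<lambda>i. N $ i) \<theta> UNIV G z0)"
    unfolding Gx by (metis norm_of_real of_real_diff)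
  also have "\<dots> \<le> 2 * B * sqrt (\<Sum>i\<in>UNIV. (1 / (\<rho> $ i)\<^sup>2) ^ (N $ i)) * sqrt ((\<Prod>i\<in>UNIV. 2 / (1 - 1 / (\<rho> $ i)\<^sup>2)) - 1)"
    by (rule tensor_interp_error[OF \<rho> N hol B z0])
  also have "\<dots> \<le> 2 * B * sqrt (\<Sum>i\<in>UNIV. (1 / (\<rho> $ i)\<^sup>2) ^ (N $ i)) * sqrt (\<Prod>i\<in>UNIV. 2 / (1 - 1 / (\<rho> $ i)\<^sup>2))"
    using order_trans[OF norm_ge_zero B[OF z0]] by (intro mult_left_mono mult_nonneg_nonneg) (auto intro!: sum_nonneg)
  also have "\<dots> = eps_int \<rho> N B"
  proof -
    have 1: "(\<Prod>i\<in>UNIV. 2 / (1 - 1 / (\<rho> $ i)\<^sup>2)) = 2 ^ CARD('d) * (\<Prod>i\<in>UNIV. 1 / (1 - 1 / (\<rho> $ i)\<^sup>2))"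
      by (simp add: prod_dividef)
    have 2: "2 powr (real CARD('d) / 2 + 1) = 2 * sqrt (2 ^ CARD('d))"
    proof -
      have "2 powr (real CARD('d) / 2) = (2 powr real CARD('d)) powr (1 / 2)"
        by (simp add: powr_powr)
      also have "\<dots> = sqrt (2 ^ CARD('d))"
        by (simp add: powr_half_sqrt powr_realpow)
      finally show ?thesis
        by (simp add: powr_add)
    qed
    have 3: "(1 / (\<rho> $ i)\<^sup>2) ^ (N $ i) = 1 / (\<rho> $ i) ^ (2 * N $ i)" for i
      by (simp add: power_divide power_mult)
    show ?thesis
      unfolding eps_int_def 1 2 3 sum_distrib_right[symmetric] real_sqrt_mult by simp
  qed
  finally show ?thesis .
qed

section \<open>Moments and error propagation\<close>

lemma abs_cheb_basis_le:
  assumes "\<And>i. xl $ i < xu $ i"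
  shows "\<bar>cheb_basis xl xu j x\<bar> \<le> 1"
proof (cases "x \<in> cbox xl xu")
  case True
  then show ?thesis
    unfolding cheb_basis_in_box[OF assms True] abs_prod by (intro prod_le_1) auto
qed (simp add: cheb_basis_outside)

text \<open>The definition goes through \<open>arccos\<close> and \<open>inv_into\<close>; rewritten
  as a polynomial times an indicator, the function is visibly Borel.\<close>

lemma cheb_basis_measurable [measurable]:
  assumes "\<And>i. xl $ i < xu $ i"
  shows "cheb_basis xl xu j \<in> borel_measurable borel"
proof -
  obtain c :: "nat \<Rightarrow> real poly" where c: "\<And>m \<theta>. poly (c m) (cos \<theta>) = cos (real m * \<theta>)"
    using cos_multiple_poly by metis
  let ?h = "\<lambda>x. indicator (cbox xl xu) x * (\<Prod>i\<in>UNIV. poly (c (j $ i)) ((2 * x $ i - xl $ i - xu $ i) * (1 / (xu $ i - xl $ i))))"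
  have "cheb_basis xl xu j x = ?h x" for x
  proof (cases "x \<in> cbox xl xu")
    case True
    then show ?thesis
      using cos_box_angle(1)[OF assms True] by (simp add: cheb_basis_in_box[OF assms True] flip: c)
  qed (simp add: cheb_basis_outside)
  moreover have "?h \<in> borel_measurable borel"
    by (intro borel_measurable_times borel_measurable_indicator borel_measurable_continuous_onI continuous_intros) auto
  ultimately show ?thesis
    by presburger
qed

lemma integrable_cheb_basis:
  assumes "\<And>i. xl $ i < xu $ i" "prob_space \<kappa>" "sets \<kappa> = sets borel"
  shows "integrable \<kappa> (cheb_basis xl xu j)"
proof -
  interpret prob_space \<kappa> by fact
  have "cheb_basis xl xu j \<in> borel_measurable \<kappa>"
    using cheb_basis_measurable[OF assms(1)] measurable_cong_sets[OF assms(3) refl] by blast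
  then show ?thesis
    using abs_cheb_basis_le[OF assms(1)] by (intro integrable_const_bound[where B = 1]) auto
qed

lemma integral_cheb_comb:
  assumes "\<And>i. xl $ i < xu $ i" "prob_space \<kappa>" "sets \<kappa> = sets borel"
  shows "integrable \<kappa> (cheb_comb xl xu N c)"
    and "(\<integral>y. cheb_comb xl xu N c y \<partial>\<kappa>) = (\<Sum>j\<in>multi_indices N. c j * (\<integral>y. cheb_basis xl xu j y \<partial>\<kappa>))"
  using integrable_cheb_basis[OF assms] unfolding cheb_comb_def by simp_all

lemma markov_kernel_prob:
  assumes "markov_process M T X K" "0 \<le> s" "s \<le> t" "t \<le> T"
  shows "prob_space (K s t x)" "sets (K s t x) = sets borel"
proof -
  have "K s t \<in> borel \<rightarrow>\<^sub>M prob_algebra borel"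
    using assms unfolding markov_process_def by blast
  then have "K s t x \<in> space (prob_algebra borel)"
    by (rule measurable_space) simp
  then show "prob_space (K s t x)" "sets (K s t x) = sets borel"
    by (auto simp: space_prob_algebra)
qed

text \<open>Linearity is given for two summands inside \<open>cheb_space\<close>, hence the
  induction over index sets, which keeps every partial sum in the space.\<close>

lemma random_linear_ops_cheb_comb:
  assumes ops: "random_linear_ops M xl xu N n \<Gamma>h" and u: "u < n" and k: "k \<in> multi_indices N" and \<omega>: "\<omega> \<in> space M"
  shows "\<Gamma>h u k \<omega> (cheb_comb xl xu N c) = (\<Sum>j\<in>multi_indices N. c j * \<Gamma>h u k \<omega> (cheb_basis xl xu j))"
proof -
  let ?L = "\<Gamma>h u k \<omega>"
  have lin: "?L (\<lambda>x. a * p x + b * q x) = a * ?L p + b * ?L q"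
    if "p \<in> cheb_space xl xu N" "q \<in> cheb_space xl xu N" for p q a b
    using ops u k \<omega> that unfolding random_linear_ops_def by blast
  have part: "(\<lambda>x. \<Sum>j\<in>S. c j * cheb_basis xl xu j x) \<in> cheb_space xl xu N" if "S \<subseteq> multi_indices N" for S c
  proof -
    have "(\<lambda>x. \<Sum>j\<in>S. c j * cheb_basis xl xu j x) = cheb_comb xl xu N (\<lambda>j. if j \<in> S then c j else 0)"
      unfolding cheb_comb_def using that
      by (intro ext sum.mono_neutral_cong_left finite_multi_indices) auto
    then show ?thesis
      by (simp add: cheb_space_def)
  qed
  have basis: "cheb_basis xl xu j \<in> cheb_space xl xu N" if "j \<in> multi_indices N" for j
    using part[of "{j}" "\<lambda>_. 1"] that by simp
  have "?L (\<lambda>x. \<Sum>j\<in>S. c j * cheb_basis xl xu j x) = (\<Sum>j\<in>S. c j * ?L (cheb_basis xl xu j))" if "S \<subseteq> multi_indices N" for S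
    using finite_subset[OF that finite_multi_indices] that
  proof (induction S rule: finite_induct)
    case empty
    have "(\<lambda>_. 0) \<in> cheb_space xl xu N"
      using part[of "{}"] by simp
    then show ?case
      using lin[of "\<lambda>_. 0" "\<lambda>_. 0" 0 0] by simp
  next
    case (insert j S)
    then have "?L (\<lambda>x. c j * cheb_basis xl xu j x + 1 * (\<Sum>j\<in>S. c j * cheb_basis xl xu j x))
        = c j * ?L (cheb_basis xl xu j) + 1 * ?L (\<lambda>x. \<Sum>j\<in>S. c j * cheb_basis xl xu j x)"
      by (intro lin basis part) auto
    then show ?case
      using insert by simp
  qed
  then show ?thesis
    unfolding cheb_comb_def by simp
qed

lemma cheb_basis_in_cheb_space:
  assumes "j \<in> multi_indices N"
  shows "cheb_basis xl xu j \<in> cheb_space xl xu N"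
proof -
  have "cheb_basis xl xu j = cheb_comb xl xu N (\<lambda>i. if i = j then 1 else 0)"
    using assms finite_multi_indices[of N]
    by (auto simp: cheb_comb_def fun_eq_iff if_distrib[of "\<lambda>a. a * _"] cong: if_cong)
  then show ?thesis
    by (simp add: cheb_space_def)
qed

lemma cheb_comb_scale: "cheb_comb xl xu N (\<lambda>j. a * c j) x = a * cheb_comb xl xu N c x"
  by (simp add: cheb_comb_def sum_distrib_left mult.assoc)

lemma cheb_comb_outside: "x \<notin> cbox xl xu \<Longrightarrow> cheb_comb xl xu N c x = 0"
  by (simp add: cheb_comb_def cheb_basis_outside)

text \<open>By linearity the bound for norm 1 scales to all polynomials. That
  \<open>\<delta>\<close> is nonnegative follows from the constant polynomial 1, and it permits
  replacing the norm by the larger \<open>m\<close>.\<close>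

lemma GM_bound:
  assumes box: "\<And>i. xl $ i < xu $ i" and M: "prob_space M"
    and ops: "random_linear_ops M xl xu N n \<Gamma>h" and u: "u < n" and k: "k \<in> multi_indices N"
    and \<kappa>: "prob_space (K (t u) (t (Suc u)) (cheb_node xl xu N k))" "sets (K (t u) (t (Suc u)) (cheb_node xl xu N k)) = sets borel"
    and gm: "GM M xl xu N K t n \<Gamma>h \<delta>" and \<omega>: "\<omega> \<in> space M" and p: "p \<in> cheb_space xl xu N"
    and m: "\<And>x. x \<in> cbox xl xu \<Longrightarrow> \<bar>p x\<bar> \<le> m"
  shows "\<bar>gen_moment xl xu N K t u k p - \<Gamma>h u k \<omega> p\<bar> \<le> \<delta> * m" "0 \<le> \<delta>"
proof -
  let ?D = "\<lambda>p. gen_moment xl xu N K t u k p - \<Gamma>h u k \<omega> p"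
  have D: "\<bar>?D q\<bar> \<le> \<delta>" if "q \<in> cheb_space xl xu N" "max_norm xl xu q = 1" for q
    using gm u k \<omega> that unfolding GM_def by metis
  have scale: "?D (cheb_comb xl xu N (\<lambda>j. a * c j)) = a * ?D (cheb_comb xl xu N c)" for a c
    unfolding gen_moment_def integral_cheb_comb(2)[OF box \<kappa>] random_linear_ops_cheb_comb[OF ops u k \<omega>]
    by (simp add: sum_distrib_left right_diff_distrib mult.assoc)
  have xl: "xl \<in> cbox xl xu"
    using box by (auto simp: mem_box_cart intro: less_imp_le)
  have sharp: "\<bar>?D q\<bar> \<le> \<delta> * max_norm xl xu q \<and> 0 \<le> max_norm xl xu q"
    if q: "q \<in> cheb_space xl xu N" for q
  proof -
    obtain c where c: "q = cheb_comb xl xu N c"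
      using q by (auto simp: cheb_space_def)
    define s where "s = max_norm xl xu q"
    have "\<bar>q x\<bar> \<le> (\<Sum>j\<in>multi_indices N. \<bar>c j\<bar>)" for x
      unfolding c cheb_comb_def
      by (rule order_trans[OF sum_abs sum_mono]) (use abs_cheb_basis_le[OF box] in \<open>auto simp: abs_mult intro: mult_left_le\<close>)
    then have bdd: "bdd_above ((\<lambda>x. \<bar>q x\<bar>) ` cbox xl xu)"
      by (intro bdd_aboveI2)
    have le: "\<bar>q x\<bar> \<le> s" if "x \<in> cbox xl xu" for x
      unfolding s_def max_norm_def using that bdd by (rule cSUP_upper)
    have s0: "0 \<le> s"
      using le[OF xl] by linarith
    show ?thesis
    proof (cases "s = 0")
      case True
      have "q = (\<lambda>x. 0)"
        using le True cheb_comb_outside[of _ xl xu N c] c by (intro ext) fastforce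
      then have "q = cheb_comb xl xu N (\<lambda>j. 0 * c j)"
        by (simp add: cheb_comb_def)
      then have "?D q = 0"
        using scale[of 0 c] by simp
      then show ?thesis
        using True s_def by simp
    next
      case False
      then have s: "0 < s" using s0 by simp
      define r where "r = cheb_comb xl xu N (\<lambda>j. (1 / s) * c j)"
      have rq: "\<bar>r x\<bar> = \<bar>q x\<bar> / s" for x
        unfolding r_def cheb_comb_scale c[symmetric] using s by (simp add: abs_mult)
      have le1: "\<bar>r x\<bar> \<le> 1" if "x \<in> cbox xl xu" for x
        using le[OF that] s by (simp add: rq)
      have "max_norm xl xu r = 1"
      proof (rule antisym)
        show "max_norm xl xu r \<le> 1"
          unfolding max_norm_def using xl le1 by (intro cSUP_least) auto
        have "bdd_above ((\<lambda>x. \<bar>r x\<bar>) ` cbox xl xu)"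
          using le1 by (intro bdd_aboveI2)
        then have "\<bar>r x\<bar> \<le> max_norm xl xu r" if "x \<in> cbox xl xu" for x
          unfolding max_norm_def using that by (intro cSUP_upper)
        then have "\<bar>q x\<bar> \<le> s * max_norm xl xu r" if "x \<in> cbox xl xu" for x
          using that s by (simp add: rq divide_le_eq mult.commute)
        then have "max_norm xl xu q \<le> s * max_norm xl xu r"
          unfolding max_norm_def[of xl xu q] using xl by (intro cSUP_least) auto
        then have "s \<le> s * max_norm xl xu r"
          by (simp only: s_def)
        then show "1 \<le> max_norm xl xu r"
          using s by simp
      qed
      moreover have "r \<in> cheb_space xl xu N"
        by (simp add: r_def cheb_space_def)
      ultimately have "\<bar>?D r\<bar> \<le> \<delta>"
        by (intro D)
      then have "\<bar>?D q\<bar> / s \<le> \<delta>"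
        unfolding r_def scale c[symmetric] using s by (simp add: abs_mult)
      then show ?thesis
        using s by (simp add: divide_le_eq s_def)
    qed
  qed
  show d0: "0 \<le> \<delta>"
  proof -
    have z: "(0 :: nat^'a) \<in> multi_indices N"
      by (simp add: multi_indices_def)
    have "cheb_basis xl xu 0 x = 1" if "x \<in> cbox xl xu" for x
      using that by (simp add: cheb_basis_in_box[OF box])
    then have "max_norm xl xu (cheb_basis xl xu 0) = (SUP x\<in>cbox xl xu. 1)"
      unfolding max_norm_def by (intro SUP_cong) auto
    also have "\<dots> = 1"
      by (rule cSUP_const) (use xl in blast)
    finally show ?thesis
      using D[OF cheb_basis_in_cheb_space[OF z]] by linarith
  qed
  have "max_norm xl xu p \<le> m"
    unfolding max_norm_def using xl m by (intro cSUP_least) auto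
  then show "\<bar>?D p\<bar> \<le> \<delta> * m"
    using sharp[OF p] d0 mult_left_mono order_trans by blast
qed

text \<open>Scaling as in \<open>GM_bound\<close>, now by \<open>star_norm\<close>. An infinite norm
  cannot be scaled to 1, which explains \<open>fin\<close>; norm 0 is treated separately.\<close>

lemma GM_star_bound:
  assumes box: "\<And>i. xl $ i < xu $ i" and N: "\<And>i. 1 \<le> N $ i" and M: "prob_space M"
    and ops: "random_linear_ops M xl xu N n \<Gamma>h" and u: "u < n" and k: "k \<in> multi_indices N"
    and \<kappa>: "prob_space (K (t u) (t (Suc u)) (cheb_node xl xu N k))" "sets (K (t u) (t (Suc u)) (cheb_node xl xu N k)) = sets borel"
    and gm: "GM_star M xl xu N K t n \<Gamma>h \<delta>"
    and c: "\<And>j. j \<in> multi_indices N \<Longrightarrow> c j \<in> borel_measurable M"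
    and fin: "star_norm M xl xu (\<lambda>\<omega>. cheb_comb xl xu N (\<lambda>j. c j \<omega>)) < \<infinity>"
  shows "(\<integral>\<^sup>+\<omega>. ennreal \<bar>gen_moment xl xu N K t u k (cheb_comb xl xu N (\<lambda>j. c j \<omega>))
      - \<Gamma>h u k \<omega> (cheb_comb xl xu N (\<lambda>j. c j \<omega>))\<bar> \<partial>M)
    \<le> ennreal \<delta> * star_norm M xl xu (\<lambda>\<omega>. cheb_comb xl xu N (\<lambda>j. c j \<omega>))"
proof -
  let ?D = "\<lambda>\<omega> p. gen_moment xl xu N K t u k p - \<Gamma>h u k \<omega> p"
  let ?p = "\<lambda>c \<omega>. cheb_comb xl xu N (\<lambda>j. c j \<omega>)"
  have D: "?D \<omega> (cheb_comb xl xu N b) = (\<Sum>j\<in>multi_indices N. b j * ?D \<omega> (cheb_basis xl xu j))"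
    if "\<omega> \<in> space M" for b \<omega>
    unfolding gen_moment_def integral_cheb_comb(2)[OF box \<kappa>] random_linear_ops_cheb_comb[OF ops u k that]
    by (simp add: right_diff_distrib sum_subtractf)
  have meas: "(\<lambda>\<omega>. ?p c \<omega> x) \<in> borel_measurable M" for x
    unfolding cheb_comb_def using c by measurable
  have "star_norm M xl xu (?p c) \<noteq> \<top>"
    using fin by auto
  then obtain s where s: "star_norm M xl xu (?p c) = ennreal s" "0 \<le> s"
    by (cases "star_norm M xl xu (?p c)") auto
  show ?thesis
  proof (cases "s = 0")
    case True
    \<comment> \<open>Norm 0 yields a null set for each \<open>x\<close> separately. The finitely
      many nodes have a common null set, and outside it the polynomial vanishes identically.\<close>
    have "AE \<omega> in M. \<forall>k\<in>multi_indices N. ?p c \<omega> (cheb_node xl xu N k) = 0"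
    proof (rule AE_finite_allI[OF finite_multi_indices])
      fix k
      have "(\<integral>\<^sup>+\<omega>. ennreal \<bar>?p c \<omega> (cheb_node xl xu N k)\<bar> \<partial>M) \<le> star_norm M xl xu (?p c)"
        unfolding star_norm_def by (intro SUP_upper cheb_node_in_box box)
      then have "(\<integral>\<^sup>+\<omega>. ennreal \<bar>?p c \<omega> (cheb_node xl xu N k)\<bar> \<partial>M) = 0"
        using s True by simp
      then show "AE \<omega> in M. ?p c \<omega> (cheb_node xl xu N k) = 0"
        using meas by (subst (asm) nn_integral_0_iff_AE) (auto simp: ennreal_eq_0_iff)
    qed
    then have "AE \<omega> in M. ennreal \<bar>?D \<omega> (?p c \<omega>)\<bar> = 0"
    proof (rule AE_mp, intro AE_I2 impI)
      fix \<omega> assume \<omega>: "\<omega> \<in> space M" and z: "\<forall>k\<in>multi_indices N. ?p c \<omega> (cheb_node xl xu N k) = 0"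
      have "?p c \<omega> x = 0" for x
        using z cheb_comb_eq_lagrange[OF box _ N, of x "\<lambda>j. c j \<omega>"] cheb_comb_outside[of x xl xu N]
        by (cases "x \<in> cbox xl xu") auto
      then have "?p c \<omega> = cheb_comb xl xu N (\<lambda>j. 0)"
        by (auto simp: cheb_comb_def)
      then show "ennreal \<bar>?D \<omega> (?p c \<omega>)\<bar> = 0"
        using D[OF \<omega>, of "\<lambda>j. 0"] by simp
    qed
    then have "(\<integral>\<^sup>+\<omega>. ennreal \<bar>?D \<omega> (?p c \<omega>)\<bar> \<partial>M) = (\<integral>\<^sup>+\<omega>. 0 \<partial>M)"
      by (rule nn_integral_cong_AE)
    then show ?thesis by simp
  next
    case False
    then have s0: "0 < s" using s by simp
    define b where "b j \<omega> = (1 / s) * c j \<omega>" for j \<omega>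
    have pb: "ennreal \<bar>?p b \<omega> x\<bar> = ennreal (1 / s) * ennreal \<bar>?p c \<omega> x\<bar>" for \<omega> x
      unfolding b_def cheb_comb_scale using s0 by (simp add: abs_mult flip: ennreal_mult)
    have "star_norm M xl xu (?p b) = ennreal (1 / s) * star_norm M xl xu (?p c)"
      unfolding star_norm_def pb using meas
      by (subst nn_integral_cmult) (auto simp: SUP_mult_left_ennreal)
    also have "\<dots> = 1"
      unfolding s(1) using s0 by (simp flip: ennreal_mult)
    finally have "star_norm M xl xu (?p b) = 1" .
    moreover have "\<forall>j\<in>multi_indices N. b j \<in> borel_measurable M"
      unfolding b_def using c by (auto intro!: borel_measurable_times)
    ultimately have le: "(\<integral>\<^sup>+\<omega>. ennreal \<bar>?D \<omega> (?p b \<omega>)\<bar> \<partial>M) \<le> ennreal \<delta>"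
      using gm u k unfolding GM_star_def Let_def by blast
    have Db: "?D \<omega> (?p c \<omega>) = s * ?D \<omega> (?p b \<omega>)" if "\<omega> \<in> space M" for \<omega>
      unfolding D[OF that] b_def using s0 by (simp add: sum_distrib_left)
    have bD: "(\<lambda>\<omega>. ?D \<omega> (?p b \<omega>)) \<in> borel_measurable M"
    proof -
      have "(\<lambda>\<omega>. \<Gamma>h u k \<omega> (cheb_basis xl xu j)) \<in> borel_measurable M" if "j \<in> multi_indices N" for j
        using ops u k cheb_basis_in_cheb_space[OF that] unfolding random_linear_ops_def by blast
      then have "(\<lambda>\<omega>. \<Sum>j\<in>multi_indices N. b j \<omega> * ?D \<omega> (cheb_basis xl xu j)) \<in> borel_measurable M"
        unfolding b_def using c
        by (intro borel_measurable_sum borel_measurable_times borel_measurable_diff borel_measurable_const) auto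
      then show ?thesis
        by (subst measurable_cong[OF D])
    qed
    have "(\<integral>\<^sup>+\<omega>. ennreal \<bar>?D \<omega> (?p c \<omega>)\<bar> \<partial>M) = (\<integral>\<^sup>+\<omega>. ennreal s * ennreal \<bar>?D \<omega> (?p b \<omega>)\<bar> \<partial>M)"
      using s0 by (intro nn_integral_cong) (simp only: Db abs_mult, simp add: ennreal_mult)
    also have "\<dots> = ennreal s * (\<integral>\<^sup>+\<omega>. ennreal \<bar>?D \<omega> (?p b \<omega>)\<bar> \<partial>M)"
      by (intro nn_integral_cmult measurable_compose[OF borel_measurable_abs[OF bD] measurable_ennreal])
    also have "\<dots> \<le> ennreal s * ennreal \<delta>"
      using le by (rule mult_left_mono) simp
    finally show ?thesis
      unfolding s(1) by (simp add: mult.commute)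
  qed
qed

text \<open>The polynomial vanishes outside the box, so all of \<open>v\<close> there counts as
  truncation error. Inside, \<open>err\<close> bounds the expectation at each fixed point while
  \<open>\<kappa>\<close> integrates over the points; Fubini's theorem reconciles the two, and
  \<open>e\<close> survives because \<open>\<kappa>\<close> has mass 1.\<close>

lemma conditional_expectation_step:
  assumes box: "\<And>i. xl $ i < xu $ i" and M: "prob_space M"
    and \<kappa>: "prob_space \<kappa>" "sets \<kappa> = sets borel" and v: "integrable \<kappa> v"
    and c: "\<And>j. j \<in> multi_indices N \<Longrightarrow> c j \<in> borel_measurable M"
    and L: "L \<in> borel_measurable M"
    and tr: "\<bar>\<integral>y. v y * indicator (- cbox xl xu) y \<partial>\<kappa>\<bar> \<le> \<epsilon>"
    and err: "\<And>x. x \<in> cbox xl xu \<Longrightarrow> (\<integral>\<^sup>+\<omega>. ennreal \<bar>v x - cheb_comb xl xu N (\<lambda>j. c j \<omega>) x\<bar> \<partial>M) \<le> e"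
    and gm: "(\<integral>\<^sup>+\<omega>. ennreal \<bar>(\<integral>y. cheb_comb xl xu N (\<lambda>j. c j \<omega>) y \<partial>\<kappa>) - L \<omega>\<bar> \<partial>M) \<le> d"
  shows "(\<integral>\<^sup>+\<omega>. ennreal \<bar>(\<integral>y. v y \<partial>\<kappa>) - L \<omega>\<bar> \<partial>M) \<le> ennreal \<epsilon> + e + d"
proof -
  interpret M: prob_space M by fact
  interpret \<kappa>: prob_space \<kappa> by fact
  interpret pair_sigma_finite \<kappa> M ..
  let ?W = "\<lambda>\<omega>. cheb_comb xl xu N (\<lambda>j. c j \<omega>)"
  let ?v = "\<lambda>y. v y * indicator (cbox xl xu) y"
  let ?Iv = "\<integral>y. v y * indicator (cbox xl xu) y \<partial>\<kappa>" and ?IW = "\<lambda>\<omega>. \<integral>y. ?W \<omega> y \<partial>\<kappa>"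
  have [measurable_cong]: "sets \<kappa> = sets borel" by fact
  have box_meas: "cbox xl xu \<in> sets \<kappa>" "- cbox xl xu \<in> sets \<kappa>"
    unfolding \<kappa>(2) by auto
  have vin: "integrable \<kappa> ?v" and vout: "integrable \<kappa> (\<lambda>y. v y * indicator (- cbox xl xu) y)"
    using integrable_real_mult_indicator[OF box_meas(1) v] integrable_real_mult_indicator[OF box_meas(2) v]
    by (simp_all add: mult.commute)
  have W: "integrable \<kappa> (?W \<omega>)" for \<omega>
    by (rule integral_cheb_comb(1)[OF box \<kappa>])
  have split: "(\<integral>y. v y \<partial>\<kappa>) = ?Iv + (\<integral>y. v y * indicator (- cbox xl xu) y \<partial>\<kappa>)"
    by (subst Bochner_Integration.integral_add[OF vin vout, symmetric])
      (intro Bochner_Integration.integral_cong refl, auto simp: indicator_def)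
  have IW: "(\<lambda>\<omega>. \<integral>y. ?W \<omega> y \<partial>\<kappa>) \<in> borel_measurable M"
    unfolding integral_cheb_comb(2)[OF box \<kappa>] using c by measurable
  have vm: "v \<in> borel_measurable \<kappa>"
    using v by auto
  have Wm: "(\<lambda>(y, \<omega>). ?W \<omega> y) \<in> borel_measurable (\<kappa> \<Otimes>\<^sub>M M)"
  proof -
    have "(\<lambda>z. \<Sum>j\<in>multi_indices N. c j (snd z) * cheb_basis xl xu j (fst z)) \<in> borel_measurable (\<kappa> \<Otimes>\<^sub>M M)"
    proof (intro borel_measurable_sum borel_measurable_times)
      fix j assume j: "j \<in> multi_indices N"
      show "(\<lambda>z. c j (snd z)) \<in> borel_measurable (\<kappa> \<Otimes>\<^sub>M M)"
        by (rule measurable_compose[OF measurable_snd c[OF j]])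
      have "cheb_basis xl xu j \<in> borel_measurable \<kappa>"
        using integrable_cheb_basis[OF box \<kappa>] by auto
      then show "(\<lambda>z. cheb_basis xl xu j (fst z)) \<in> borel_measurable (\<kappa> \<Otimes>\<^sub>M M)"
        by (rule measurable_compose[OF measurable_fst])
    qed
    then show ?thesis
      by (simp add: cheb_comb_def split_def)
  qed
  have diffm: "(\<lambda>(y, \<omega>). ennreal \<bar>?v y - ?W \<omega> y\<bar>) \<in> borel_measurable (\<kappa> \<Otimes>\<^sub>M M)"
  proof -
    have "(\<lambda>z. v (fst z) * indicator (cbox xl xu) (fst z)) \<in> borel_measurable (\<kappa> \<Otimes>\<^sub>M M)"
      by (rule measurable_compose[OF measurable_fst borel_measurable_integrable[OF vin]])
    then show ?thesis
      using Wm by (simp add: split_def)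
  qed
  have mid: "(\<integral>\<^sup>+\<omega>. ennreal \<bar>?Iv - ?IW \<omega>\<bar> \<partial>M) \<le> e"
  proof -
    have "(\<integral>\<^sup>+\<omega>. ennreal \<bar>?Iv - ?IW \<omega>\<bar> \<partial>M)
        \<le> (\<integral>\<^sup>+\<omega>. (\<integral>\<^sup>+y. ennreal \<bar>?v y - ?W \<omega> y\<bar> \<partial>\<kappa>) \<partial>M)"
    proof (rule nn_integral_mono)
      fix \<omega>
      have "?Iv - ?IW \<omega> = (\<integral>y. ?v y - ?W \<omega> y \<partial>\<kappa>)"
        using vin W by (rule Bochner_Integration.integral_diff[symmetric])
      then show "ennreal \<bar>?Iv - ?IW \<omega>\<bar>
        \<le> (\<integral>\<^sup>+y. ennreal \<bar>?v y - ?W \<omega> y\<bar> \<partial>\<kappa>)"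
        using integral_norm_bound_ennreal[OF Bochner_Integration.integrable_diff[OF vin W[of \<omega>]]] by simp
    qed
    also have "\<dots> = (\<integral>\<^sup>+y. (\<integral>\<^sup>+\<omega>. ennreal \<bar>?v y - ?W \<omega> y\<bar> \<partial>M) \<partial>\<kappa>)"
      by (rule Fubini'[OF diffm])
    also have "\<dots> \<le> (\<integral>\<^sup>+y. e \<partial>\<kappa>)"
    proof (rule nn_integral_mono)
      fix y
      show "(\<integral>\<^sup>+\<omega>. ennreal \<bar>?v y - ?W \<omega> y\<bar> \<partial>M) \<le> e"
        using err[of y] by (cases "y \<in> cbox xl xu") (simp_all add: cheb_comb_outside)
    qed
    also have "\<dots> = e"
      by (simp add: \<kappa>.emeasure_space_1)
    finally show ?thesis .
  qed
  have "(\<integral>\<^sup>+\<omega>. ennreal \<bar>(\<integral>y. v y \<partial>\<kappa>) - L \<omega>\<bar> \<partial>M)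
    \<le> (\<integral>\<^sup>+\<omega>. ennreal \<epsilon> + ennreal \<bar>?Iv - ?IW \<omega>\<bar>
        + ennreal \<bar>?IW \<omega> - L \<omega>\<bar> \<partial>M)"
  proof (rule nn_integral_mono)
    fix \<omega>
    have "\<bar>(\<integral>y. v y \<partial>\<kappa>) - L \<omega>\<bar> \<le> \<epsilon> + \<bar>?Iv - ?IW \<omega>\<bar>
        + \<bar>?IW \<omega> - L \<omega>\<bar>"
      using tr unfolding split by linarith
    then show "ennreal \<bar>(\<integral>y. v y \<partial>\<kappa>) - L \<omega>\<bar> \<le> ennreal \<epsilon> + ennreal \<bar>?Iv - ?IW \<omega>\<bar>
        + ennreal \<bar>?IW \<omega> - L \<omega>\<bar>"
      using order_trans[OF abs_ge_zero tr] by (simp add: ennreal_leI flip: ennreal_plus)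
  qed
  also have "\<dots> = ennreal \<epsilon> + (\<integral>\<^sup>+\<omega>. ennreal \<bar>?Iv - ?IW \<omega>\<bar> \<partial>M)
      + (\<integral>\<^sup>+\<omega>. ennreal \<bar>?IW \<omega> - L \<omega>\<bar> \<partial>M)"
    using IW L by (simp add: nn_integral_add M.emeasure_space_1)
  also have "\<dots> \<le> ennreal \<epsilon> + e + d"
    using mid gm by (intro add_mono) auto
  finally show ?thesis .
qed

text \<open>The nodal errors enter with the deterministic weights \<open>lagrange_tensor\<close>, so
  expectations can be taken node by node; the absolute weights then add up to at most the Lebesgue
  constant.\<close>

lemma cheb_interp_error_propagation:
  assumes box: "\<And>i. xl $ i < xu $ i" and N: "\<And>i. 1 \<le> N $ i" and M: "prob_space M"
    and x: "x \<in> cbox xl xu"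
    and int: "\<bar>v x - cheb_interp xl xu N (\<lambda>k. v (cheb_node xl xu N k)) x\<bar> \<le> \<epsilon>"
    and w: "\<And>k. k \<in> multi_indices N \<Longrightarrow> w k \<in> borel_measurable M"
    and le: "\<And>k. k \<in> multi_indices N \<Longrightarrow> (\<integral>\<^sup>+\<omega>. ennreal \<bar>v (cheb_node xl xu N k) - w k \<omega>\<bar> \<partial>M) \<le> ennreal d"
    and d: "0 \<le> d"
  shows "(\<integral>\<^sup>+\<omega>. ennreal \<bar>v x - cheb_interp xl xu N (\<lambda>k. w k \<omega>) x\<bar> \<partial>M) \<le> ennreal (\<epsilon> + lebesgue_const xl xu N * d)"
proof -
  interpret prob_space M by fact
  let ?l = "\<lambda>k. lagrange_tensor xl xu N k x"
  let ?d = "\<lambda>k \<omega>. \<bar>v (cheb_node xl xu N k) - w k \<omega>\<bar>" and ?I = "\<lambda>\<omega>. cheb_interp xl xu N (\<lambda>k. w k \<omega>) x"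
  have \<epsilon>: "0 \<le> \<epsilon>" using int by linarith
  have "(\<integral>\<^sup>+\<omega>. ennreal \<bar>v x - ?I \<omega>\<bar> \<partial>M)
    \<le> (\<integral>\<^sup>+\<omega>. ennreal \<epsilon> + (\<Sum>k\<in>multi_indices N. ennreal \<bar>?l k\<bar> * ennreal (?d k \<omega>)) \<partial>M)"
  proof (rule nn_integral_mono)
    fix \<omega>
    have "cheb_interp xl xu N (\<lambda>k. v (cheb_node xl xu N k)) x - ?I \<omega>
        = (\<Sum>k\<in>multi_indices N. (v (cheb_node xl xu N k) - w k \<omega>) * ?l k)"
      unfolding cheb_interp_eq_lagrange[OF box x N] by (simp add: left_diff_distrib sum_subtractf)
    moreover have "\<bar>\<Sum>k\<in>multi_indices N. (v (cheb_node xl xu N k) - w k \<omega>) * ?l k\<bar>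
        \<le> (\<Sum>k\<in>multi_indices N. \<bar>?l k\<bar> * ?d k \<omega>)"
      by (rule order_trans[OF sum_abs]) (simp add: abs_mult mult.commute)
    ultimately have "\<bar>v x - ?I \<omega>\<bar>
        \<le> \<epsilon> + (\<Sum>k\<in>multi_indices N. \<bar>?l k\<bar> * ?d k \<omega>)"
      using int by linarith
    then have "ennreal \<bar>v x - ?I \<omega>\<bar>
        \<le> ennreal (\<epsilon> + (\<Sum>k\<in>multi_indices N. \<bar>?l k\<bar> * ?d k \<omega>))"
      by (rule ennreal_leI)
    also have "\<dots> = ennreal \<epsilon> + (\<Sum>k\<in>multi_indices N. ennreal \<bar>?l k\<bar> * ennreal (?d k \<omega>))"
      using \<epsilon> by (subst ennreal_plus) (auto intro!: sum_nonneg simp: sum_ennreal[symmetric] ennreal_mult)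
    finally show "ennreal \<bar>v x - ?I \<omega>\<bar>
        \<le> ennreal \<epsilon> + (\<Sum>k\<in>multi_indices N. ennreal \<bar>?l k\<bar> * ennreal (?d k \<omega>))" .
  qed
  also have "\<dots> = ennreal \<epsilon> + (\<Sum>k\<in>multi_indices N. ennreal \<bar>?l k\<bar> * (\<integral>\<^sup>+\<omega>. ennreal (?d k \<omega>) \<partial>M))"
    using w by (simp add: nn_integral_add nn_integral_sum nn_integral_cmult emeasure_space_1)
  also have "\<dots> \<le> ennreal \<epsilon> + (\<Sum>k\<in>multi_indices N. ennreal \<bar>?l k\<bar> * ennreal d)"
    using le by (intro add_left_mono sum_mono mult_left_mono) auto
  also have "\<dots> = ennreal (\<epsilon> + (\<Sum>k\<in>multi_indices N. \<bar>?l k\<bar>) * d)"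
    using \<epsilon> d by (simp add: sum_distrib_right ennreal_plus sum_nonneg flip: ennreal_mult)
  also have "\<dots> \<le> ennreal (\<epsilon> + lebesgue_const xl xu N * d)"
    using sum_lagrange_le_lebesgue_const[OF x] d by (intro ennreal_leI add_left_mono mult_right_mono)
  finally show ?thesis .
qed

theorem theorem3p3:
  fixes M :: "'w measure"
    and X :: "real \<Rightarrow> 'w \<Rightarrow> real^'d"
    and K :: "real \<Rightarrow> real \<Rightarrow> real^'d \<Rightarrow> (real^'d) measure"
    and T :: real
    and t :: "nat \<Rightarrow> real"
    and n :: nat
    and f :: "real \<Rightarrow> real \<Rightarrow> real"
    and g :: "real \<Rightarrow> real^'d \<Rightarrow> real"
    and Lf :: real
    and xl xu :: "real^'d"
    and N :: "nat^'d"
    and \<rho> :: "nat \<Rightarrow> real^'d"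
    and B :: "nat \<Rightarrow> real"
    and \<epsilon>tr \<epsilon>gm \<delta>bar :: real
    and \<delta>star :: "nat \<Rightarrow> real"
    and samples :: nat
    and \<Gamma>h :: "nat \<Rightarrow> nat^'d \<Rightarrow> 'w \<Rightarrow> (real^'d \<Rightarrow> real) \<Rightarrow> real"
  defines "V \<equiv> value_fun f g K t n"
    and "Vh \<equiv> cheb_value xl xu N f g \<Gamma>h t n"
    and "\<Lambda> \<equiv> lebesgue_const xl xu N"
  defines "C \<equiv> \<Lambda> * Lf * (1 + \<epsilon>gm)"
  assumes markov: "markov_process M T X K"
    and times: "0 \<le> t 0" "\<And>u. u < n \<Longrightarrow> t u < t (Suc u)" "t n = T"
    and g_cont: "continuous_on ({0..T} \<times> UNIV) (\<lambda>(s, x). g s x)"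
    and g_int: "(\<integral>\<^sup>+\<omega>. (SUP s\<in>{0..T}. ennreal \<bar>g s (X s \<omega>)\<bar>) \<partial>M) < \<infinity>"
    and f_lipschitz: "\<And>x1 y1 x2 y2. \<bar>f x1 y1 - f x2 y2\<bar> \<le> Lf * (\<bar>x1 - x2\<bar> + \<bar>y1 - y2\<bar>)"
    and cond_exp_exists: "\<And>u x. u < n \<Longrightarrow> integrable (K (t u) (t (Suc u)) x) (V (Suc u))"
    and box: "\<And>i. xl $ i < xu $ i"
    and degrees: "\<And>i. 1 \<le> N $ i"
    and rho: "\<And>u i. u \<in> {1..n} \<Longrightarrow> 1 < \<rho> u $ i"
    and analyticity: "\<And>u. u \<in> {1..n} \<Longrightarrow> analytic_extension_bounded xl xu (\<rho> u) (B u) (V u)"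
    and eps_tr: "0 \<le> \<epsilon>tr"
    and truncation: "\<And>u k. u < n \<Longrightarrow> k \<in> multi_indices N \<Longrightarrow>
      \<bar>gen_moment xl xu N K t u k (\<lambda>y. V (Suc u) y * indicator (- cbox xl xu) y)\<bar> \<le> \<epsilon>tr"
    and operators: "random_linear_ops M xl xu N n \<Gamma>h"
    and moments: "(GM M xl xu N K t n \<Gamma>h \<delta>bar \<and> \<epsilon>gm = \<delta>bar) \<or>
      (GM_star M xl xu N K t n \<Gamma>h (\<delta>star samples) \<and> \<epsilon>gm = \<delta>star samples)"
  shows "\<forall>u\<in>{1..n}. cheb_error M xl xu (V u) (Vh u) \<le> ennreal (
      (\<Sum>j=u..n. C ^ (j - u) * eps_int (\<rho> j) N (B j)) +
      \<Lambda> * Lf * (\<Sum>j=u+1..n. C ^ (j - (u + 1)) * (\<epsilon>tr + \<epsilon>gm * max_norm xl xu (V j))))"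
proof
  fix u0 assume u0: "u0 \<in> {1..n}"
  let ?J = "multi_indices N"
  let ?x = "cheb_node xl xu N"
  have M: "prob_space M"
    using markov by (simp add: markov_process_def)
  interpret prob_space M by fact
  have t_ge: "0 \<le> t u" if "u \<le> n" for u
    using that
  proof (induction u)
    case (Suc u)
    then show ?case using times(2)[of u] by simp
  qed (use times(1) in simp)
  have t_le: "t u \<le> T" if "u \<le> n" for u
    using that
  proof (induction u rule: inc_induct)
    case (step u)
    then show ?case using times(2)[of u] by simp
  qed (use times(3) in simp)
  have \<kappa>: "prob_space (K (t u) (t (Suc u)) x)" "sets (K (t u) (t (Suc u)) x) = sets borel" if "u < n" for u x
    using that times(2)[of u] by (intro markov_kernel_prob[OF markov] t_ge t_le; simp)+
  have Lf: "0 \<le> Lf"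
    using order_trans[OF abs_ge_zero f_lipschitz[of 1 0 0 0]] by simp
  \<comment> \<open>Lipschitz continuity in the second argument keeps the nodal values measurable
    along the recursion.\<close>
  have f_meas: "f a \<in> borel_measurable borel" for a
  proof -
    have "Lf-lipschitz_on UNIV (f a)"
      using Lf f_lipschitz[of a _ a] by (intro lipschitz_onI) (auto simp: dist_real_def)
    then show ?thesis
      by (intro borel_measurable_continuous_onI lipschitz_on_continuous_on)
  qed

  \<comment> \<open>The nodal values of the method and their measurability\<close>
  define w where "w u \<omega> k = (if n \<le> u then g (t n) (?x k) else f (g (t u) (?x k)) (\<Gamma>h u k \<omega> (Vh (Suc u) \<omega>)))" for u \<omega> k
  have Vh_w: "Vh u \<omega> = cheb_interp xl xu N (w u \<omega>)" for u \<omega>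
    unfolding w_def[abs_def] Vh_def by (subst cheb_value.simps) simp
  have Vh_comb: "Vh u \<omega> = cheb_comb xl xu N (cheb_coeff N (w u \<omega>))" for u \<omega>
    by (simp add: Vh_w cheb_interp_def)
  have coeff_meas: "(\<lambda>\<omega>. cheb_coeff N (w u \<omega>) j) \<in> borel_measurable M"
    if "\<forall>k\<in>?J. (\<lambda>\<omega>. w u \<omega> k) \<in> borel_measurable M" for u j
    unfolding cheb_coeff_def using that by (intro borel_measurable_times borel_measurable_const borel_measurable_sum) auto
  have op_meas: "(\<lambda>\<omega>. \<Gamma>h u k \<omega> (Vh (Suc u) \<omega>)) \<in> borel_measurable M"
    if "\<forall>k\<in>?J. (\<lambda>\<omega>. w (Suc u) \<omega> k) \<in> borel_measurable M" "u < n" "k \<in> ?J" for u k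
  proof -
    have "(\<lambda>\<omega>. \<Gamma>h u k \<omega> (cheb_basis xl xu j)) \<in> borel_measurable M" if "j \<in> ?J" for j
      using operators \<open>u < n\<close> \<open>k \<in> ?J\<close> cheb_basis_in_cheb_space[OF that] unfolding random_linear_ops_def by blast
    then have "(\<lambda>\<omega>. \<Sum>j\<in>?J. cheb_coeff N (w (Suc u) \<omega>) j * \<Gamma>h u k \<omega> (cheb_basis xl xu j)) \<in> borel_measurable M"
      using coeff_meas[OF that(1)] by (intro borel_measurable_sum borel_measurable_times)
    then show ?thesis
      unfolding Vh_comb by (subst measurable_cong[OF random_linear_ops_cheb_comb[OF operators that(2,3)]])
  qed
  have w_meas: "\<forall>k\<in>?J. (\<lambda>\<omega>. w u \<omega> k) \<in> borel_measurable M" if "u \<le> n" for u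
    using that
  proof (induction u rule: inc_induct)
    case base
    then show ?case by (simp add: w_def)
  next
    case (step u)
    show ?case
    proof
      fix k assume "k \<in> ?J"
      from measurable_compose[OF op_meas[OF step.IH \<open>u < n\<close> this] f_meas]
      show "(\<lambda>\<omega>. w u \<omega> k) \<in> borel_measurable M"
        using \<open>u < n\<close> by (simp add: w_def)
    qed
  qed
  have gm0: "0 \<le> \<epsilon>gm"
    using moments
  proof
    assume gm: "GM M xl xu N K t n \<Gamma>h \<delta>bar \<and> \<epsilon>gm = \<delta>bar"
    obtain \<omega> where \<omega>: "\<omega> \<in> space M"
      using not_empty by blast
    have J0: "0 \<in> ?J"
      by (simp add: multi_indices_def)
    have "0 < n"
      using u0 by simp
    have "0 \<le> \<delta>bar"
      by (rule GM_bound(2)[where K = K and t = t and p = "cheb_basis xl xu 0" and m = 1,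
        OF box M operators \<open>0 < n\<close> J0 \<kappa>[OF \<open>0 < n\<close>] _ \<omega> cheb_basis_in_cheb_space[OF J0]])
        (use gm abs_cheb_basis_le[OF box] in auto)
    then show ?thesis
      using gm by simp
  qed (auto simp: GM_star_def)
  \<comment> \<open>The common form of both alternatives, after which the induction no longer
    distinguishes them. The bound \<open>s\<close> on the iterate is later supplied by its error
    plus \<open>Vb\<close>.\<close>
  have moment: "(\<integral>\<^sup>+\<omega>. ennreal \<bar>gen_moment xl xu N K t u k (Vh (Suc u) \<omega>) - \<Gamma>h u k \<omega> (Vh (Suc u) \<omega>)\<bar> \<partial>M) \<le> ennreal (\<epsilon>gm * s)"
    if u: "u < n" and k: "k \<in> ?J" and s: "0 \<le> s"
      "\<And>x. x \<in> cbox xl xu \<Longrightarrow> (\<integral>\<^sup>+\<omega>. ennreal \<bar>Vh (Suc u) \<omega> x\<bar> \<partial>M) \<le> ennreal s" for u k s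
    using moments
  proof
    let ?D = "\<lambda>\<omega>. \<bar>gen_moment xl xu N K t u k (Vh (Suc u) \<omega>) - \<Gamma>h u k \<omega> (Vh (Suc u) \<omega>)\<bar>"
    assume gm: "GM M xl xu N K t n \<Gamma>h \<delta>bar \<and> \<epsilon>gm = \<delta>bar"
    then obtain G where G: "\<And>u k \<omega> p. u < n \<Longrightarrow> k \<in> ?J \<Longrightarrow> \<omega> \<in> space M \<Longrightarrow> p \<in> cheb_space xl xu N \<Longrightarrow> \<Gamma>h u k \<omega> p = G u k p"
      unfolding GM_def by blast
    \<comment> \<open>(GM) bounds the moments by the maximum norm, which here equals the norm of (GM*) because the
      iterates do not depend on \<open>\<omega>\<close>.\<close>
    have det: "\<forall>\<omega>\<in>space M. \<forall>\<omega>'\<in>space M. Vh u \<omega> = Vh u \<omega>'" if "u \<le> n" for u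
      using that
    proof (induction u rule: inc_induct)
      case base
      then show ?case by (simp add: Vh_w w_def[abs_def])
    next
      case (step u)
      show ?case
      proof (intro ballI)
        fix \<omega> \<omega>' assume \<omega>: "\<omega> \<in> space M" "\<omega>' \<in> space M"
        then have "Vh (Suc u) \<omega> = Vh (Suc u) \<omega>'"
          using step.IH by blast
        moreover have "Vh (Suc u) \<omega>' \<in> cheb_space xl xu N"
          unfolding Vh_comb cheb_space_def by simp
        ultimately have "w u \<omega> k = w u \<omega>' k" if "k \<in> ?J" for k
          using G[OF \<open>u < n\<close> that] \<omega> by (simp add: w_def)
        then have "cheb_coeff N (w u \<omega>) = cheb_coeff N (w u \<omega>')"
          by (auto simp: cheb_coeff_def fun_eq_iff)
        then show "Vh u \<omega> = Vh u \<omega>'"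
          by (simp add: Vh_comb)
      qed
    qed
    have "ennreal (?D \<omega>) \<le> ennreal (\<epsilon>gm * s)"
      if \<omega>: "\<omega> \<in> space M" for \<omega>
    proof (rule ennreal_leI)
      have "\<bar>Vh (Suc u) \<omega> x\<bar> \<le> s" if "x \<in> cbox xl xu" for x
      proof -
        have "(\<integral>\<^sup>+\<omega>'. ennreal \<bar>Vh (Suc u) \<omega>' x\<bar> \<partial>M) = (\<integral>\<^sup>+\<omega>'. ennreal \<bar>Vh (Suc u) \<omega> x\<bar> \<partial>M)"
          using det[of "Suc u"] u \<omega> by (intro nn_integral_cong) (metis Suc_leI)
        then show ?thesis
          using s(2)[OF that] s(1) by (simp add: emeasure_space_1)
      qed
      then show "?D \<omega> \<le> \<epsilon>gm * s"
        using gm by (intro GM_bound(1)[where K = K and t = t, OF box M operators u k \<kappa>[OF u] _ \<omega>]) (auto simp: Vh_comb cheb_space_def)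
    qed
    then have "(\<integral>\<^sup>+\<omega>. ennreal (?D \<omega>) \<partial>M)
        \<le> (\<integral>\<^sup>+\<omega>. ennreal (\<epsilon>gm * s) \<partial>M)"
      by (rule nn_integral_mono)
    then show ?thesis
      by (simp add: emeasure_space_1)
  next
    let ?p = "\<lambda>\<omega>. cheb_comb xl xu N (\<lambda>j. cheb_coeff N (w (Suc u) \<omega>) j)"
    assume gm: "GM_star M xl xu N K t n \<Gamma>h (\<delta>star samples) \<and> \<epsilon>gm = \<delta>star samples"
    have le: "star_norm M xl xu ?p \<le> ennreal s"
      unfolding star_norm_def using s(2) by (intro SUP_least) (simp add: Vh_comb)
    have "(\<integral>\<^sup>+\<omega>. ennreal \<bar>gen_moment xl xu N K t u k (?p \<omega>)
        - \<Gamma>h u k \<omega> (?p \<omega>)\<bar> \<partial>M)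
      \<le> ennreal (\<delta>star samples) * star_norm M xl xu ?p"
    proof (rule GM_star_bound[where K = K and t = t, OF box degrees M operators u k \<kappa>[OF u]])
      show "(\<lambda>\<omega>. cheb_coeff N (w (Suc u) \<omega>) j) \<in> borel_measurable M" for j
        using u by (intro coeff_meas w_meas) simp
      show "star_norm M xl xu ?p < \<infinity>"
        using le by (rule le_less_trans) simp
    qed (use gm in simp)
    also have "\<dots> \<le> ennreal \<epsilon>gm * ennreal s"
      using gm le by (intro mult_mono) auto
    finally show ?thesis
      using gm0 s(1) by (simp add: Vh_comb ennreal_mult)
  qed

  \<comment> \<open>The claimed bound as the solution of a backward recursion\<close>
  define ei where "ei u = eps_int (\<rho> u) N (B u)" for u
  define Vb where "Vb u = max_norm xl xu (V u)" for u
  have xl_in: "xl \<in> cbox xl xu"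
    using box by (auto simp: mem_box_cart intro: less_imp_le)
  have intp: "\<bar>V u x - cheb_interp xl xu N (\<lambda>k. V u (?x k)) x\<bar> \<le> ei u" if "u \<in> {1..n}" "x \<in> cbox xl xu" for u x
    unfolding ei_def using that by (intro cheb_interp_error_le_eps_int box degrees rho analyticity)
  have ei0: "0 \<le> ei u" if "u \<in> {1..n}" for u
    using intp[OF that xl_in] by linarith
  have Vb: "\<bar>V u x\<bar> \<le> Vb u" if "u \<in> {1..n}" "x \<in> cbox xl xu" for u x
  proof -
    have "\<bar>V u x\<bar> \<le> B u" if "x \<in> cbox xl xu" for x
      using \<open>u \<in> {1..n}\<close> that by (intro analytic_extension_abs_le[OF box _ analyticity] rho)
    then have "bdd_above ((\<lambda>x. \<bar>V u x\<bar>) ` cbox xl xu)"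
      by (intro bdd_aboveI2)
    then show ?thesis
      unfolding Vb_def max_norm_def using that by (intro cSUP_upper)
  qed
  have Vb0: "0 \<le> Vb u" if "u \<in> {1..n}" for u
    using Vb[OF that xl_in] by linarith
  have \<Lambda>0: "0 \<le> \<Lambda>"
    unfolding \<Lambda>_def using order_trans[OF _ sum_lagrange_le_lebesgue_const[OF xl_in]] by (simp add: sum_nonneg)
  have C0: "0 \<le> C"
    unfolding C_def using \<Lambda>0 Lf gm0 by simp
  define R where "R u = (\<Sum>j=u..n. C ^ (j - u) * ei j) +
      \<Lambda> * Lf * (\<Sum>j=u+1..n. C ^ (j - (u + 1)) * (\<epsilon>tr + \<epsilon>gm * Vb j))" for u
  have R0: "0 \<le> R u" if "1 \<le> u" for u
    unfolding R_def using that C0 \<Lambda>0 Lf gm0 eps_tr ei0 Vb0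
    by (intro add_nonneg_nonneg mult_nonneg_nonneg sum_nonneg zero_le_power) auto
  have R_n: "R n = ei n"
    by (simp add: R_def)
  \<comment> \<open>The previous error enters twice, through the conditional expectation with factor
    1 and through the moment error with factor \<open>\<epsilon>gm\<close>; this is the origin of
    \<open>1 + \<epsilon>gm\<close> in \<open>C\<close>.\<close>
  have R_step: "R u = ei u + \<Lambda> * (Lf * (\<epsilon>tr + R (Suc u) + \<epsilon>gm * (R (Suc u) + Vb (Suc u))))" if "u < n" for u
  proof -
    have 1: "(\<Sum>j=u..n. C ^ (j - u) * ei j) = ei u + C * (\<Sum>j=Suc u..n. C ^ (j - Suc u) * ei j)"
      using that by (simp add: sum.atLeast_Suc_atMost[of u n] sum_distrib_left mult.assoc Suc_diff_le flip: power_Suc)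
        (intro sum.cong refl, auto simp: Suc_diff_Suc simp flip: power_Suc mult.assoc)
    have 2: "(\<Sum>j=u+1..n. C ^ (j - (u + 1)) * (\<epsilon>tr + \<epsilon>gm * Vb j))
        = (\<epsilon>tr + \<epsilon>gm * Vb (Suc u)) + C * (\<Sum>j=Suc u+1..n. C ^ (j - (Suc u + 1)) * (\<epsilon>tr + \<epsilon>gm * Vb j))"
      using that by (simp add: sum.atLeast_Suc_atMost[of "Suc u" n] sum_distrib_left)
        (intro sum.cong refl, auto simp: Suc_diff_Suc simp flip: power_Suc mult.assoc)
    have "R u = ei u + C * R (Suc u) + \<Lambda> * Lf * (\<epsilon>tr + \<epsilon>gm * Vb (Suc u))"
      unfolding R_def 1 2 by (simp add: algebra_simps)
    then show ?thesis
      by (simp add: C_def algebra_simps)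
  qed
  \<comment> \<open>Induction from \<open>n\<close> downwards. The restriction
    \<open>1 \<le> u\<close> is carried along because analyticity is assumed from the first index
    on.\<close>
  have main: "\<forall>x\<in>cbox xl xu. (\<integral>\<^sup>+\<omega>. ennreal \<bar>V u x - Vh u \<omega> x\<bar> \<partial>M) \<le> ennreal (R u)" if "u \<le> n" "1 \<le> u" for u
    using that
  proof (induction u rule: inc_induct)
    case base
    have "V n = g (t n)"
      unfolding V_def by (subst value_fun.simps) simp
    then have "\<bar>V n x - Vh n \<omega> x\<bar> \<le> ei n" if "x \<in> cbox xl xu" for x \<omega>
      using intp[OF _ that, of n] base by (simp add: Vh_w w_def[abs_def])
    then have "(\<integral>\<^sup>+\<omega>. ennreal \<bar>V n x - Vh n \<omega> x\<bar> \<partial>M) \<le> (\<integral>\<^sup>+\<omega>. ennreal (ei n) \<partial>M)" if "x \<in> cbox xl xu" for x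
      using that by (intro nn_integral_mono ennreal_leI)
    then show ?case
      by (simp add: R_n emeasure_space_1)
  next
    case (step u)
    let ?e = "R (Suc u)"
    let ?d = "Lf * (\<epsilon>tr + ?e + \<epsilon>gm * (?e + Vb (Suc u)))"
    have u: "u < n" "u \<in> {1..n}" "Suc u \<in> {1..n}"
      using step by auto
    have e0: "0 \<le> ?e" "0 \<le> Vb (Suc u)"
      using u by (auto intro: R0 Vb0)
    have IH: "(\<integral>\<^sup>+\<omega>. ennreal \<bar>V (Suc u) x - Vh (Suc u) \<omega> x\<bar> \<partial>M) \<le> ennreal ?e" if "x \<in> cbox xl xu" for x
      using step.IH that by simp
    have wm: "\<forall>k\<in>?J. (\<lambda>\<omega>. w (Suc u) \<omega> k) \<in> borel_measurable M"
      using u by (intro w_meas) simp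
    have Vhm: "(\<lambda>\<omega>. Vh (Suc u) \<omega> x) \<in> borel_measurable M" for x
      unfolding Vh_comb cheb_comb_def using coeff_meas[OF wm] by measurable
    have s: "(\<integral>\<^sup>+\<omega>. ennreal \<bar>Vh (Suc u) \<omega> x\<bar> \<partial>M) \<le> ennreal (?e + Vb (Suc u))" if x: "x \<in> cbox xl xu" for x
    proof -
      have "(\<integral>\<^sup>+\<omega>. ennreal \<bar>Vh (Suc u) \<omega> x\<bar> \<partial>M)
          \<le> (\<integral>\<^sup>+\<omega>. ennreal \<bar>V (Suc u) x - Vh (Suc u) \<omega> x\<bar> + ennreal (Vb (Suc u)) \<partial>M)"
      proof (rule nn_integral_mono)
        fix \<omega>
        have "\<bar>Vh (Suc u) \<omega> x\<bar> \<le> \<bar>V (Suc u) x - Vh (Suc u) \<omega> x\<bar> + Vb (Suc u)"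
          using Vb[OF u(3) x] by linarith
        then show "ennreal \<bar>Vh (Suc u) \<omega> x\<bar> \<le> ennreal \<bar>V (Suc u) x - Vh (Suc u) \<omega> x\<bar> + ennreal (Vb (Suc u))"
          using e0 by (simp add: ennreal_leI flip: ennreal_plus)
      qed
      also have "\<dots> = (\<integral>\<^sup>+\<omega>. ennreal \<bar>V (Suc u) x - Vh (Suc u) \<omega> x\<bar> \<partial>M) + ennreal (Vb (Suc u))"
        using Vhm by (simp add: nn_integral_add emeasure_space_1)
      also have "\<dots> \<le> ennreal ?e + ennreal (Vb (Suc u))"
        using IH[OF x] by (rule add_right_mono)
      finally show ?thesis
        using e0 by (simp add: ennreal_plus)
    qed
    have nodal: "(\<integral>\<^sup>+\<omega>. ennreal \<bar>V u (?x k) - w u \<omega> k\<bar> \<partial>M) \<le> ennreal ?d" if k: "k \<in> ?J" for k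
    proof -
      let ?\<Gamma> = "\<integral>y. V (Suc u) y \<partial>K (t u) (t (Suc u)) (?x k)"
      have "V u (?x k) = f (g (t u) (?x k)) ?\<Gamma>"
        unfolding V_def using u by (subst value_fun.simps) simp
      \<comment> \<open>Both sides use the exact payoff \<open>g\<close> at the node, so only the
        second argument of \<open>f\<close> contributes to the error.\<close>
      then have "\<bar>V u (?x k) - w u \<omega> k\<bar> \<le> Lf * \<bar>?\<Gamma> - \<Gamma>h u k \<omega> (Vh (Suc u) \<omega>)\<bar>" for \<omega>
        using f_lipschitz[of "g (t u) (?x k)" ?\<Gamma> "g (t u) (?x k)"] u by (simp add: w_def)
      then have "(\<integral>\<^sup>+\<omega>. ennreal \<bar>V u (?x k) - w u \<omega> k\<bar> \<partial>M)
          \<le> (\<integral>\<^sup>+\<omega>. ennreal Lf * ennreal \<bar>?\<Gamma> - \<Gamma>h u k \<omega> (Vh (Suc u) \<omega>)\<bar> \<partial>M)"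
        using Lf by (intro nn_integral_mono) (simp add: ennreal_leI flip: ennreal_mult)
      also have "\<dots> = ennreal Lf * (\<integral>\<^sup>+\<omega>. ennreal \<bar>?\<Gamma> - \<Gamma>h u k \<omega> (Vh (Suc u) \<omega>)\<bar> \<partial>M)"
        using op_meas[OF wm u(1) k] by (intro nn_integral_cmult) simp
      also have "(\<integral>\<^sup>+\<omega>. ennreal \<bar>?\<Gamma> - \<Gamma>h u k \<omega> (Vh (Suc u) \<omega>)\<bar> \<partial>M)
          \<le> ennreal \<epsilon>tr + ennreal ?e + ennreal (\<epsilon>gm * (?e + Vb (Suc u)))"
      proof (rule conditional_expectation_step[OF box M \<kappa>[OF u(1)] cond_exp_exists[OF u(1)]])
        show "(\<lambda>\<omega>. cheb_coeff N (w (Suc u) \<omega>) j) \<in> borel_measurable M" for j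
          by (rule coeff_meas[OF wm])
        show "(\<lambda>\<omega>. \<Gamma>h u k \<omega> (Vh (Suc u) \<omega>)) \<in> borel_measurable M"
          by (rule op_meas[OF wm u(1) k])
        show "\<bar>\<integral>y. V (Suc u) y * indicator (- cbox xl xu) y \<partial>K (t u) (t (Suc u)) (?x k)\<bar> \<le> \<epsilon>tr"
          using truncation[OF u(1) k] by (simp add: gen_moment_def)
        show "(\<integral>\<^sup>+\<omega>. ennreal \<bar>V (Suc u) x - cheb_comb xl xu N (cheb_coeff N (w (Suc u) \<omega>)) x\<bar> \<partial>M) \<le> ennreal ?e"
          if "x \<in> cbox xl xu" for x
          using IH[OF that] by (simp add: Vh_comb)
        show "(\<integral>\<^sup>+\<omega>. ennreal \<bar>(\<integral>y. cheb_comb xl xu N (cheb_coeff N (w (Suc u) \<omega>)) y \<partial>K (t u) (t (Suc u)) (?x k))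
            - \<Gamma>h u k \<omega> (Vh (Suc u) \<omega>)\<bar> \<partial>M) \<le> ennreal (\<epsilon>gm * (?e + Vb (Suc u)))"
          using moment[OF u(1) k _ s] e0 by (simp add: gen_moment_def Vh_comb)
      qed
      also have "ennreal Lf * (ennreal \<epsilon>tr + ennreal ?e + ennreal (\<epsilon>gm * (?e + Vb (Suc u)))) = ennreal ?d"
        using Lf e0 gm0 eps_tr by (simp add: ennreal_mult ennreal_plus)
      finally show ?thesis
        by (simp add: mult_left_mono)
    qed
    show ?case
    proof
      fix x assume x: "x \<in> cbox xl xu"
      have "(\<integral>\<^sup>+\<omega>. ennreal \<bar>V u x - cheb_interp xl xu N (\<lambda>k. w u \<omega> k) x\<bar> \<partial>M) \<le> ennreal (ei u + lebesgue_const xl xu N * ?d)"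
        using Lf e0 gm0 eps_tr w_meas[of u] u
        by (intro cheb_interp_error_propagation[OF box degrees M x intp[OF u(2) x] _ nodal]) auto
      then show "(\<integral>\<^sup>+\<omega>. ennreal \<bar>V u x - Vh u \<omega> x\<bar> \<partial>M) \<le> ennreal (R u)"
        by (simp add: Vh_w R_step[OF u(1)] \<Lambda>_def)
    qed
  qed
  show "cheb_error M xl xu (V u0) (Vh u0) \<le> ennreal (
      (\<Sum>j=u0..n. C ^ (j - u0) * eps_int (\<rho> j) N (B j)) +
      \<Lambda> * Lf * (\<Sum>j=u0+1..n. C ^ (j - (u0 + 1)) * (\<epsilon>tr + \<epsilon>gm * max_norm xl xu (V j))))"
    using main[of u0] u0 unfolding cheb_error_def R_def ei_def Vb_def by (intro SUP_least) auto
qed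

end
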